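(* Let $(\Omega,\mu)$ be a standard probability space and let $X$ be a separable, geodesically complete CAT$(0)$ space which is affinely rigid with respect to CAT$(0)$ spaces and not isometric to $\mathbb R$. A map $\gamma:L^2(\Omega,X)\to L^2(\Omega,X)$ is an isometry if and only if there exist an almost everywhere bijective map $\varphi:\Omega\to\Omega$ with $\varphi_*\mu\sim\mu$, and an almost everywhere defined map $\rho:\Omega\to\operatorname{Dil}(X)$ with $$\operatorname{dil}(\rho(\omega))=\left(\sqrt{\frac{d(\varphi_*\mu)}{d\mu}(\omega)}\right)^{-1}$$ and $\rho(\cdot)(x)\in L^2(\Omega,X)$ for some $x\in X$, such that for every $f\in L^2(\Omega,X)$, $\gamma(f)(\omega)=\rho(\varphi(\omega))\big(f(\varphi(\omega))\big)$ for $\mu$-a.e. $\omega\in\Omega$.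
   Context: A standard probability space is a probability space isomorphic (modulo null sets) to $[0,1]\sqcup\mathbb N$ with the measure $c\lambda+\sum_{n\ge1}p_n\delta_n$, where $c,p_n\ge0$, $c+\sum_n p_n=1$, $\lambda$ is Lebesgue measure and $\delta_n$ is the Dirac measure at $n$. A map $\varphi:\Omega\to\Omega$ is almost everywhere bijective if there are null sets $N_1,N_2\subset\Omega$ such that $\varphi$ restricts to a bijection $\Omega\setminus N_1\to\Omega\setminus N_2$. $\mu\sim\nu$ means that the measures are mutually absolutely continuous. For a finite measure space $(\Omega,\mu)$ and a metric space $(X,d)$, $L^2(\Omega,X)$ is the space of measurable maps $f:\Omega\to X$ with separable range (modulo null sets) such that $\int_\Omega d^2(f(\omega),x)\,d\mu(\omega)<\infty$ for some (equivalently any) $x\in X$, with the metric $d_{L^2}(f,g)=\left(\int_\Omega d^2(f,g)\,d\mu\right)^{1/2}$. An isometry is a distance-preserving bijection. A geodesic is an isometric embedding of an interval. CAT$(0)$ spaces are understood to be complete geodesic spaces. A CAT$(0)$ space is geodesically complete if every nontrivial geodesic segment extends to a geodesic line $\mathbb R\to X$. A map $f:X\to Y$ of metric spaces is affine if for each geodesic $c:I\to X$ there is a factor $\rho(c)\ge0$ such that $f\circ c$ is a geodesic linearly reparametrized by the factor $\rho(c)$ (so $d_Y(f(c(s)),f(c(t)))=\rho(c)|s-t|$). It is a dilation if this factor is independent of $c$; the common factor of a dilation $f$ is denoted $\operatorname{dil}(f)$. $\operatorname{Dil}_\lambda(X)$ is the set of dilations $X\to X$ with factor $\lambda\geq 0$,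 and $\operatorname{Dil}(X)=\bigsqcup_{\lambda\ge0}\operatorname{Dil}_\lambda(X)$. $X$ is affinely rigid with respect to CAT$(0)$ spaces if every affine map from $X$ into any CAT$(0)$ space is a dilation.
   Formalization: The dilations ρ(ω) are also required to be surjective for a.e. ω, and ρ(·)(x) is required to be in L² with respect to φ_*μ rather than μ; as printed, the "if" and the "only if" direction respectively have counterexamples. *)

theory Defs
  imports "HOL-Probability.Probability"
begin

section \<open>Standard probability spaces\<close>

text \<open>
  The disjoint union of \<open>[0,1]\<close> and \<open>\<nat>\<close> carrying \<open>c\<close> times Lebesgue measure plus an atom of mass
  \<open>p n\<close> at every \<open>n\<close>; its measurable sets are the Borel sets.
\<close>

definition std_model :: "real \<Rightarrow> (nat \<Rightarrow> real) \<Rightarrow> (real + nat) measure" where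
  "std_model c p =
     measure_of ({0..1} <+> UNIV)
       {A. A \<subseteq> {0..1} <+> UNIV \<and> Inl -` A \<in> sets borel}
       (\<lambda>A. ennreal c * emeasure lborel (Inl -` A) + (\<Sum>n. ennreal (p n) * indicator A (Inr n)))"

definition isomorphic_mod_null :: "'a measure \<Rightarrow> 'b measure \<Rightarrow> bool" where
  "isomorphic_mod_null M N \<longleftrightarrow>
     (\<exists>A\<in>null_sets M. \<exists>B\<in>null_sets N. \<exists>\<psi>.
        bij_betw \<psi> (space M - A) (space N - B) \<and>
        \<psi> \<in> measurable (restrict_space M (space M - A)) (restrict_space N (space N - B)) \<and>
        the_inv_into (space M - A) \<psi>
          \<in> measurable (restrict_space N (space N - B)) (restrict_space M (space M - A)) \<and>
        distr (restrict_space M (space M - A)) (restrict_space N (space N - B)) \<psi>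
          = restrict_space N (space N - B))"

text \<open>
  Both conventions for the measurable sets of the model are admitted: Borel sets, or Lebesgue
  measurable sets (the completion).
\<close>

definition standard_prob_space :: "'a measure \<Rightarrow> bool" where
  "standard_prob_space M \<longleftrightarrow>
     prob_space M \<and>
     (\<exists>c p. 0 \<le> c \<and> (\<forall>n. 0 \<le> p n) \<and> summable p \<and> c + (\<Sum>n. p n) = 1 \<and>
        (isomorphic_mod_null M (std_model c p) \<or>
         isomorphic_mod_null M (completion (std_model c p))))"

definition ae_bijective :: "'a measure \<Rightarrow> ('a \<Rightarrow> 'a) \<Rightarrow> bool" where
  "ae_bijective M \<phi> \<longleftrightarrow>
     (\<exists>N1\<in>null_sets M. \<exists>N2\<in>null_sets M. bij_betw \<phi> (space M - N1) (space M - N2))"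

definition mutually_abs_continuous :: "'a measure \<Rightarrow> 'a measure \<Rightarrow> bool" where
  "mutually_abs_continuous M N \<longleftrightarrow> absolutely_continuous M N \<and> absolutely_continuous N M"


section \<open>Isometries, geodesics and CAT(0) spaces\<close>

text \<open>
  A metric space is a carrier set together with a distance function, as in the locale
  \<^locale>\<open>Metric_space\<close>.
\<close>

definition isometry ::
  "'x set \<Rightarrow> ('x \<Rightarrow> 'x \<Rightarrow> real) \<Rightarrow> 'y set \<Rightarrow> ('y \<Rightarrow> 'y \<Rightarrow> real) \<Rightarrow> ('x \<Rightarrow> 'y) \<Rightarrow> bool" where
  "isometry X dX Y dY h \<longleftrightarrow> bij_betw h X Y \<and> (\<forall>x\<in>X. \<forall>y\<in>X. dY (h x) (h y) = dX x y)"

definition geodesic :: "'x set \<Rightarrow> ('x \<Rightarrow> 'x \<Rightarrow> real) \<Rightarrow> real set \<Rightarrow> (real \<Rightarrow> 'x) \<Rightarrow> bool" where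
  "geodesic X d I c \<longleftrightarrow>
     is_interval I \<and> (\<forall>t\<in>I. c t \<in> X) \<and> (\<forall>s\<in>I. \<forall>t\<in>I. d (c s) (c t) = \<bar>s - t\<bar>)"

definition geodesic_from_to ::
  "'x set \<Rightarrow> ('x \<Rightarrow> 'x \<Rightarrow> real) \<Rightarrow> 'x \<Rightarrow> 'x \<Rightarrow> (real \<Rightarrow> 'x) \<Rightarrow> bool" where
  "geodesic_from_to X d x y c \<longleftrightarrow> geodesic X d {0..d x y} c \<and> c 0 = x \<and> c (d x y) = y"

definition geodesic_space :: "'x set \<Rightarrow> ('x \<Rightarrow> 'x \<Rightarrow> real) \<Rightarrow> bool" where
  "geodesic_space X d \<longleftrightarrow> (\<forall>x\<in>X. \<forall>y\<in>X. \<exists>c. geodesic_from_to X d x y c)"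

text \<open>
  Geodesic triangles are no thicker than their comparison triangles in the Euclidean plane. Any two
  different sides of a triangle share a vertex, here called \<open>x\<close>; the points \<open>p\<close> and \<open>q\<close> are the
  comparison points of \<open>c s\<close> and \<open>c' t\<close>.
\<close>

definition CAT0_comparison :: "'x set \<Rightarrow> ('x \<Rightarrow> 'x \<Rightarrow> real) \<Rightarrow> bool" where
  "CAT0_comparison X d \<longleftrightarrow>
     (\<forall>x\<in>X. \<forall>y\<in>X. \<forall>z\<in>X. \<forall>c c'.
        geodesic_from_to X d x y c \<longrightarrow> geodesic_from_to X d x z c' \<longrightarrow>
        (\<forall>x' y' z' :: real^2.
           dist x' y' = d x y \<longrightarrow> dist x' z' = d x z \<longrightarrow> dist y' z' = d y z \<longrightarrow>
           (\<forall>s\<in>{0..d x y}. \<forall>t\<in>{0..d x z}.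
              \<forall>p\<in>closed_segment x' y'. \<forall>q\<in>closed_segment x' z'.
                dist x' p = s \<longrightarrow> dist x' q = t \<longrightarrow> d (c s) (c' t) \<le> dist p q)))"

definition CAT0 :: "'x set \<Rightarrow> ('x \<Rightarrow> 'x \<Rightarrow> real) \<Rightarrow> bool" where
  "CAT0 X d \<longleftrightarrow>
     Metric_space X d \<and> Metric_space.mcomplete X d \<and> geodesic_space X d \<and> CAT0_comparison X d"

definition geodesically_complete :: "'x set \<Rightarrow> ('x \<Rightarrow> 'x \<Rightarrow> real) \<Rightarrow> bool" where
  "geodesically_complete X d \<longleftrightarrow>
     (\<forall>a b c. a < b \<longrightarrow> geodesic X d {a..b} c \<longrightarrow>
        (\<exists>l. geodesic X d UNIV l \<and> (\<forall>t\<in>{a..b}. l t = c t)))"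


section \<open>Affine maps and dilations\<close>

definition affine_map ::
  "'x set \<Rightarrow> ('x \<Rightarrow> 'x \<Rightarrow> real) \<Rightarrow> 'y set \<Rightarrow> ('y \<Rightarrow> 'y \<Rightarrow> real) \<Rightarrow> ('x \<Rightarrow> 'y) \<Rightarrow> bool" where
  "affine_map X dX Y dY f \<longleftrightarrow>
     f \<in> X \<rightarrow> Y \<and>
     (\<forall>I c. geodesic X dX I c \<longrightarrow>
        (\<exists>r\<ge>0. \<forall>s\<in>I. \<forall>t\<in>I. dY (f (c s)) (f (c t)) = r * \<bar>s - t\<bar>))"

definition dilation_by ::
  "'x set \<Rightarrow> ('x \<Rightarrow> 'x \<Rightarrow> real) \<Rightarrow> 'y set \<Rightarrow> ('y \<Rightarrow> 'y \<Rightarrow> real) \<Rightarrow> real \<Rightarrow> ('x \<Rightarrow> 'y) \<Rightarrow> bool" where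
  "dilation_by X dX Y dY r f \<longleftrightarrow>
     0 \<le> r \<and> f \<in> X \<rightarrow> Y \<and>
     (\<forall>I c. geodesic X dX I c \<longrightarrow>
        (\<forall>s\<in>I. \<forall>t\<in>I. dY (f (c s)) (f (c t)) = r * \<bar>s - t\<bar>))"

text \<open>
  HOL cannot quantify over all types inside a definition, so the CAT(0) target spaces range over all
  metric spaces whose points are real numbers; the distance \<open>dY\<close> on them is arbitrary and has
  nothing to do with that of \<open>\<real>\<close>. Up to isometry these are exactly the CAT(0) spaces with at most
  continuum many points. For a source of at most continuum cardinality (in particular a separable
  one) this is no restriction: an affine map takes its values in the closed convex hull of its
  image, which is again a CAT(0) space with at most continuum many points.
\<close>

definition affinely_rigid_CAT0 :: "'x set \<Rightarrow> ('x \<Rightarrow> 'x \<Rightarrow> real) \<Rightarrow> bool" where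
  "affinely_rigid_CAT0 X dX \<longleftrightarrow>
     (\<forall>(Y :: real set) dY f. CAT0 Y dY \<longrightarrow> affine_map X dX Y dY f \<longrightarrow>
        (\<exists>r. dilation_by X dX Y dY r f))"

text \<open>
  Elements of \<open>Dil r\<close> need not be surjective, even for \<open>r > 0\<close>: a tree all of whose vertices have
  countably infinite degree embeds isometrically onto a proper subtree. A characterization of the
  bijective isometries of \<open>L\<^sup>2(\<Omega>,X)\<close> therefore has to ask for surjectivity separately. The factor is
  an argument rather than a function of the map because on a one-point space it is not determined.
\<close>

definition Dil :: "real \<Rightarrow> ('x::metric_space \<Rightarrow> 'x) set" where
  "Dil r = {f. dilation_by UNIV dist UNIV dist r f}"


section \<open>The space of square integrable maps\<close>

definition separable_range_mod_null :: "'a measure \<Rightarrow> ('a \<Rightarrow> 'x::metric_space) \<Rightarrow> bool" where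
  "separable_range_mod_null M f \<longleftrightarrow>
     (\<exists>N\<in>null_sets M. \<exists>D. countable D \<and> D \<subseteq> f ` (space M - N) \<and> f ` (space M - N) \<subseteq> closure D)"

text \<open>
  The measure is an explicit argument. For the family \<open>\<rho>\<close> with \<open>\<gamma>(f) = \<rho>(\<phi>(\<cdot>))(f(\<phi>(\<cdot>)))\<close>, square
  integrability of \<open>\<rho>(\<cdot>)(x)\<close> is meant with respect to \<open>\<phi>\<^sub>*\<mu>\<close>, equivalently that of
  \<open>\<rho>(\<phi>(\<cdot>))(x)\<close> with respect to \<open>\<mu>\<close>; with respect to \<open>\<mu>\<close> itself it can fail for all \<open>x\<close>.
\<close>

definition L2_fun :: "'a measure \<Rightarrow> ('a \<Rightarrow> 'x::metric_space) set" where
  "L2_fun M =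
     {f \<in> borel_measurable M. separable_range_mod_null M f \<and>
        (\<exists>x. integrable M (\<lambda>\<omega>. (dist (f \<omega>) x)\<^sup>2))}"

definition ae_eq :: "'a measure \<Rightarrow> (('a \<Rightarrow> 'x::metric_space) \<times> ('a \<Rightarrow> 'x)) set" where
  "ae_eq M = {(f, g). f \<in> L2_fun M \<and> g \<in> L2_fun M \<and> (AE \<omega> in M. f \<omega> = g \<omega>)}"

definition L2 :: "'a measure \<Rightarrow> ('a \<Rightarrow> 'x::metric_space) set set" where
  "L2 M = L2_fun M // ae_eq M"

definition L2_dist ::
  "'a measure \<Rightarrow> ('a \<Rightarrow> 'x::metric_space) set \<Rightarrow> ('a \<Rightarrow> 'x) set \<Rightarrow> real" where
  "L2_dist M F G =
     sqrt (LINT \<omega>|M. (dist ((SOME f. f \<in> F) \<omega>) ((SOME g. g \<in> G) \<omega>))\<^sup>2)"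

end

(* Let G be an isometry of L^2(Omega,X). For a weight 0 <= w <= 1 put E(f,g) = int w d(Gf,Gg)^2.
   Geodesics of L^2 are fibrewise geodesics, so E behaves along geodesics like a squared CAT(0)
   distance. Changing f on a set A to the constant x, affine rigidity of X gives E = c d(x,y)^2. In two
   complementary sets A, B the mixed term of E on a flat spanned by a geodesic of X and a line in the other
   factor defines an affine function X -> R; it is constant, since X is rigid and not a line. Hence
   Pythagoras holds, and E(f,g) = int w' d(f,g)^2 for a weight w' that depends on w only.
   The correspondence w -> w' is an order isomorphism (its inverse comes from the inverse of G), so it maps
   indicators to indicators: d(Gf,Gg) on B depends only on d(f,g) on a set A. On a standard
   probability space this isomorphism of measure algebras is induced by a point map phi, and comparing
   integrals over B and A yields d(Gf,Gg) = (d(f,g) / sqrt(d phi_* mu / d mu)) o phi. Applied to constant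
   functions this gives the dilations rho.
   The converse is a change of variables, together with measurability of the inverse of phi for surjectivity. *)

theory Submission
  imports Defs
begin

section \<open>CAT(0) spaces\<close>

text \<open>For X = \<real> the space is a Hilbert space, whose rotations mix the points of
  \<Omega>. What could permit such mixing in general is a nonconstant affine function X
  \<rightarrow> \<real>, and this is where the line has to be excluded.

  The image of a set under G is not known to be a set at the outset. Hence E is studied for all
  [0,1]-valued weights, and only the order isomorphism in both directions singles out the
  indicators.

  Lines chosen separately in the fibres need not depend measurably on the fibre; the geometric
  argument is therefore run on simple functions and extended by continuity.

  G of a constant is defined only up to a null set that depends on the constant, so the dilations
  are built on a countable dense set and extended. For the converse, the inverse of phi has to be
  made measurable by discarding null sets, while the sigma-algebra may be the Borel or the complete
  one; both points are settled in a real coordinate. On a one-point X distances say nothing about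
  \<Omega>, so that case is separate.\<close>

lemma geodesic_from_to_concat:
  fixes x :: "'x::metric_space"
  assumes gs: "geodesic_space (UNIV :: 'x set) dist"
    and sum: "dist x m + dist m y = dist x y"
  obtains c where "geodesic_from_to UNIV dist x y c" "c (dist x m) = m"
proof -
  obtain c1 where c1: "geodesic_from_to UNIV dist x m c1" using gs unfolding geodesic_space_def by blast
  obtain c2 where c2: "geodesic_from_to UNIV dist m y c2" using gs unfolding geodesic_space_def by blast
  define a where "a = dist x m"
  define c where "c t = (if t \<le> a then c1 t else c2 (t - a))" for t
  have d1: "dist (c1 s) (c1 t) = \<bar>s - t\<bar>" if "0 \<le> s" "s \<le> a" "0 \<le> t" "t \<le> a" for s t
    using c1 that unfolding geodesic_from_to_def geodesic_def a_def by auto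
  have d2: "dist (c2 s) (c2 t) = \<bar>s - t\<bar>" if "0 \<le> s" "s \<le> dist m y" "0 \<le> t" "t \<le> dist m y" for s t
    using c2 that unfolding geodesic_from_to_def geodesic_def by auto
  have e: "c1 0 = x" "c1 a = m" "c2 0 = m" "c2 (dist m y) = y"
    using c1 c2 unfolding geodesic_from_to_def a_def by auto
  \<comment> \<open>At most \<open>t - s\<close> by the detour through \<open>m\<close>; at least
    \<open>t - s\<close> because a shortcut would bring \<open>x\<close> and \<open>y\<close> closer
    than \<open>dist x y\<close>.\<close>
  have mix: "dist (c1 s) (c2 (t - a)) = t - s" if "0 \<le> s" "s \<le> a" "a < t" "t \<le> dist x y" for s t
  proof -
    have t: "t - a \<le> dist m y" "0 \<le> t - a" using that sum a_def by auto
    have "dist (c1 s) (c2 (t - a)) \<le> dist (c1 s) m + dist m (c2 (t - a))" by (rule dist_triangle)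
    also have "\<dots> = t - s"
      using d1[of s a] d2[of 0 "t - a"] e that t by auto
    finally have 1: "dist (c1 s) (c2 (t - a)) \<le> t - s" .
    have "dist x y \<le> dist x (c1 s) + dist (c1 s) (c2 (t - a)) + dist (c2 (t - a)) y"
      by (smt (verit) dist_triangle)
    moreover have "dist x (c1 s) = s" using d1[of 0 s] e that by auto
    moreover have "dist (c2 (t - a)) y = dist m y - (t - a)" using d2[of "t - a" "dist m y"] e t by auto
    ultimately show ?thesis using 1 sum a_def by linarith
  qed
  have "dist (c s) (c t) = \<bar>s - t\<bar>" if "0 \<le> s" "s \<le> dist x y" "0 \<le> t" "t \<le> dist x y" for s t
  proof -
    have *: "a \<le> dist x y" "dist m y = dist x y - a" using sum zero_le_dist[of m y] unfolding a_def by linarith+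
    consider "s \<le> a" "t \<le> a" | "s \<le> a" "a < t" | "a < s" "t \<le> a" | "a < s" "a < t" by linarith
    then show ?thesis
    proof cases
      case 1 then show ?thesis using d1 that c_def by auto
    next
      case 2 then show ?thesis using mix[of s t] that c_def by auto
    next
      case 3 then show ?thesis using mix[of t s] that c_def by (auto simp: dist_commute)
    next
      case 4 then show ?thesis using d2[of "s - a" "t - a"] that * c_def by auto
    qed
  qed
  moreover have "c 0 = x" using e by (auto simp: c_def a_def)
  moreover have "c (dist x y) = y"
  proof (cases "dist x y \<le> a")
    case True
    then have "dist m y = 0" "dist x y = a" using sum zero_le_dist[of m y] unfolding a_def by linarith+
    then show ?thesis using e c_def by auto
  next
    case False
    then show ?thesis using e sum by (auto simp: c_def a_def) (metis add_diff_cancel_left')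
  qed
  moreover have "c a = m" using e c_def by auto
  ultimately show ?thesis
    using that[of c] unfolding geodesic_from_to_def geodesic_def a_def
    by (auto simp: is_interval_cc)
qed

lemma comparison_triangle_exists:
  fixes a b c :: real
  assumes "0 < a" "0 \<le> b" "0 \<le> c" "a \<le> b + c" "b \<le> a + c" "c \<le> a + b"
  obtains x' y' z' :: "real^2" where "dist x' y' = a" "dist x' z' = b" "dist y' z' = c"
proof -
  \<comment> \<open>Law of cosines: \<open>u\<close> is the first coordinate of \<open>z'\<close>
    when \<open>x'\<close> is the origin and \<open>y'\<close> lies on the first axis.\<close>
  define u where "u = (a\<^sup>2 + b\<^sup>2 - c\<^sup>2) / (2 * a)"
  have ua: "2 * a * u = a\<^sup>2 + b\<^sup>2 - c\<^sup>2" using assms u_def by (simp add: field_simps)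
  have "\<bar>a\<^sup>2 + b\<^sup>2 - c\<^sup>2\<bar> \<le> 2 * a * b"
  proof -
    have "(a - b)\<^sup>2 \<le> c\<^sup>2" using assms by (intro abs_le_square_iff[THEN iffD1]) auto
    moreover have "c\<^sup>2 \<le> (a + b)\<^sup>2" using assms by (intro power_mono) auto
    ultimately show ?thesis by (auto simp: power2_eq_square algebra_simps abs_le_iff)
  qed
  then have "\<bar>u\<bar> \<le> b" using ua assms by (simp add: u_def field_simps)
  then have ub: "u\<^sup>2 \<le> b\<^sup>2" using assms by (simp add: abs_le_square_iff[symmetric])
  define v where "v = sqrt (b\<^sup>2 - u\<^sup>2)"
  have v: "v\<^sup>2 = b\<^sup>2 - u\<^sup>2" using ub v_def by simp
  define x' :: "real^2" where "x' = 0"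
  define y' :: "real^2" where "y' = vector [a, 0]"
  define z' :: "real^2" where "z' = vector [u, v]"
  have D: "dist p q = sqrt ((p$1 - q$1)\<^sup>2 + (p$2 - q$2)\<^sup>2)" for p q :: "real^2"
    by (simp add: dist_vec_def L2_set_def sum_2 dist_real_def)
  have "dist x' y' = a" using assms by (simp add: D x'_def y'_def)
  moreover have "dist x' z' = b" using assms v by (simp add: D x'_def z'_def)
  moreover have "(a - u)\<^sup>2 + v\<^sup>2 = c\<^sup>2" using v ua by (simp add: power2_eq_square algebra_simps)
  then have "dist y' z' = c" using assms by (simp add: D y'_def z'_def)
  ultimately show ?thesis using that by blast
qed

text \<open>Stewart's theorem. It turns comparison of distances into an inequality between squares,
  which can be multiplied by weights and integrated.\<close>

lemma dist2_affine_combination: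
  fixes x y z :: "'b::real_inner"
  shows "(dist z ((1 - l) *\<^sub>R x + l *\<^sub>R y))\<^sup>2 =
    (1 - l) * (dist z x)\<^sup>2 + l * (dist z y)\<^sup>2 - l * (1 - l) * (dist x y)\<^sup>2"
proof -
  have N: "(dist u v)\<^sup>2 = (u - v) \<bullet> (u - v)" for u v :: 'b
    by (simp add: dist_norm power2_norm_eq_inner)
  show ?thesis unfolding N
    by (simp add: inner_diff inner_add algebra_simps inner_commute power2_eq_square)
qed

text \<open>The Bruhat-Tits inequality at an arbitrary ratio: Stewart's theorem is its equality case
  in the comparison triangle. Describing \<open>m\<close> by its two distances makes it applicable
  to points known only almost everywhere to lie between others, with no geodesic at hand.\<close>

lemma CAT0_CN:
  fixes x y z m :: "'x::metric_space"
  assumes "CAT0 (UNIV :: 'x set) dist" and l: "0 \<le> l" "l \<le> 1"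
    and m: "dist x m = l * dist x y" "dist m y = (1 - l) * dist x y"
  shows "(dist z m)\<^sup>2 \<le> (1 - l) * (dist z x)\<^sup>2 + l * (dist z y)\<^sup>2 - l * (1 - l) * (dist x y)\<^sup>2"
proof (cases "x = y")
  case True
  then show ?thesis using m by (simp add: algebra_simps)
next
  case False
  have gs: "geodesic_space (UNIV :: 'x set) dist" and comp: "CAT0_comparison (UNIV :: 'x set) dist"
    using assms unfolding CAT0_def by auto
  have "dist x m + dist m y = dist x y" using m by (simp add: algebra_simps)
  then obtain c where c: "geodesic_from_to UNIV dist x y c" "c (dist x m) = m"
    using geodesic_from_to_concat[OF gs] by blast
  obtain c' where c': "geodesic_from_to UNIV dist x z c'" using gs unfolding geodesic_space_def by blast
  obtain x' y' z' :: "real^2" where t: "dist x' y' = dist x y" "dist x' z' = dist x z" "dist y' z' = dist y z"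
    using comparison_triangle_exists[of "dist x y" "dist x z" "dist y z"] False
    by (smt (verit) dist_commute dist_triangle zero_less_dist_iff zero_le_dist)
  define p where "p = (1 - l) *\<^sub>R x' + l *\<^sub>R y'"
  have p: "p \<in> closed_segment x' y'" using l unfolding p_def closed_segment_def by blast
  have xp: "dist x' p = l * dist x y"
  proof -
    have "x' - p = l *\<^sub>R (x' - y')" by (simp add: p_def algebra_simps)
    then show ?thesis using t l by (simp add: dist_norm)
  qed
  have lx: "l * dist x y \<le> dist x y" using l by (simp add: mult_left_le_one_le)
  have xm: "dist x m \<in> {0..dist x y}" using m lx by (metis atLeastAtMost_iff zero_le_dist)
  have "dist (c (dist x m)) (c' (dist x z)) \<le> dist p z'"
    by (rule comp[unfolded CAT0_comparison_def, rule_format, OF UNIV_I UNIV_I UNIV_I c(1) c' t xm _ p])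
      (auto simp: xp m t)
  then have "dist z m \<le> dist z' p"
    using c c' unfolding geodesic_from_to_def by (simp add: dist_commute)
  then have "(dist z m)\<^sup>2 \<le> (dist z' p)\<^sup>2" by (intro power_mono) auto
  also have "\<dots> = (1 - l) * (dist z x)\<^sup>2 + l * (dist z y)\<^sup>2 - l * (1 - l) * (dist x y)\<^sup>2"
    unfolding p_def dist2_affine_combination using t by (simp add: dist_commute)
  finally show ?thesis .
qed

text \<open>Two uses of the inequality reach a point on each side: first the distance from
  \<open>z\<close> to \<open>c s\<close> is bounded, then \<open>c s\<close> itself is the vertex
  opposite the side from \<open>x\<close> to \<open>z\<close>. The comparison triangle satisfies
  both with equality.\<close>

lemma CAT0_comparison_if_CN:
  assumes "Metric_space X d"
    and CN: "\<And>x y z c s. \<lbrakk>x \<in> X; y \<in> X; z \<in> X; geodesic_from_to X d x y c; 0 \<le> s; s \<le> 1\<rbrakk> \<Longrightarrow>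
       (d z (c (s * d x y)))\<^sup>2 \<le> (1 - s) * (d z x)\<^sup>2 + s * (d z y)\<^sup>2 - s * (1 - s) * (d x y)\<^sup>2"
  shows "CAT0_comparison X d"
  unfolding CAT0_comparison_def
proof (intro ballI allI impI)
  interpret Metric_space X d by fact
  fix x y z c c' and x' y' z' :: "real^2" and s t p q
  assume X: "x \<in> X" "y \<in> X" "z \<in> X" and c: "geodesic_from_to X d x y c" and c': "geodesic_from_to X d x z c'"
    and t: "dist x' y' = d x y" "dist x' z' = d x z" "dist y' z' = d y z"
    and st: "s \<in> {0..d x y}" "t \<in> {0..d x z}"
    and pq: "p \<in> closed_segment x' y'" "q \<in> closed_segment x' z'" "dist x' p = s" "dist x' q = t"
  from pq obtain a where a: "0 \<le> a" "a \<le> 1" "p = (1 - a) *\<^sub>R x' + a *\<^sub>R y'" unfolding closed_segment_def by blast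
  from pq obtain b where b: "0 \<le> b" "b \<le> 1" "q = (1 - b) *\<^sub>R x' + b *\<^sub>R z'" unfolding closed_segment_def by blast
  have "x' - p = a *\<^sub>R (x' - y')" by (simp add: a algebra_simps)
  then have s: "s = a * d x y" using pq t a by (metis abs_of_nonneg dist_norm norm_scaleR)
  have "x' - q = b *\<^sub>R (x' - z')" by (simp add: b algebra_simps)
  then have tt: "t = b * d x z" using pq t b by (metis abs_of_nonneg dist_norm norm_scaleR)
  have cX: "c s \<in> X" "c' t \<in> X" using c c' st unfolding geodesic_from_to_def geodesic_def by auto
  have xc: "d (c s) x = s" using c st unfolding geodesic_from_to_def geodesic_def
    by (smt (verit) atLeastAtMost_iff nonneg)
  have 1: "(d (c s) (c' t))\<^sup>2 \<le> (1 - b) * (d (c s) x)\<^sup>2 + b * (d (c s) z)\<^sup>2 - b * (1 - b) * (d x z)\<^sup>2"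
    using CN[OF X(1) X(3) cX(1) c' b(1,2)] tt by simp
  have 2: "(d z (c s))\<^sup>2 \<le> (1 - a) * (d z x)\<^sup>2 + a * (d z y)\<^sup>2 - a * (1 - a) * (d x y)\<^sup>2"
    using CN[OF X(1) X(2) X(3) c a(1,2)] s by simp
  have 3: "(dist z' p)\<^sup>2 = (1 - a) * (d z x)\<^sup>2 + a * (d z y)\<^sup>2 - a * (1 - a) * (d x y)\<^sup>2"
    unfolding a(3) dist2_affine_combination using t by (simp add: dist_commute commute)
  have "(dist p q)\<^sup>2 = (1 - b) * (dist p x')\<^sup>2 + b * (dist p z')\<^sup>2 - b * (1 - b) * (dist x' z')\<^sup>2"
    unfolding b(3) dist2_affine_combination by simp
  also have "\<dots> = (1 - b) * s\<^sup>2 + b * (dist z' p)\<^sup>2 - b * (1 - b) * (d x z)\<^sup>2"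
    using pq t by (simp add: dist_commute)
  finally have 4: "(dist p q)\<^sup>2 = \<dots>" .
  have "b * (d (c s) z)\<^sup>2 \<le> b * (dist z' p)\<^sup>2"
    using 2 3 b by (intro mult_left_mono) (auto simp: commute)
  then have "(d (c s) (c' t))\<^sup>2 \<le> (dist p q)\<^sup>2" using 1 4 xc by simp
  then show "d (c s) (c' t) \<le> dist p q" by (rule power2_le_imp_le) simp
qed

text \<open>Degenerate segments are included: if \<open>x = y\<close> there is still a line through
  \<open>x\<close>, drawn towards another point supplied by \<open>two\<close>.\<close>

lemma geodesic_line_through:
  fixes x :: "'x::metric_space"
  assumes gs: "geodesic_space (UNIV :: 'x set) dist" and gc: "geodesically_complete (UNIV :: 'x set) dist"
    and two: "\<exists>a b :: 'x. a \<noteq> b"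
    and sum: "dist x m + dist m y = dist x y"
  obtains l where "\<And>s t. dist (l s) (l t) = \<bar>s - t\<bar>" "l 0 = x" "l (dist x m) = m" "l (dist x y) = y"
proof -
  have main: "\<exists>l. (\<forall>s t. dist (l s) (l t) = \<bar>s - t\<bar>) \<and> l 0 = x \<and> l (dist x m) = m \<and> l (dist x y) = y"
    if ne: "x \<noteq> y" and sum: "dist x m + dist m y = dist x y" for y m
  proof -
    obtain c where c: "geodesic_from_to UNIV dist x y c" "c (dist x m) = m"
      using geodesic_from_to_concat[OF gs sum] by blast
    then have "geodesic UNIV dist {0..dist x y} c" unfolding geodesic_from_to_def by blast
    then obtain l where l: "geodesic UNIV dist UNIV l" "\<forall>t\<in>{0..dist x y}. l t = c t"
      using gc ne unfolding geodesically_complete_def by (metis zero_less_dist_iff)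
    have "dist x m \<le> dist x y" using sum by (smt (verit) zero_le_dist)
    then show ?thesis using l c unfolding geodesic_def geodesic_from_to_def by (intro exI[of _ l]) auto
  qed
  show ?thesis
  proof (cases "x = y")
    case False
    then show ?thesis using main[OF False sum] that by blast
  next
    case True
    then have "dist x m = 0" using sum by (simp add: dist_commute[of m])
    then have m: "m = x" by simp
    obtain z where "x \<noteq> z" using two by metis
    then obtain l where "(\<forall>s t. dist (l s) (l t) = \<bar>s - t\<bar>) \<and> l 0 = x" using main[of z x] by auto
    then show ?thesis using True m that by auto
  qed
qed

section \<open>Consequences of affine rigidity\<close>

text \<open>A point is encoded by the indices of the basic open sets containing it. The encoding
  turns any metric on the space into one on a set of reals, the form in which the rigidity
  hypothesis admits target spaces.\<close>

lemma inj_into_reals: "\<exists>f :: 'x::{second_countable_topology, t1_space} \<Rightarrow> real. inj f"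
proof -
  obtain B :: "'x set set" where B: "countable B" "topological_basis B"
    using ex_countable_basis by blast
  define g where "g x = {n. x \<in> from_nat_into B n}" for x :: 'x
  have "inj g"
  proof (rule injI, rule ccontr)
    fix x y assume eq: "g x = g y" and "x \<noteq> y"
    then obtain U where "open U" "x \<in> U" "y \<notin> U" using t1_space by blast
    then obtain V where V: "V \<in> B" "x \<in> V" "V \<subseteq> U" using B(2) topological_basisE by blast
    then obtain n where "V = from_nat_into B n" using B(1) by (metis from_nat_into_surj)
    then have "n \<in> g x" "n \<notin> g y" using V \<open>y \<notin> U\<close> by (auto simp: g_def)
    then show False using eq by simp
  qed
  moreover obtain h :: "nat set \<Rightarrow> real" where "inj h"
    using nat_sets_eqpoll_reals unfolding eqpoll_def bij_betw_def by blast
  ultimately show ?thesis by (intro exI[of _ "h \<circ> g"]) (rule inj_compose)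
qed

text \<open>Ratios on two subintervals are compared through one interval containing both.
  Proportions written as products stay valid for \<open>u = w\<close>.\<close>

lemma constant_ratio_on_interval:
  fixes g :: "real \<Rightarrow> real \<Rightarrow> real"
  assumes I: "is_interval I"
    and nn: "\<And>s t. 0 \<le> g s t" and sym: "\<And>s t. g s t = g t s" and z: "\<And>s. g s s = 0"
    and sub: "\<And>u v w. \<lbrakk>u \<in> I; w \<in> I; u \<le> v; v \<le> w\<rbrakk> \<Longrightarrow>
        g u v * (w - u) = g u w * (v - u) \<and> g v w * (w - u) = g u w * (w - v)"
  shows "\<exists>r\<ge>0. \<forall>s\<in>I. \<forall>t\<in>I. g s t = r * \<bar>s - t\<bar>"
proof (cases "\<exists>a\<in>I. \<exists>b\<in>I. a < b")
  case False
  then have "s = t" if "s \<in> I" "t \<in> I" for s t using that by (meson linorder_neq_iff)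
  then show ?thesis using z by (intro exI[of _ 0]) auto
next
  case True
  then obtain a b where ab: "a \<in> I" "b \<in> I" "a < b" by blast
  have part: "g s t * (w - u) = g u w * (t - s)"
    if "u \<in> I" "w \<in> I" "u \<le> s" "s \<le> t" "t \<le> w" for u w s t
  proof -
    have s: "s \<in> I" using that I mem_is_interval_1_I order_trans by metis
    have *: "g s w * (w - u) = g u w * (w - s)" using sub[of u w s] that by auto
    have **: "g s t * (w - s) = g s w * (t - s)" using sub[of s w t] that s by auto
    show ?thesis
    proof (cases "s = w")
      case True
      then show ?thesis using that z by simp
    next
      case False
      then have "w - s \<noteq> 0" by simp
      moreover have "(g s t * (w - u)) * (w - s) = (g u w * (t - s)) * (w - s)"
        using * ** by (metis mult.assoc mult.commute)
      ultimately show ?thesis by simp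
    qed
  qed
  define r where "r = g a b / (b - a)"
  have main: "g s t = r * (t - s)" if "s \<in> I" "t \<in> I" "s \<le> t" for s t
  proof -
    define u w where "u = min a s" and "w = max b t"
    have uw: "u \<in> I" "w \<in> I" "u \<le> s" "u \<le> a" "t \<le> w" "b \<le> w" "u < w"
      using ab that by (auto simp: u_def w_def min_def max_def)
    have 1: "g s t * (w - u) = g u w * (t - s)" using part[OF uw(1,2)] that uw by auto
    have "g a b * (w - u) = g u w * (b - a)" using part[OF uw(1,2)] ab uw by auto
    then have "g u w = r * (w - u)" using ab by (simp add: r_def field_simps)
    then show ?thesis using 1 uw by auto
  qed
  have "g s t = r * \<bar>s - t\<bar>" if "s \<in> I" "t \<in> I" for s t
    using main[of s t] main[of t s] that sym by (cases "s \<le> t") auto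
  moreover have "0 \<le> r" using nn ab by (simp add: r_def)
  ultimately show ?thesis by blast
qed

text \<open>
  Rigidity enters only through the following consequence: \<open>sqrt (d\<^sup>2 + Q)\<close> is again a CAT(0) metric
  on the same set, with the same geodesics up to reparametrization, so the identity is an affine map
  into it. Adding \<open>d\<^sup>2\<close> keeps the metric complete, whatever \<open>Q\<close> is.
\<close>

lemma rigid_quadratic:
  fixes Q :: "'x::polish_space \<Rightarrow> 'x \<Rightarrow> real"
  assumes C: "CAT0 (UNIV :: 'x set) dist" and R: "affinely_rigid_CAT0 (UNIV :: 'x set) dist"
    and nn: "\<And>x y. 0 \<le> Q x y" and sym: "\<And>x y. Q x y = Q y x"
    and tri: "\<And>x y z. sqrt (Q x z) \<le> sqrt (Q x y) + sqrt (Q y z)"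
    and bnd: "\<And>x y. Q x y \<le> K * (dist x y)\<^sup>2"
    and lin: "\<And>x m y l. \<lbrakk>0 \<le> l; l \<le> 1; dist x m = l * dist x y; dist m y = (1 - l) * dist x y\<rbrakk>
        \<Longrightarrow> Q x m = l\<^sup>2 * Q x y"
    and CN: "\<And>x m y l z. \<lbrakk>0 \<le> l; l \<le> 1; dist x m = l * dist x y; dist m y = (1 - l) * dist x y\<rbrakk>
        \<Longrightarrow> Q z m \<le> (1 - l) * Q z x + l * Q z y - l * (1 - l) * Q x y"
  shows "\<exists>k\<ge>0. \<forall>x y. Q x y = k * (dist x y)\<^sup>2"
proof -
  define D where "D x y = sqrt ((dist x y)\<^sup>2 + Q x y)" for x y :: 'x
  have D2: "(D x y)\<^sup>2 = (dist x y)\<^sup>2 + Q x y" for x y using nn by (simp add: D_def)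
  have Dnn: "0 \<le> D x y" for x y using nn by (simp add: D_def)
  have Dsym: "D x y = D y x" for x y unfolding D_def using sym by (simp add: dist_commute)
  have Dge: "dist x y \<le> D x y" for x y unfolding D_def using nn by (intro real_le_rsqrt) simp
  have Q0: "Q x x = 0" for x using nn[of x x] bnd[of x x] by simp
  have D0: "D x x = 0" for x by (simp add: D_def Q0)
  have Dtri: "D x z \<le> D x y + D y z" for x y z
  proof -
    have "D x z = sqrt ((dist x z)\<^sup>2 + (sqrt (Q x z))\<^sup>2)" by (simp add: D_def nn)
    also have "\<dots> \<le> sqrt ((dist x y + dist y z)\<^sup>2 + (sqrt (Q x y) + sqrt (Q y z))\<^sup>2)"
      using tri nn by (intro real_sqrt_le_mono add_mono power_mono dist_triangle) auto
    also have "\<dots> \<le> sqrt ((dist x y)\<^sup>2 + (sqrt (Q x y))\<^sup>2) + sqrt ((dist y z)\<^sup>2 + (sqrt (Q y z))\<^sup>2)"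
      by (rule real_sqrt_sum_squares_triangle_ineq)
    finally show ?thesis by (simp add: D_def nn)
  qed
  have Dlin: "D x m = l * D x y" "D m y = (1 - l) * D x y"
    if l: "0 \<le> l" "l \<le> 1" "dist x m = l * dist x y" "dist m y = (1 - l) * dist x y" for x m y l
  proof -
    have "(D x m)\<^sup>2 = (l * D x y)\<^sup>2"
      using lin[OF l] l(3) by (simp add: D2 power_mult_distrib algebra_simps)
    then show "D x m = l * D x y" using Dnn l by (metis mult_nonneg_nonneg power2_eq_imp_eq)
    have "Q y m = (1 - l)\<^sup>2 * Q y x" using lin[of "1 - l" y m x] l by (simp add: dist_commute)
    then have "(D m y)\<^sup>2 = ((1 - l) * D x y)\<^sup>2"
      using l(4) sym[of y m] sym[of y x] by (simp add: power_mult_distrib D2 distrib_left)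
    moreover have "0 \<le> (1 - l) * D x y" using l Dnn by simp
    ultimately show "D m y = (1 - l) * D x y" using Dnn by (metis power2_eq_imp_eq)
  qed
  have DCN: "(D z m)\<^sup>2 \<le> (1 - l) * (D z x)\<^sup>2 + l * (D z y)\<^sup>2 - l * (1 - l) * (D x y)\<^sup>2"
    if l: "0 \<le> l" "l \<le> 1" "dist x m = l * dist x y" "dist m y = (1 - l) * dist x y" for x m y l z
    using CN[OF l, of z] CAT0_CN[OF C l, of z] by (simp add: D2 algebra_simps)
  have gs: "geodesic_space (UNIV :: 'x set) dist" using C unfolding CAT0_def by blast
  have point: "\<exists>m. dist x m = l * dist x y \<and> dist m y = (1 - l) * dist x y"
    if "0 \<le> l" "l \<le> 1" for x y :: 'x and l
  proof -
    obtain c where c: "geodesic_from_to UNIV dist x y c" using gs unfolding geodesic_space_def by blast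
    have in01: "l * dist x y \<in> {0..dist x y}" "0 \<in> {0..dist x y}" "dist x y \<in> {0..dist x y}"
      using that by (auto simp: mult_left_le_one_le)
    have "dist (c 0) (c (l * dist x y)) = \<bar>0 - l * dist x y\<bar>"
      "dist (c (l * dist x y)) (c (dist x y)) = \<bar>l * dist x y - dist x y\<bar>"
      using c in01 unfolding geodesic_from_to_def geodesic_def by blast+
    then show ?thesis using c that in01 unfolding geodesic_from_to_def
      by (intro exI[of _ "c (l * dist x y)"]) (auto simp: abs_mult algebra_simps)
  qed
  obtain \<iota> :: "'x \<Rightarrow> real" where inj: "inj \<iota>" using inj_into_reals by blast
  define \<kappa> where "\<kappa> = inv \<iota>"
  have \<kappa>: "\<kappa> (\<iota> x) = x" for x using inj by (simp add: \<kappa>_def)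
  define Y where "Y = range \<iota>"
  define dY where "dY u v = D (\<kappa> u) (\<kappa> v)" for u v
  have dY: "dY (\<iota> x) (\<iota> y) = D x y" for x y by (simp add: dY_def \<kappa>)
  interpret MY: Metric_space Y dY
  proof
    show "0 \<le> dY x y" for x y by (simp add: dY_def Dnn)
    show "dY x y = dY y x" for x y unfolding dY_def by (rule Dsym)
    show "dY x y = 0 \<longleftrightarrow> x = y" if "x \<in> Y" "y \<in> Y" for x y
    proof -
      from that obtain a b where "x = \<iota> a" "y = \<iota> b" unfolding Y_def by blast
      then show ?thesis using Dge[of a b] D0[of a] inj by (auto simp: dY dest: injD)
    qed
    show "dY x z \<le> dY x y + dY y z" for x y z unfolding dY_def by (rule Dtri)
  qed
  have mc: "Metric_space.mcomplete Y dY"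
    unfolding MY.mcomplete_def
  proof (intro allI impI)
    fix \<sigma> assume "MY.MCauchy \<sigma>"
    then have sY: "range \<sigma> \<subseteq> Y" and Ca: "\<And>\<epsilon>. \<epsilon> > 0 \<Longrightarrow> \<exists>N. \<forall>n n'. N \<le> n \<longrightarrow> N \<le> n' \<longrightarrow> dY (\<sigma> n) (\<sigma> n') < \<epsilon>"
      unfolding MY.MCauchy_def by auto
    \<comment> \<open>\<open>dist \<le> D \<le> sqrt (1 + K) * dist\<close>, so both metrics have
      the same Cauchy sequences and the same limits.\<close>
    have "Cauchy (\<lambda>n. \<kappa> (\<sigma> n))"
      unfolding Cauchy_def
    proof (intro allI impI)
      fix e :: real assume "0 < e"
      then obtain N where "\<forall>n n'. N \<le> n \<longrightarrow> N \<le> n' \<longrightarrow> dY (\<sigma> n) (\<sigma> n') < e" using Ca by blast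
      then show "\<exists>M. \<forall>m\<ge>M. \<forall>n\<ge>M. dist (\<kappa> (\<sigma> m)) (\<kappa> (\<sigma> n)) < e"
        using Dge le_less_trans unfolding dY_def by (intro exI[of _ N]) blast
    qed
    then obtain x where x: "(\<lambda>n. \<kappa> (\<sigma> n)) \<longlonglongrightarrow> x" using Cauchy_convergent convergentD by blast
    have "(\<lambda>n. D (\<kappa> (\<sigma> n)) x) \<longlonglongrightarrow> 0"
    proof (rule tendsto_sandwich[OF _ _ tendsto_const])
      show "(\<lambda>n. sqrt (1 + K) * dist (\<kappa> (\<sigma> n)) x) \<longlonglongrightarrow> 0"
        using tendsto_mult[OF tendsto_const tendsto_dist[OF x tendsto_const[of x]], of "sqrt (1 + K)"] by simp
      have "D y x \<le> sqrt (1 + K) * dist y x" for y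
      proof -
        have "(dist y x)\<^sup>2 + Q y x \<le> (1 + K) * (dist y x)\<^sup>2" using bnd[of y x] by (simp add: algebra_simps)
        then have "D y x \<le> sqrt ((1 + K) * (dist y x)\<^sup>2)" unfolding D_def by simp
        then show ?thesis by (simp add: real_sqrt_mult)
      qed
      then show "\<forall>\<^sub>F n in sequentially. D (\<kappa> (\<sigma> n)) x \<le> sqrt (1 + K) * dist (\<kappa> (\<sigma> n)) x" by simp
      show "\<forall>\<^sub>F n in sequentially. 0 \<le> D (\<kappa> (\<sigma> n)) x" by (simp add: Dnn)
    qed
    then have "\<exists>N. \<forall>n\<ge>N. dY (\<sigma> n) (\<iota> x) < \<epsilon>" if "\<epsilon> > 0" for \<epsilon>
      using order_tendstoD(2)[of _ 0 sequentially \<epsilon>] that by (simp add: dY_def \<kappa> eventually_sequentially)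
    moreover have "\<iota> x \<in> Y" "\<sigma> n \<in> Y" for n using sY by (auto simp: Y_def)
    ultimately have "limitin MY.mtopology \<sigma> (\<iota> x) sequentially"
      unfolding MY.limit_metric_sequentially by blast
    then show "\<exists>x. limitin MY.mtopology \<sigma> x sequentially" by blast
  qed
  have gsY: "geodesic_space Y dY"
    unfolding geodesic_space_def
  proof (intro ballI)
    fix u v assume "u \<in> Y" "v \<in> Y"
    then obtain x y where xy: "u = \<iota> x" "v = \<iota> y" unfolding Y_def by blast
    show "\<exists>c. geodesic_from_to Y dY u v c"
    proof (cases "x = y")
      case True
      then show ?thesis using xy by (intro exI[of _ "\<lambda>_. \<iota> x"])
        (auto simp: geodesic_from_to_def geodesic_def dY D0 Y_def is_interval_1)
    next
      case False
      obtain c where c: "geodesic_from_to UNIV dist x y c" using gs unfolding geodesic_space_def by blast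
      define r where "r = D x y / dist x y"
      have Dpos: "0 < D x y" using False Dge[of x y] zero_less_dist_iff[of x y] by linarith
      then have r: "0 < r" using False by (auto simp: r_def)
      have cl: "dist (c s) (c t) = \<bar>s - t\<bar>" if "0 \<le> s" "s \<le> dist x y" "0 \<le> t" "t \<le> dist x y" for s t
        using c that unfolding geodesic_from_to_def geodesic_def by auto
      have ce: "c 0 = x" "c (dist x y) = y" using c unfolding geodesic_from_to_def by auto
      \<comment> \<open>Betweenness is used twice: for \<open>c t\<close> on the way from
        \<open>x\<close> to \<open>y\<close>, then for \<open>c s\<close> on the way from
        \<open>x\<close> to \<open>c t\<close>.\<close>
      have Dr: "D (c s) (c t) = r * (t - s)" if st: "0 \<le> s" "s \<le> t" "t \<le> dist x y" for s t
      proof -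
        have p: "0 < dist x y" using False by simp
        have "dist x (c t) = (t / dist x y) * dist x y" "dist (c t) y = (1 - t / dist x y) * dist x y"
          using st p cl[of 0 t] cl[of t "dist x y"] ce by (auto simp: left_diff_distrib)
        then have "D x (c t) = (t / dist x y) * D x y" using st p by (intro Dlin) auto
        then have a: "D x (c t) = r * t" by (simp add: r_def)
        show ?thesis
        proof (cases "t = 0")
          case True then show ?thesis using st D0 by simp
        next
          case False
          have d: "dist x (c t) = t" using cl[of 0 t] ce st by auto
          have "dist x (c s) = (s / t) * dist x (c t)" "dist (c s) (c t) = (1 - s / t) * dist x (c t)"
            using st d False cl[of 0 s] cl[of s t] ce by (auto simp: left_diff_distrib)
          then have "D (c s) (c t) = (1 - s / t) * D x (c t)" using st False by (intro Dlin) auto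
          then show ?thesis using a False by (simp add: left_diff_distrib right_diff_distrib)
        qed
      qed
      define c' where "c' u = \<iota> (c (u / r))" for u
      have Dxy: "D x y = r * dist x y" using False by (simp add: r_def)
      have "dY (c' s) (c' t) = \<bar>s - t\<bar>" if "0 \<le> s" "s \<le> D x y" "0 \<le> t" "t \<le> D x y" for s t
      proof -
        have *: "0 \<le> s / r" "s / r \<le> dist x y" "0 \<le> t / r" "t / r \<le> dist x y"
          using that r Dxy by (auto simp: field_simps)
        consider "s \<le> t" | "t \<le> s" by linarith
        then show ?thesis
        proof cases
          case 1
          then have "s / r \<le> t / r" using r by (simp add: divide_right_mono)
          then have "dY (c' s) (c' t) = r * (t / r - s / r)" using Dr[of "s / r" "t / r"] * by (simp add: c'_def dY)
          then show ?thesis using 1 r by (simp add: right_diff_distrib)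
        next
          case 2
          then have "t / r \<le> s / r" using r by (simp add: divide_right_mono)
          then have "dY (c' s) (c' t) = r * (s / r - t / r)"
            using Dr[of "t / r" "s / r"] Dsym[of "c (s / r)"] * by (simp add: c'_def dY)
          then show ?thesis using 2 r by (simp add: right_diff_distrib)
        qed
      qed
      moreover have "c' 0 = u" "c' (D x y) = v" using ce xy r False by (auto simp: c'_def r_def)
      ultimately show ?thesis using xy
        by (intro exI[of _ c']) (auto simp: geodesic_from_to_def geodesic_def dY is_interval_cc, simp add: c'_def Y_def)
    qed
  qed
  have compY: "CAT0_comparison Y dY"
  proof (rule CAT0_comparison_if_CN)
    show "Metric_space Y dY" ..
    fix u v w c s
    assume Y: "u \<in> Y" "v \<in> Y" "w \<in> Y" and c: "geodesic_from_to Y dY u v c" and s: "0 \<le> (s::real)" "s \<le> 1"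
    then obtain x y z where xyz: "u = \<iota> x" "v = \<iota> y" "w = \<iota> z" unfolding Y_def by blast
    have in01: "s * dY u v \<in> {0..dY u v}" using s by (auto simp: mult_left_le_one_le)
    then have "c (s * dY u v) \<in> Y" using c unfolding geodesic_from_to_def geodesic_def by auto
    then obtain m where m: "c (s * dY u v) = \<iota> m" unfolding Y_def by blast
    have e01: "0 \<in> {0..dY u v}" "dY u v \<in> {0..dY u v}" by auto
    have "dY (c 0) (c (s * dY u v)) = \<bar>0 - s * dY u v\<bar>"
      "dY (c (s * dY u v)) (c (dY u v)) = \<bar>s * dY u v - dY u v\<bar>"
      using c in01 e01 unfolding geodesic_from_to_def geodesic_def by blast+
    moreover have "c 0 = \<iota> x" "c (dY u v) = \<iota> y" using c by (auto simp: geodesic_from_to_def xyz)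
    ultimately have "D x m = \<bar>0 - s * D x y\<bar>" "D m y = \<bar>s * D x y - D x y\<bar>"
      unfolding m by (simp_all add: dY xyz)
    then have ds: "D x m = s * D x y" "D m y = (1 - s) * D x y"
      using s Dnn[of x y] in01 by (auto simp: xyz dY left_diff_distrib)
    obtain m0 where m0: "dist x m0 = s * dist x y" "dist m0 y = (1 - s) * dist x y" using point[OF s] by blast
    \<comment> \<open>uniqueness of geodesics for \<open>D\<close>\<close>
    have "(D m m0)\<^sup>2 \<le> (1 - s) * (D m x)\<^sup>2 + s * (D m y)\<^sup>2 - s * (1 - s) * (D x y)\<^sup>2"
      by (rule DCN[OF s m0])
    also have "\<dots> = 0" unfolding Dsym[of m x] ds by (simp add: power2_eq_square algebra_simps)
    finally have "D m m0 = 0" by simp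
    then have "m = m0" using Dge[of m m0] by simp
    then show "(dY w (c (s * dY u v)))\<^sup>2 \<le> (1 - s) * (dY w u)\<^sup>2 + s * (dY w v)\<^sup>2 - s * (1 - s) * (dY u v)\<^sup>2"
      using DCN[OF s m0, of z] m by (simp add: xyz dY)
  qed
  have "CAT0 Y dY" unfolding CAT0_def using MY.Metric_space_axioms mc gsY compY by blast
  moreover have "affine_map UNIV dist Y dY \<iota>"
    unfolding affine_map_def
  proof (intro conjI allI impI)
    show "\<iota> \<in> UNIV \<rightarrow> Y" by (auto simp: Y_def)
    fix I c assume c: "geodesic (UNIV :: 'x set) dist I c"
    then have I: "is_interval I" and cd: "\<And>s t. s \<in> I \<Longrightarrow> t \<in> I \<Longrightarrow> dist (c s) (c t) = \<bar>s - t\<bar>"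
      unfolding geodesic_def by auto
    have "\<exists>r\<ge>0. \<forall>s\<in>I. \<forall>t\<in>I. D (c s) (c t) = r * \<bar>s - t\<bar>"
    proof (rule constant_ratio_on_interval[OF I])
      fix u v w assume uw: "u \<in> I" "w \<in> I" "u \<le> v" "v \<le> w"
      then have v: "v \<in> I" using I mem_is_interval_1_I by metis
      show "D (c u) (c v) * (w - u) = D (c u) (c w) * (v - u) \<and> D (c v) (c w) * (w - u) = D (c u) (c w) * (w - v)"
      proof (cases "u = w")
        case True then show ?thesis using uw D0 by simp
      next
        case False
        define l where "l = (v - u) / (w - u)"
        have l: "0 \<le> l" "l \<le> 1" "l * (w - u) = v - u" "(1 - l) * (w - u) = w - v"
          using uw False by (auto simp: l_def field_simps)
        have "dist (c u) (c v) = v - u" "dist (c v) (c w) = w - v" "dist (c u) (c w) = w - u"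
          using cd uw v by auto
        then have "dist (c u) (c v) = l * dist (c u) (c w)" "dist (c v) (c w) = (1 - l) * dist (c u) (c w)"
          by (simp_all only: l(3,4))
        then have "D (c u) (c v) = l * D (c u) (c w)" "D (c v) (c w) = (1 - l) * D (c u) (c w)"
          using Dlin l(1,2) by blast+
        moreover have "v - u = l * (w - u)" "w - v = (1 - l) * (w - u)" using l(3,4) by simp_all
        ultimately show ?thesis by (simp only: mult_ac simp_thms)
      qed
    qed (use Dnn Dsym D0 in auto)
    then show "\<exists>r\<ge>0. \<forall>s\<in>I. \<forall>t\<in>I. dY (\<iota> (c s)) (\<iota> (c t)) = r * \<bar>s - t\<bar>" by (simp add: dY)
  qed
  ultimately obtain r where r: "dilation_by UNIV dist Y dY r \<iota>"
    using R unfolding affinely_rigid_CAT0_def by blast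
  have Dr: "D x y = r * dist x y" for x y
  proof -
    obtain c where c: "geodesic_from_to UNIV dist x y c" using gs unfolding geodesic_space_def by blast
    then have "dY (\<iota> (c 0)) (\<iota> (c (dist x y))) = r * \<bar>0 - dist x y\<bar>"
      using r unfolding dilation_by_def geodesic_from_to_def by (metis atLeastAtMost_iff order_refl zero_le_dist)
    then show ?thesis using c unfolding geodesic_from_to_def by (simp add: dY)
  qed
  have Q: "Q x y = (r\<^sup>2 - 1) * (dist x y)\<^sup>2" for x y
    using D2[of x y] Dr[of x y] by (simp add: power_mult_distrib algebra_simps)
  show ?thesis
  proof (cases "\<exists>x y :: 'x. x \<noteq> y")
    case True
    then obtain x y :: 'x where "x \<noteq> y" by blast
    then have "0 < (dist x y)\<^sup>2" by simp
    then have "0 \<le> r\<^sup>2 - 1" using Q[of x y] nn[of x y] by (metis zero_le_mult_iff not_le)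
    then show ?thesis using Q by blast
  next
    \<comment> \<open>The factor of a dilation of a point is arbitrary, so
      \<open>r\<^sup>2 - 1\<close> could be negative here.\<close>
    case False
    then have "dist x y = 0" "Q x y = 0" for x y :: 'x using Q0 by (metis dist_self, metis)
    then show ?thesis by (intro exI[of _ 0]) simp
  qed
qed

section \<open>Flats and their mixed terms\<close>

text \<open>An increase over one step \<open>h\<close>, of either sign, recurs at least as large
  over every following step and eventually exceeds \<open>K\<close>; so \<open>f\<close> increases
  in neither direction.\<close>

lemma midpoint_convex_bounded_constant:
  fixes f :: "real \<Rightarrow> real"
  assumes conv: "\<And>t h. f t \<le> (f (t - h) + f (t + h)) / 2" and bnd: "\<And>t. f t \<le> K"
  shows "f s = f t"
proof -
  have le: "f (t + h) \<le> f t" for t h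
  proof (rule ccontr)
    assume "\<not> f (t + h) \<le> f t"
    then have \<delta>: "0 < f (t + h) - f t" by simp
    have step: "f (t + h) - f t \<le> f (t + (real n + 1) * h) - f (t + real n * h)" for n
    proof (induction n)
      case (Suc n)
      have 1: "t + (real n + 1) * h - h = t + real n * h" "t + (real n + 1) * h + h = t + (real (Suc n) + 1) * h"
        by (simp_all add: algebra_simps)
      have 2: "real (Suc n) = real n + 1" by simp
      have "d \<le> w - v" if "d \<le> v - u" "v \<le> (u + w) / 2" for d u v w :: real using that by argo
      from this[OF Suc conv[of "t + (real n + 1) * h" h, unfolded 1]] show ?case unfolding 2 .
    qed simp
    have "f t + real n * (f (t + h) - f t) \<le> f (t + real n * h)" for n
    proof (induction n)
      case (Suc n)
      have S: "real (Suc n) = real n + 1" by simp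
      have "real (Suc n) * (f (t + h) - f t) = real n * (f (t + h) - f t) + (f (t + h) - f t)"
        unfolding S by (simp add: distrib_right)
      then show ?case using Suc step[of n] unfolding S by linarith
    qed simp
    moreover obtain n where "K - f t < real n * (f (t + h) - f t)" using reals_Archimedean3[OF \<delta>] by blast
    ultimately show False using bnd by (smt (verit))
  qed
  show ?thesis using le[of s "t - s"] le[of t "s - t"] by simp
qed

text \<open>A nonpositively curved semidistance on the plane comes from a quadratic form. The
  distance between two points moving in parallel is convex and bounded, hence constant, which gives
  translation invariance; the curvature inequality then yields the parallelogram law.\<close>

lemma flat_quadratic:
  fixes q :: "real \<times> real \<Rightarrow> real \<times> real \<Rightarrow> real"
  assumes nn: "\<And>a b. 0 \<le> q a b" and sym: "\<And>a b. q a b = q b a"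
    and tri: "\<And>a b c. sqrt (q a c) \<le> sqrt (q a b) + sqrt (q b c)"
    and bnd: "\<And>a b. q a b \<le> K * (norm (a - b))\<^sup>2"
    and lin: "\<And>a b l. \<lbrakk>0 \<le> l; l \<le> 1\<rbrakk> \<Longrightarrow> q a ((1 - l) *\<^sub>R a + l *\<^sub>R b) = l\<^sup>2 * q a b"
    and CN: "\<And>a b c l. \<lbrakk>0 \<le> l; l \<le> 1\<rbrakk> \<Longrightarrow>
        q c ((1 - l) *\<^sub>R a + l *\<^sub>R b) \<le> (1 - l) * q c a + l * q c b - l * (1 - l) * q a b"
  shows "\<exists>\<alpha> \<eta> \<tau>. \<forall>s t s' t'. q (s, t) (s', t') = \<alpha> * (s - s')\<^sup>2 + 2 * \<eta> * (s - s') * (t - t') + \<tau> * (t - t')\<^sup>2"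
proof -
  define mid :: "real \<times> real \<Rightarrow> real \<times> real \<Rightarrow> real \<times> real" where "mid a b = (1/2) *\<^sub>R (a + b)" for a b
  have CNm: "q c (mid a b) \<le> q c a / 2 + q c b / 2 - q a b / 4" for a b c
    using CN[of "1/2" c a b] by (simp add: mid_def scaleR_add_right)
  \<comment> \<open>The midline of a triangle is at most half as long as the third side: the
    midpoint inequality is used as seen from \<open>mid a b\<close> and as seen from
    \<open>b'\<close>.\<close>
  have mm: "sqrt (q (mid a b) (mid a b')) \<le> sqrt (q b b') / 2" for a b b'
  proof -
    have "q (mid a b) (mid a b') \<le> q (mid a b) a / 2 + q (mid a b) b' / 2 - q a b' / 4" by (rule CNm)
    moreover have "q a (mid a b) = q a b / 4" using lin[of "1/2" a b] by (simp add: mid_def scaleR_add_right power2_eq_square)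
    moreover have "q b' (mid a b) \<le> q b' a / 2 + q b' b / 2 - q a b / 4" by (rule CNm)
    ultimately have "q (mid a b) (mid a b') \<le> q b b' / 4"
      using sym[of a "mid a b"] sym[of b' "mid a b"] sym[of b' a] sym[of b' b] by simp
    then have "sqrt (q (mid a b) (mid a b')) \<le> sqrt (q b b' / 4)" by simp
    then show ?thesis by (simp add: real_sqrt_divide)
  qed
  have midc: "mid a b = mid b a" for a b by (simp add: mid_def add.commute)
  \<comment> \<open>The diagonal from \<open>a\<close> to \<open>b'\<close> cuts the quadrilateral
    into two triangles, each with its midline.\<close>
  have quad: "sqrt (q (mid a a') (mid b b')) \<le> (sqrt (q a b) + sqrt (q a' b')) / 2" for a a' b b'
    using tri[of "mid a a'" "mid b b'" "mid a b'"] mm[of a a' b'] mm[of b' a b]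
      midc[of b' a] midc[of b' b] by simp
  have trans: "q (a + v) (b + v) = q a b" for a b v
  proof -
    define f where "f t = sqrt (q (a + t *\<^sub>R v) (b + t *\<^sub>R v))" for t
    have "f 1 = f 0"
    proof (rule midpoint_convex_bounded_constant[of f "sqrt (K * (norm (a - b))\<^sup>2)"])
      fix t h
      have "mid (c + (t - h) *\<^sub>R v) (c + (t + h) *\<^sub>R v) = c + t *\<^sub>R v" for c
        unfolding mid_def by (simp add: prod_eq_iff algebra_simps)
      then show "f t \<le> (f (t - h) + f (t + h)) / 2"
        unfolding f_def using quad[of "a + (t - h) *\<^sub>R v" "a + (t + h) *\<^sub>R v" "b + (t - h) *\<^sub>R v" "b + (t + h) *\<^sub>R v"]
        by simp
    next
      fix t
      have "q (a + t *\<^sub>R v) (b + t *\<^sub>R v) \<le> K * (norm (a - b))\<^sup>2" using bnd[of "a + t *\<^sub>R v" "b + t *\<^sub>R v"] by simp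
      then show "f t \<le> sqrt (K * (norm (a - b))\<^sup>2)" unfolding f_def by simp
    qed
    then show ?thesis by (simp add: f_def)
  qed
  define n where "n u = q 0 u" for u
  have qn: "q a b = n (b - a)" for a b using trans[of 0 a "b - a"] by (simp add: n_def)

  have nneg: "n (- u) = n u" for u using qn[of u 0] sym[of u 0] by (simp add: n_def)
  have npos: "n (l *\<^sub>R u) = l\<^sup>2 * n u" if "0 \<le> l" for l u
  proof (cases "l \<le> 1")
    case True
    then show ?thesis using lin[OF that, of 0 u] by (simp add: n_def)
  next
    case False
    then have "n ((1/l) *\<^sub>R (l *\<^sub>R u)) = (1/l)\<^sup>2 * n (l *\<^sub>R u)" using lin[of "1/l" 0 "l *\<^sub>R u"] by (simp add: n_def)
    then show ?thesis using False by (simp add: power_divide field_simps)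
  qed
  have nscale: "n (l *\<^sub>R u) = l\<^sup>2 * n u" for l u
    using npos[of l u] npos[of "- l" u] nneg[of "l *\<^sub>R u"] by (cases "0 \<le> l") auto
  \<comment> \<open>The midpoint of \<open>- v\<close> and \<open>v\<close> is the origin, so the
    midpoint inequality seen from \<open>u\<close> is one half of the parallelogram law. Replacing
    \<open>u\<close>, \<open>v\<close> by \<open>u + v\<close>, \<open>u - v\<close> gives the other
    half.\<close>
  have par1: "n u + n v \<le> (n (u + v) + n (u - v)) / 2" for u v
  proof -
    have "mid (- v) v = 0" by (simp add: mid_def)
    then have "q u 0 \<le> q u (- v) / 2 + q u v / 2 - q (- v) v / 4" using CNm[of u "- v" v] by simp
    moreover have "q (- v) v = 4 * n v" using nscale[of 2 v] by (simp add: qn scaleR_2)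
    moreover have "q u 0 = n u" "q u v = n (u - v)"
      using nneg[of "u"] nneg[of "u - v"] by (simp_all add: qn)
    moreover have "- v - u = - (u + v)" by simp
    then have "q u (- v) = n (u + v)" by (simp only: qn nneg)
    ultimately show ?thesis by simp
  qed
  have par: "n (u + v) + n (u - v) = 2 * n u + 2 * n v" for u v
  proof -
    have "n (u + v) + n (u - v) \<le> (n (2 *\<^sub>R u) + n (2 *\<^sub>R v)) / 2"
      using par1[of "u + v" "u - v"] by (simp add: scaleR_2 algebra_simps)
    then show ?thesis using par1[of u v] by (simp add: nscale)
  qed
  \<comment> \<open>Twice the polar form of \<open>u\<close> and \<open>s *\<^sub>R v\<close>. The
    curvature inequality bounds \<open>r u v (l * s)\<close> by \<open>l * r u v s\<close>, and
    oddness in \<open>s\<close> turns the bound into an equality, hence into linearity.\<close>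
  define r where "r u v s = n (u + s *\<^sub>R v) - s\<^sup>2 * n v - n u" for u v s

  have rneg: "r u v (- s) = - r u v s" for u v s
    using par[of u "s *\<^sub>R v"] nscale[of s v] by (simp add: r_def mult_ac)
  have rconv: "r u v (l * s) \<le> l * r u v s" if "0 \<le> l" "l \<le> 1" for u v l s
  proof -
    have "(1 - l) *\<^sub>R u + l *\<^sub>R (u + s *\<^sub>R v) = u + (l * s) *\<^sub>R v" by (simp add: algebra_simps)
    then have "q 0 (u + (l * s) *\<^sub>R v) \<le> (1 - l) * q 0 u + l * q 0 (u + s *\<^sub>R v) - l * (1 - l) * q u (u + s *\<^sub>R v)"
      using CN[OF that, of 0 u "u + s *\<^sub>R v"] by simp
    then have *: "n (u + (l * s) *\<^sub>R v) \<le> (1 - l) * n u + l * n (u + s *\<^sub>R v) - l * (1 - l) * (s\<^sup>2 * n v)"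
      using qn[of u "u + s *\<^sub>R v"] by (simp add: n_def[symmetric] nscale)
    show ?thesis unfolding r_def using * by (simp add: algebra_simps power2_eq_square)
  qed
  have rl: "r u v (l * s) = l * r u v s" if "0 \<le> l" "l \<le> 1" for u v l s
    using rconv[OF that, of u v s] rconv[OF that, of u v "- s"] rneg[of u v s] rneg[of u v "l * s"] by simp
  have rlin: "r u v s = s * r u v 1" for u v s
  proof -
    have pos: "r u v s = s * r u v 1" if "0 \<le> s" for s
    proof (cases "s \<le> 1")
      case True then show ?thesis using rl[OF that True, of u v 1] by simp
    next
      case False then show ?thesis using rl[of "1/s" u v s] by (simp add: field_simps)
    qed
    show ?thesis
    proof (cases "0 \<le> s")
      case False then show ?thesis using pos[of "- s"] rneg[of u v s] by simp
    qed (rule pos)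
  qed
  have rsym: "r u v 1 = r v u 1" for u v by (simp add: r_def add.commute)
  have rscale: "r u (t *\<^sub>R v) 1 = t * r u v 1" for u v t
    using rlin[of u v t] nscale[of t v] by (simp add: r_def)
  define e1 e2 :: "real \<times> real" where "e1 = (1, 0)" and "e2 = (0, 1)"
  have form: "n (s *\<^sub>R e1 + t *\<^sub>R e2) = n e1 * s\<^sup>2 + r e1 e2 1 * s * t + n e2 * t\<^sup>2" for s t
  proof -
    have "r (s *\<^sub>R e1) (t *\<^sub>R e2) 1 = s * t * r e1 e2 1"
      using rscale[of "s *\<^sub>R e1" t e2] rscale[of e2 s e1] rsym[of "s *\<^sub>R e1" e2] rsym[of e1 e2] by simp
    then show ?thesis by (simp add: r_def nscale algebra_simps)
  qed
  have "q (s, t) (s', t') = n e1 * (s - s')\<^sup>2 + 2 * (r e1 e2 1 / 2) * (s - s') * (t - t') + n e2 * (t - t')\<^sup>2" for s t s' t'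
  proof -
    have "(s, t) - (s', t') = (s - s') *\<^sub>R e1 + (t - t') *\<^sub>R e2" by (simp add: e1_def e2_def)
    then have "q (s', t') (s, t) = n ((s - s') *\<^sub>R e1 + (t - t') *\<^sub>R e2)" by (simp only: qn)
    then show ?thesis unfolding form using sym[of "(s, t)" "(s', t')"] by simp
  qed
  then show ?thesis by blast
qed

text \<open>Squaring and estimating the mixed product by the squares leaves the same coefficient
  \<open>4 * \<tau>\<close> of the square of \<open>T\<close> on both sides. What remains is linear
  in \<open>T\<close> with slope \<open>4 * (a - (b + c))\<close> and bounded above, so the slope
  cannot be positive.\<close>

lemma sqrt_quadratic_superadditive:
  fixes A B C a b c \<tau> :: real
  assumes nn: "\<And>T. 0 \<le> B + 2 * T * b + T\<^sup>2 * \<tau>" "\<And>T. 0 \<le> C + 2 * T * c + T\<^sup>2 * \<tau>"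
    and ineq: "\<And>T. sqrt (A + 4 * T * a + 4 * T\<^sup>2 * \<tau>) \<le> sqrt (B + 2 * T * b + T\<^sup>2 * \<tau>) + sqrt (C + 2 * T * c + T\<^sup>2 * \<tau>)"
  shows "a \<le> b + c"
proof (rule ccontr)
  assume "\<not> a \<le> b + c"
  then have pos: "0 < 4 * (a - (b + c))" by simp
  have "T * (4 * (a - (b + c))) \<le> 2 * B + 2 * C - A" for T
  proof -
    define P R where "P = B + 2 * T * b + T\<^sup>2 * \<tau>" and "R = C + 2 * T * c + T\<^sup>2 * \<tau>"
    have PR: "0 \<le> P" "0 \<le> R" using nn by (auto simp: P_def R_def)
    have "A + 4 * T * a + 4 * T\<^sup>2 * \<tau> \<le> (sqrt P + sqrt R)\<^sup>2"
      using ineq[of T] PR unfolding P_def[symmetric] R_def[symmetric] by (intro sqrt_le_D)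
    also have "\<dots> \<le> 2 * P + 2 * R"
      using sum_squares_bound[of "sqrt P" "sqrt R"] PR by (simp add: power2_sum)
    finally show ?thesis by (simp add: P_def R_def algebra_simps)
  qed
  moreover obtain n where "2 * B + 2 * C - A < real n * (4 * (a - (b + c)))" using reals_Archimedean3[OF pos] by blast
  ultimately show False by (smt (verit))
qed

text \<open>The squared difference of values of \<open>\<beta>\<close> is a form to which rigidity
  applies, so \<open>\<beta>\<close> multiplies all distances by one factor. A nonzero factor would
  make \<open>X\<close> isometric to \<real>.\<close>

lemma affine_function_constant:
  fixes \<beta> :: "'x::polish_space \<Rightarrow> real"
  assumes C: "CAT0 (UNIV :: 'x set) dist" and R: "affinely_rigid_CAT0 (UNIV :: 'x set) dist"
    and gc: "geodesically_complete (UNIV :: 'x set) dist"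
    and nR: "\<not> (\<exists>h :: 'x \<Rightarrow> real. isometry UNIV dist UNIV dist h)"
    and aff: "\<And>l. (\<And>s t. dist (l s) (l t) = \<bar>s - t\<bar>) \<Longrightarrow> \<exists>k. \<forall>s t. \<beta> (l s) - \<beta> (l t) = k * (s - t)"
    and bnd: "\<And>x y. (\<beta> x - \<beta> y)\<^sup>2 \<le> K * (dist x y)\<^sup>2"
  shows "\<beta> x = \<beta> y"
proof (cases "\<exists>a b :: 'x. a \<noteq> b")
  case False
  then show ?thesis by metis
next
  case two: True
  have gs: "geodesic_space (UNIV :: 'x set) dist" using C unfolding CAT0_def by blast
  have lin: "\<beta> m - \<beta> x = l * (\<beta> y - \<beta> x)"
    if l: "0 \<le> l" "l \<le> 1" "dist x m = l * dist x y" "dist m y = (1 - l) * dist x y" for x m y l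
  proof -
    have "dist x m + dist m y = dist x y" using l by (simp add: algebra_simps)
    then obtain L where L: "\<And>s t. dist (L s) (L t) = \<bar>s - t\<bar>" "L 0 = x" "L (dist x m) = m" "L (dist x y) = y"
      using geodesic_line_through[OF gs gc two] by metis
    obtain k where k: "\<forall>s t. \<beta> (L s) - \<beta> (L t) = k * (s - t)" using aff[of L] L(1) by blast
    have "\<beta> m - \<beta> x = k * dist x m" "\<beta> y - \<beta> x = k * dist x y"
      using k[rule_format, of "dist x m" 0] k[rule_format, of "dist x y" 0] L by auto
    then show ?thesis using l by simp
  qed
  have "\<exists>k\<ge>0. \<forall>x y. (\<beta> x - \<beta> y)\<^sup>2 = k * (dist x y)\<^sup>2"
  proof (rule rigid_quadratic[OF C R])
    show "(\<beta> x - \<beta> y)\<^sup>2 = (\<beta> y - \<beta> x)\<^sup>2" for x y by (simp add: power2_commute)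
    show "(\<beta> x - \<beta> m)\<^sup>2 = l\<^sup>2 * (\<beta> x - \<beta> y)\<^sup>2"
      if "0 \<le> l" "l \<le> 1" "dist x m = l * dist x y" "dist m y = (1 - l) * dist x y" for x m y l
      using lin[OF that] by (metis power2_commute power_mult_distrib)
    show "(\<beta> z - \<beta> m)\<^sup>2 \<le> (1 - l) * (\<beta> z - \<beta> x)\<^sup>2 + l * (\<beta> z - \<beta> y)\<^sup>2 - l * (1 - l) * (\<beta> x - \<beta> y)\<^sup>2"
      if "0 \<le> l" "l \<le> 1" "dist x m = l * dist x y" "dist m y = (1 - l) * dist x y" for x m y l z
    proof -
      have m: "\<beta> m = (1 - l) * \<beta> x + l * \<beta> y" using lin[OF that] by (simp add: algebra_simps)
      show ?thesis unfolding m by (simp add: power2_eq_square algebra_simps)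
    qed
  qed (use bnd in auto)
  then obtain c where c: "c \<ge> 0" "\<And>x y. (\<beta> x - \<beta> y)\<^sup>2 = c * (dist x y)\<^sup>2" by blast
  have "c = 0"
  proof (rule ccontr)
    assume "c \<noteq> 0"
    then have c0: "0 < c" using c by simp
    define h where "h x = \<beta> x / sqrt c" for x
    have "\<bar>\<beta> x - \<beta> y\<bar> = sqrt c * dist x y" for x y
    proof -
      have "sqrt ((\<beta> x - \<beta> y)\<^sup>2) = sqrt (c * (dist x y)\<^sup>2)" using c by simp
      then show ?thesis by (simp add: real_sqrt_mult)
    qed
    then have hd: "dist (h x) (h y) = dist x y" for x y
      using c0 unfolding h_def dist_real_def diff_divide_distrib[symmetric] by (simp add: abs_divide)
    obtain L :: "real \<Rightarrow> 'x" where L: "\<And>s t. dist (L s) (L t) = \<bar>s - t\<bar>"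
      using geodesic_line_through[OF gs gc two, of undefined undefined undefined] by (metis add_0 dist_self)
    obtain k where k: "\<forall>s t. \<beta> (L s) - \<beta> (L t) = k * (s - t)" using aff[of L] L by blast
    have "k \<noteq> 0" using k[rule_format, of 1 0] c(2)[of "L 1" "L 0"] L c0 by auto
    \<comment> \<open>A single line of \<open>X\<close> is already mapped onto \<real>.\<close>
    have "h (L ((r * sqrt c - \<beta> (L 0)) / k)) = r" for r
      using k[rule_format, of "(r * sqrt c - \<beta> (L 0)) / k" 0] \<open>k \<noteq> 0\<close> c0 by (simp add: h_def)
    then have "surj h" by (rule surjI)
    moreover have "inj h" using hd by (metis dist_eq_0_iff injI)
    ultimately have "isometry UNIV dist UNIV dist h" using hd unfolding isometry_def bij_def by auto
    then show False using nR by blast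
  qed
  then show ?thesis using c(2)[of x y] by simp
qed

text \<open>
  In a flat spanned by a geodesic of \<open>X\<close> and a line of the second factor, the mixed term \<open>\<eta>\<close> is linear
  along the geodesic. Letting the line go to infinity (a Busemann function argument) shows that
  it is additive on all of \<open>X\<close>, hence comes from an affine function \<open>X \<rightarrow> \<real>\<close>.
\<close>

lemma mixed_term_vanishes:
  fixes q :: "'x::polish_space \<Rightarrow> real \<Rightarrow> 'x \<Rightarrow> real \<Rightarrow> real"
  assumes C: "CAT0 (UNIV :: 'x set) dist" and R: "affinely_rigid_CAT0 (UNIV :: 'x set) dist"
    and gc: "geodesically_complete (UNIV :: 'x set) dist"
    and nR: "\<not> (\<exists>h :: 'x \<Rightarrow> real. isometry UNIV dist UNIV dist h)"
    and two: "\<exists>a b :: 'x. a \<noteq> b"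
    and nn: "\<And>x t y u. 0 \<le> q x t y u"
    and tri: "\<And>x t y u z v. sqrt (q x t z v) \<le> sqrt (q x t y u) + sqrt (q y u z v)"
    and base: "\<And>x y. q x 0 y 0 = k * (dist x y)\<^sup>2"
    and flat: "\<And>l. (\<And>s t. dist (l s) (l t) = \<bar>s - t\<bar>) \<Longrightarrow>
      \<exists>\<alpha> \<eta> \<tau>. \<forall>s t s' t'. q (l s) t (l s') t' = \<alpha> * (s - s')\<^sup>2 + 2 * \<eta> * (s - s') * (t - t') + \<tau> * (t - t')\<^sup>2"
  shows "\<exists>\<tau>. \<forall>x t x' t'. q x t x' t' = k * (dist x x')\<^sup>2 + \<tau> * (t - t')\<^sup>2"
proof -
  have gs: "geodesic_space (UNIV :: 'x set) dist" using C unfolding CAT0_def by blast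
  fix x0 :: 'x
  define \<tau> where "\<tau> = q x0 0 x0 1"
  \<comment> \<open>The mixed coefficient, read off at \<open>t - t' = 1\<close>. Many lines may
    pass through \<open>x\<close> and \<open>x'\<close>; this value refers to none of them.\<close>
  define \<eta> where "\<eta> x x' = (q x 1 x' 0 - k * (dist x x')\<^sup>2 - \<tau>) / 2" for x x'
  have line: "\<exists>e. (\<forall>s t s' t'. q (l s) t (l s') t' = k * (s - s')\<^sup>2 + 2 * (e * (s - s')) * (t - t') + \<tau>' * (t - t')\<^sup>2)
      \<and> \<tau>' = q (l s0) 0 (l s0) 1"
    if l: "\<And>s t. dist (l s) (l t) = \<bar>s - t\<bar>" and \<tau>': "\<tau>' = q (l s0) 0 (l s0) 1" for l s0 \<tau>'
  proof -
    obtain \<alpha> e t1 where f: "\<And>s t s' t'. q (l s) t (l s') t' = \<alpha> * (s - s')\<^sup>2 + 2 * e * (s - s') * (t - t') + t1 * (t - t')\<^sup>2"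
      using flat[of l] l by blast
    have "\<alpha> = k" using f[of 1 0 0 0] base[of "l 1" "l 0"] l by simp
    moreover have "t1 = \<tau>'" using f[of s0 0 s0 1] \<tau>' by simp
    ultimately have "q (l s) t (l s') t' = k * (s - s')\<^sup>2 + 2 * (e * (s - s')) * (t - t') + \<tau>' * (t - t')\<^sup>2" for s t s' t'
      using f[of s t s' t'] by (simp add: mult_ac)
    then show ?thesis using \<tau>' by blast
  qed
  \<comment> \<open>Within one flat the coefficient of the squared height is the same at all points,
    and every point lies on a line through \<open>x0\<close>.\<close>
  have \<tau>eq: "q x 0 x 1 = \<tau>" for x
  proof -
    obtain l where l: "\<And>s t. dist (l s) (l t) = \<bar>s - t\<bar>" "l 0 = x0" "l (dist x0 x) = x"
      using geodesic_line_through[OF gs gc two, of x0 x0 x] by auto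
    obtain e where "\<forall>s t s' t'. q (l s) t (l s') t' = k * (s - s')\<^sup>2 + 2 * (e * (s - s')) * (t - t') + \<tau> * (t - t')\<^sup>2"
      using line[OF l(1), of \<tau> 0] l by (auto simp: \<tau>_def)
    from this[rule_format, of "dist x0 x" 0 "dist x0 x" 1] show ?thesis using l by simp
  qed
  have line': "\<exists>e. \<forall>s t s' t'. q (l s) t (l s') t' = k * (s - s')\<^sup>2 + 2 * (e * (s - s')) * (t - t') + \<tau> * (t - t')\<^sup>2
      \<and> \<eta> (l s) (l s') = e * (s - s')"
    if l: "\<And>s t. dist (l s) (l t) = \<bar>s - t\<bar>" for l
  proof -
    obtain e where e: "\<forall>s t s' t'. q (l s) t (l s') t' = k * (s - s')\<^sup>2 + 2 * (e * (s - s')) * (t - t') + \<tau> * (t - t')\<^sup>2"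
      using line[OF l, of \<tau> 0] \<tau>eq[of "l 0"] by auto
    then have "\<eta> (l s) (l s') = e * (s - s')" for s s' by (simp add: \<eta>_def l)
    then show ?thesis using e by blast
  qed
  have form: "q x t x' t' = k * (dist x x')\<^sup>2 + 2 * \<eta> x x' * (t - t') + \<tau> * (t - t')\<^sup>2" and anti: "\<eta> x' x = - \<eta> x x'" for x t x' t'
  proof -
    obtain l where l: "\<And>s t. dist (l s) (l t) = \<bar>s - t\<bar>" "l 0 = x" "l (dist x x') = x'"
      using geodesic_line_through[OF gs gc two, of x x x'] by auto
    obtain e where e: "\<forall>s t s' t'. q (l s) t (l s') t' = k * (s - s')\<^sup>2 + 2 * (e * (s - s')) * (t - t') + \<tau> * (t - t')\<^sup>2
      \<and> \<eta> (l s) (l s') = e * (s - s')" using line'[OF l(1)] by blast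
    show "q x t x' t' = k * (dist x x')\<^sup>2 + 2 * \<eta> x x' * (t - t') + \<tau> * (t - t')\<^sup>2"
      using e[rule_format, of 0 t "dist x x'" t'] l by simp
    show "\<eta> x' x = - \<eta> x x'"
      using e[rule_format, of 0 t "dist x x'" t'] e[rule_format, of "dist x x'" t 0 t'] l by simp
  qed
  \<comment> \<open>The way from height \<open>2 * T\<close> over \<open>x\<close> to height 0 over
    \<open>z\<close> is interrupted at height \<open>T\<close> over \<open>y\<close>. Comparing the
    terms of first order in \<open>T\<close> gives subadditivity.\<close>
  have sub: "\<eta> x z \<le> \<eta> x y + \<eta> y z" for x y z
  proof (rule sqrt_quadratic_superadditive[where A = "k * (dist x z)\<^sup>2" and B = "k * (dist x y)\<^sup>2" and C = "k * (dist y z)\<^sup>2" and \<tau> = \<tau>])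
    fix T
    show "0 \<le> k * (dist x y)\<^sup>2 + 2 * T * \<eta> x y + T\<^sup>2 * \<tau>" using nn[of x T y 0] by (simp add: form mult_ac)
    show "0 \<le> k * (dist y z)\<^sup>2 + 2 * T * \<eta> y z + T\<^sup>2 * \<tau>" using nn[of y T z 0] by (simp add: form mult_ac)
    have "2 * T - T = T" by simp
    then show "sqrt (k * (dist x z)\<^sup>2 + 4 * T * \<eta> x z + 4 * T\<^sup>2 * \<tau>)
       \<le> sqrt (k * (dist x y)\<^sup>2 + 2 * T * \<eta> x y + T\<^sup>2 * \<tau>) + sqrt (k * (dist y z)\<^sup>2 + 2 * T * \<eta> y z + T\<^sup>2 * \<tau>)"
      using tri[of x "2 * T" z 0 y T] by (simp add: form power_mult_distrib mult_ac)
  qed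
  have add: "\<eta> x z = \<eta> x y + \<eta> y z" for x y z
    using sub[of x z y] sub[of z x y] anti[of z x] anti[of z y] anti[of y x] by linarith
  define \<beta> where "\<beta> x = \<eta> x x0" for x
  have \<beta>: "\<eta> x y = \<beta> x - \<beta> y" for x y using add[of x x0 y] anti[of x0 y] by (simp add: \<beta>_def)
  have const: "\<beta> x = \<beta> y" for x y
  proof (rule affine_function_constant[OF C R gc nR])
    fix l :: "real \<Rightarrow> 'x" assume l: "\<And>s t. dist (l s) (l t) = \<bar>s - t\<bar>"
    then show "\<exists>k. \<forall>s t. \<beta> (l s) - \<beta> (l t) = k * (s - t)" using line'[OF l] \<beta> by metis
  next
    fix x y
    \<comment> \<open>A nonnegative quadratic polynomial in the height has nonpositive discriminant;
      for \<open>\<tau> = 0\<close> it is linear and must have slope 0.\<close>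
    show "(\<beta> x - \<beta> y)\<^sup>2 \<le> (k * \<tau>) * (dist x y)\<^sup>2"
    proof (cases "\<tau> = 0")
      case True
      have "\<eta> x y = 0"
      proof (rule ccontr)
        assume "\<eta> x y \<noteq> 0"
        then show False using nn[of x "- (k * (dist x y)\<^sup>2 + 1) / (2 * \<eta> x y)" y 0] True by (simp add: form)
      qed
      then show ?thesis using True \<beta> by simp
    next
      case False
      then have "0 < \<tau>" using nn[of x0 0 x0 1] by (simp add: \<tau>_def)
      moreover have "0 \<le> k * (dist x y)\<^sup>2 - (\<eta> x y)\<^sup>2 / \<tau>"
        using nn[of x "- \<eta> x y / \<tau>" y 0] False by (simp add: form power2_eq_square field_simps)
      ultimately show ?thesis using \<beta>[of x y] by (simp add: field_simps)
    qed
  qed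
  have "\<eta> x y = 0" for x y unfolding \<beta> using const[of x y] by simp
  then show ?thesis using form by (intro exI[of _ \<tau>]) simp
qed

section \<open>The metric geometry of \<open>L\<^sup>2(\<Omega>, X)\<close>\<close>

lemma separable_range_mod_null_polish:
  fixes f :: "'a \<Rightarrow> 'x::polish_space"
  shows "separable_range_mod_null M f"
proof -
  obtain D where "countable D" "D \<subseteq> f ` space M" "f ` space M \<subseteq> closure D"
    using separable by blast
  then show ?thesis unfolding separable_range_mod_null_def by (intro bexI[of _ "{}"] exI[of _ D]) auto
qed

lemma L2_fun_iff:
  fixes f :: "'a \<Rightarrow> 'x::polish_space"
  shows "f \<in> L2_fun M \<longleftrightarrow> f \<in> borel_measurable M \<and> (\<exists>x. integrable M (\<lambda>\<omega>. (dist (f \<omega>) x)\<^sup>2))"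
  unfolding L2_fun_def using separable_range_mod_null_polish by blast

lemma L2_fun_measurable [measurable_dest]:
  fixes f :: "'a \<Rightarrow> 'x::polish_space"
  shows "f \<in> L2_fun M \<Longrightarrow> f \<in> borel_measurable M"
  by (simp add: L2_fun_iff)

lemma dist_square_le:
  fixes a b c :: "'x::metric_space"
  shows "(dist a c)\<^sup>2 \<le> 2 * (dist a b)\<^sup>2 + 2 * (dist b c)\<^sup>2"
proof -
  have "(dist a c)\<^sup>2 \<le> (dist a b + dist b c)\<^sup>2" by (intro power_mono dist_triangle) auto
  also have "\<dots> \<le> 2 * (dist a b)\<^sup>2 + 2 * (dist b c)\<^sup>2"
    using sum_squares_bound[of "dist a b" "dist b c"] by (simp add: power2_sum)
  finally show ?thesis .
qed

lemma integrable_dist_square_trans: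
  fixes f g h :: "'a \<Rightarrow> 'x::polish_space"
  assumes [measurable]: "f \<in> borel_measurable M" "h \<in> borel_measurable M"
    and "integrable M (\<lambda>\<omega>. (dist (f \<omega>) (g \<omega>))\<^sup>2)" "integrable M (\<lambda>\<omega>. (dist (g \<omega>) (h \<omega>))\<^sup>2)"
  shows "integrable M (\<lambda>\<omega>. (dist (f \<omega>) (h \<omega>))\<^sup>2)"
proof (rule Bochner_Integration.integrable_bound)
  show "integrable M (\<lambda>\<omega>. 2 * (dist (f \<omega>) (g \<omega>))\<^sup>2 + 2 * (dist (g \<omega>) (h \<omega>))\<^sup>2)"
    using assms by auto
  show "AE \<omega> in M. norm ((dist (f \<omega>) (h \<omega>))\<^sup>2) \<le> norm (2 * (dist (f \<omega>) (g \<omega>))\<^sup>2 + 2 * (dist (g \<omega>) (h \<omega>))\<^sup>2)"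
    using dist_square_le by (intro AE_I2) (simp add: abs_of_nonneg)
qed measurable

lemma L2_fun_integrable_dist_const:
  fixes f :: "'a \<Rightarrow> 'x::polish_space"
  assumes "finite_measure M" "f \<in> L2_fun M"
  shows "integrable M (\<lambda>\<omega>. (dist (f \<omega>) y)\<^sup>2)"
proof -
  interpret finite_measure M by fact
  obtain x where "integrable M (\<lambda>\<omega>. (dist (f \<omega>) x)\<^sup>2)" using assms L2_fun_iff by blast
  then show ?thesis
    using integrable_dist_square_trans[of f M "\<lambda>_. y" "\<lambda>_. x"] assms(2) by (simp add: L2_fun_measurable)
qed

lemma L2_fun_integrable_dist:
  fixes f g :: "'a \<Rightarrow> 'x::polish_space"
  assumes "finite_measure M" "f \<in> L2_fun M" "g \<in> L2_fun M"
  shows "integrable M (\<lambda>\<omega>. (dist (f \<omega>) (g \<omega>))\<^sup>2)"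
proof -
  fix x :: 'x
  show ?thesis
    using integrable_dist_square_trans[of f M g "\<lambda>_. x"] L2_fun_integrable_dist_const[OF assms(1), of _ x] assms
    by (simp add: L2_fun_measurable dist_commute)
qed

lemma L2_funI_dist:
  fixes f g :: "'a \<Rightarrow> 'x::polish_space"
  assumes "finite_measure M" "f \<in> borel_measurable M" "g \<in> L2_fun M"
    and "integrable M (\<lambda>\<omega>. (dist (f \<omega>) (g \<omega>))\<^sup>2)"
  shows "f \<in> L2_fun M"
proof -
  fix x :: 'x
  show ?thesis
    using integrable_dist_square_trans[of f M "\<lambda>_. x" g] L2_fun_integrable_dist_const[OF assms(1,3), of x] assms
    by (auto simp: L2_fun_iff)
qed

lemma L2_fun_bounded:
  fixes f :: "'a \<Rightarrow> 'x::polish_space"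
  assumes "finite_measure M" "f \<in> borel_measurable M" "\<And>\<omega>. \<omega> \<in> space M \<Longrightarrow> (dist (f \<omega>) x)\<^sup>2 \<le> B"
  shows "f \<in> L2_fun M"
proof -
  interpret finite_measure M by fact
  have "integrable M (\<lambda>\<omega>. (dist (f \<omega>) x)\<^sup>2)"
    using assms by (intro integrable_const_bound[of _ B] AE_I2) auto
  then show ?thesis using assms L2_fun_iff by blast
qed

lemma L2_fun_const:
  fixes x :: "'x::polish_space"
  shows "finite_measure M \<Longrightarrow> (\<lambda>_. x) \<in> L2_fun M"
  by (rule L2_fun_bounded[of _ _ x 0]) auto

lemma L2_fun_simple:
  fixes f :: "'a \<Rightarrow> 'x::polish_space"
  assumes "finite_measure M" "simple_function M f"
  shows "f \<in> L2_fun M"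
proof -
  fix x
  have fin: "finite ((\<lambda>y. (dist y x)\<^sup>2) ` f ` space M)" using simple_functionD(1)[OF assms(2)] by blast
  show ?thesis
  proof (rule L2_fun_bounded[OF assms(1)])
    show "f \<in> borel_measurable M" using assms(2) by (rule borel_measurable_simple_function)
    show "(dist (f \<omega>) x)\<^sup>2 \<le> Max ((\<lambda>y. (dist y x)\<^sup>2) ` f ` space M)" if "\<omega> \<in> space M" for \<omega>
      using fin that by (intro Max_ge) auto
  qed
qed

text \<open>For fixed \<open>A\<close> these functions form a product: a scaled copy of
  \<open>X\<close>, with coordinate \<open>x\<close>, times the restrictions of \<open>h\<close> to
  the complement of \<open>A\<close>.\<close>

definition upd :: "'a set \<Rightarrow> 'x \<Rightarrow> ('a \<Rightarrow> 'x) \<Rightarrow> 'a \<Rightarrow> 'x" where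
  "upd A x h = (\<lambda>\<omega>. if \<omega> \<in> A then x else h \<omega>)"

lemma upd_L2_fun:
  fixes h :: "'a \<Rightarrow> 'x::polish_space"
  assumes M: "finite_measure M" and [measurable]: "A \<in> sets M" and h: "h \<in> L2_fun M"
  shows "upd A x h \<in> L2_fun M"
proof (rule L2_funI_dist[OF M _ h])
  have [measurable]: "h \<in> borel_measurable M" using h by (rule L2_fun_measurable)
  show [measurable]: "upd A x h \<in> borel_measurable M" unfolding upd_def by measurable
  show "integrable M (\<lambda>\<omega>. (dist (upd A x h \<omega>) (h \<omega>))\<^sup>2)"
    using L2_fun_integrable_dist_const[OF M h, of x]
    by (rule Bochner_Integration.integrable_bound) (auto simp: upd_def dist_commute)
qed

lemma simple_function_upd:
  assumes "A \<in> sets M" "simple_function M h"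
  shows "simple_function M (upd A x h)"
  unfolding upd_def using assms by (intro simple_function_If_set simple_function_const) (auto simp: sets.Int_space_eq2)

section \<open>Weighted squared distances\<close>

text \<open>Serves to obtain Minkowski's inequality by integrating a pointwise Young inequality for
  every \<open>t\<close>. The optimal \<open>t\<close> is \<open>sqrt B / sqrt A\<close>.\<close>

lemma sqrt_le_add_if_Young:
  fixes A B C :: real
  assumes nn: "0 \<le> A" "0 \<le> B" and Y: "\<And>t. 0 < t \<Longrightarrow> C \<le> (1 + t) * A + (1 + 1 / t) * B"
  shows "sqrt C \<le> sqrt A + sqrt B"
proof (rule field_le_epsilon)
  fix e :: real assume e: "0 < e"
  \<comment> \<open>The shift by \<open>e / 2\<close> keeps the quotient \<open>b / a\<close>
    positive and meaningful when \<open>A\<close> or \<open>B\<close> is 0.\<close>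
  define a b where "a = sqrt A + e / 2" and "b = sqrt B + e / 2"
  have ab: "0 < a" "0 < b" using e nn by (auto simp: a_def b_def add_nonneg_pos)
  have "A \<le> a\<^sup>2" "B \<le> b\<^sup>2" using nn e by (auto simp: a_def b_def intro!: sqrt_le_D)
  have "C \<le> (1 + b / a) * A + (1 + 1 / (b / a)) * B" using Y[of "b / a"] ab by simp
  also have "\<dots> \<le> (1 + b / a) * a\<^sup>2 + (1 + 1 / (b / a)) * b\<^sup>2"
    using ab \<open>A \<le> a\<^sup>2\<close> \<open>B \<le> b\<^sup>2\<close> by (intro add_mono mult_left_mono) auto
  also have "\<dots> = (a + b)\<^sup>2" using ab by (simp add: field_simps power2_eq_square)
  finally have "sqrt C \<le> a + b" using ab by (intro real_le_lsqrt) auto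
  then show "sqrt C \<le> sqrt A + sqrt B + e" by (simp add: a_def b_def)
qed

text \<open>More than indicators, because the weight that represents the form of an indicator is
  recognized as an indicator only afterwards. The bounds hold at every point, which keeps estimates
  pointwise.\<close>

definition weights :: "'a measure \<Rightarrow> ('a \<Rightarrow> real) set" where
  "weights M = {w \<in> borel_measurable M. \<forall>\<omega>. 0 \<le> w \<omega> \<and> w \<omega> \<le> 1}"

lemma weightsD:
  assumes "w \<in> weights M"
  shows "w \<in> borel_measurable M" "0 \<le> w \<omega>" "w \<omega> \<le> 1"
  using assms by (auto simp: weights_def)

lemma integrable_weight_mult:
  fixes u :: "'a \<Rightarrow> real"
  assumes w: "w \<in> weights M" and u: "integrable M u"
  shows "integrable M (\<lambda>\<omega>. w \<omega> * u \<omega>)"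
proof (rule Bochner_Integration.integrable_bound[OF u])
  have [measurable]: "w \<in> borel_measurable M" "u \<in> borel_measurable M" using weightsD(1)[OF w] u by auto
  show "(\<lambda>\<omega>. w \<omega> * u \<omega>) \<in> borel_measurable M" by measurable
  show "AE \<omega> in M. norm (w \<omega> * u \<omega>) \<le> norm (u \<omega>)"
    using weightsD(2,3)[OF w] by (intro AE_I2) (simp add: abs_mult mult_left_le_one_le)
qed

definition wdist2 :: "'a measure \<Rightarrow> ('a \<Rightarrow> real) \<Rightarrow> ('a \<Rightarrow> 'x::metric_space) \<Rightarrow> ('a \<Rightarrow> 'x) \<Rightarrow> real" where
  "wdist2 M w f g = (LINT \<omega>|M. w \<omega> * (dist (f \<omega>) (g \<omega>))\<^sup>2)"

lemma wdist2_integrable: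
  fixes f g :: "'a \<Rightarrow> 'x::polish_space"
  assumes "finite_measure M" "w \<in> weights M" "f \<in> L2_fun M" "g \<in> L2_fun M"
  shows "integrable M (\<lambda>\<omega>. w \<omega> * (dist (f \<omega>) (g \<omega>))\<^sup>2)"
  using integrable_weight_mult[OF assms(2) L2_fun_integrable_dist[OF assms(1,3,4)]] .

lemma wdist2_commute: "wdist2 M w f g = wdist2 M w g f"
  by (simp add: wdist2_def dist_commute)

lemma wdist2_nonneg: "w \<in> weights M \<Longrightarrow> 0 \<le> wdist2 M w f g"
  unfolding wdist2_def by (intro Bochner_Integration.integral_nonneg) (simp add: weightsD(2))

lemma wdist2_self: "wdist2 M w f f = 0"
  by (simp add: wdist2_def)

lemma wdist2_mono:
  fixes f g :: "'a \<Rightarrow> 'x::polish_space"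
  assumes "finite_measure M" "w \<in> weights M" "v \<in> weights M" "f \<in> L2_fun M" "g \<in> L2_fun M"
    and "AE \<omega> in M. w \<omega> \<le> v \<omega>"
  shows "wdist2 M w f g \<le> wdist2 M v f g"
  unfolding wdist2_def using assms
  by (intro integral_mono_AE wdist2_integrable) (auto simp: mult_right_mono)

lemma const_1_weight: "(\<lambda>_. 1) \<in> weights M"
  by (simp add: weights_def)

lemma sqrt_wdist2_triangle:
  fixes f g h :: "'a \<Rightarrow> 'x::polish_space"
  assumes M: "finite_measure M" and w: "w \<in> weights M" and L2: "f \<in> L2_fun M" "g \<in> L2_fun M" "h \<in> L2_fun M"
  shows "sqrt (wdist2 M w f h) \<le> sqrt (wdist2 M w f g) + sqrt (wdist2 M w g h)"
proof (rule sqrt_le_add_if_Young)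
  note int = wdist2_integrable[OF M w L2(1,2)] wdist2_integrable[OF M w L2(1,3)] wdist2_integrable[OF M w L2(2,3)]
  fix t :: real assume t: "0 < t"
  have pt: "(dist a c)\<^sup>2 \<le> (1 + t) * (dist a b)\<^sup>2 + (1 + 1 / t) * (dist b c)\<^sup>2" for a b c :: 'x
  proof -
    have "(dist a c)\<^sup>2 \<le> (dist a b + dist b c)\<^sup>2" by (intro power_mono dist_triangle) auto
    also have "\<dots> \<le> (1 + t) * (dist a b)\<^sup>2 + (1 + 1 / t) * (dist b c)\<^sup>2"
    proof -
      have "0 \<le> (t * dist a b - dist b c)\<^sup>2 / t" using t by simp
      also have "\<dots> = (1 + t) * (dist a b)\<^sup>2 + (1 + 1 / t) * (dist b c)\<^sup>2 - (dist a b + dist b c)\<^sup>2"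
        using t by (simp add: field_simps power2_eq_square)
      finally show ?thesis by simp
    qed
    finally show ?thesis .
  qed
  have "wdist2 M w f h \<le> (LINT \<omega>|M. (1 + t) * (w \<omega> * (dist (f \<omega>) (g \<omega>))\<^sup>2) + (1 + 1 / t) * (w \<omega> * (dist (g \<omega>) (h \<omega>))\<^sup>2))"
    unfolding wdist2_def
  proof (rule integral_mono)
    fix \<omega>
    show "w \<omega> * (dist (f \<omega>) (h \<omega>))\<^sup>2 \<le> (1 + t) * (w \<omega> * (dist (f \<omega>) (g \<omega>))\<^sup>2) + (1 + 1 / t) * (w \<omega> * (dist (g \<omega>) (h \<omega>))\<^sup>2)"
      using mult_left_mono[OF pt[of "f \<omega>" "h \<omega>" "g \<omega>"] weightsD(2)[OF w, of \<omega>]] by (simp add: algebra_simps)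
  qed (use int in \<open>auto intro!: Bochner_Integration.integrable_add\<close>)
  also have "\<dots> = (1 + t) * wdist2 M w f g + (1 + 1 / t) * wdist2 M w g h"
    unfolding wdist2_def using int by (subst Bochner_Integration.integral_add) auto
  finally show "wdist2 M w f h \<le> (1 + t) * wdist2 M w f g + (1 + 1 / t) * wdist2 M w g h" .
qed (use wdist2_nonneg[OF w] in auto)

text \<open>With \<open>a\<close>, \<open>b\<close>, \<open>c\<close> the fibre distances from
  \<open>f\<close> to \<open>m\<close>, \<open>m\<close> to \<open>g\<close> and \<open>f\<close> to
  \<open>g\<close>, the sum of the squares of \<open>a\<close> and \<open>b\<close> divided by
  \<open>l\<close> and \<open>1 - l\<close> is at least the square of \<open>a + b\<close>, which is
  at least that of \<open>c\<close>. The integrals of the two ends agree, so both estimates are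
  equalities almost everywhere: the first fixes the ratio of \<open>a\<close> to \<open>b\<close>,
  the second says \<open>c = a + b\<close>.\<close>

lemma L2_between_imp_AE_between:
  fixes f m g :: "'a \<Rightarrow> 'x::polish_space"
  assumes M: "finite_measure M" and L2: "f \<in> L2_fun M" "m \<in> L2_fun M" "g \<in> L2_fun M"
    and l: "0 \<le> l" "l \<le> 1"
    and fm: "(LINT \<omega>|M. (dist (f \<omega>) (m \<omega>))\<^sup>2) = l\<^sup>2 * (LINT \<omega>|M. (dist (f \<omega>) (g \<omega>))\<^sup>2)"
    and mg: "(LINT \<omega>|M. (dist (m \<omega>) (g \<omega>))\<^sup>2) = (1 - l)\<^sup>2 * (LINT \<omega>|M. (dist (f \<omega>) (g \<omega>))\<^sup>2)"
  shows "AE \<omega> in M. dist (f \<omega>) (m \<omega>) = l * dist (f \<omega>) (g \<omega>) \<and> dist (m \<omega>) (g \<omega>) = (1 - l) * dist (f \<omega>) (g \<omega>)"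
proof -
  note int = L2_fun_integrable_dist[OF M]
  consider "l = 0" | "l = 1" | "0 < l" "l < 1" using l by linarith
  then show ?thesis
  proof cases
    case 1
    then have "AE \<omega> in M. (dist (f \<omega>) (m \<omega>))\<^sup>2 = 0"
      using fm int[OF L2(1,2)] by (subst integral_nonneg_eq_0_iff_AE[symmetric]) auto
    then show ?thesis by eventually_elim (use 1 in auto)
  next
    case 2
    then have "AE \<omega> in M. (dist (m \<omega>) (g \<omega>))\<^sup>2 = 0"
      using mg int[OF L2(2,3)] by (subst integral_nonneg_eq_0_iff_AE[symmetric]) auto
    then show ?thesis by eventually_elim (use 2 in auto)
  next
    case 3
    define D where "D \<omega> = (dist (f \<omega>) (m \<omega>))\<^sup>2 / l + (dist (m \<omega>) (g \<omega>))\<^sup>2 / (1 - l) - (dist (f \<omega>) (g \<omega>))\<^sup>2" for \<omega>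
    have sq: "a\<^sup>2 / l + b\<^sup>2 / (1 - l) - (a + b)\<^sup>2 = ((1 - l) * a - l * b)\<^sup>2 / (l * (1 - l))" for a b
    proof -
      have "1 - l \<noteq> 0" "l \<noteq> 0" using 3 by auto
      then show ?thesis by (simp add: divide_simps power2_eq_square) (simp add: algebra_simps)
    qed
    have tri: "(dist (f \<omega>) (g \<omega>))\<^sup>2 \<le> (dist (f \<omega>) (m \<omega>) + dist (m \<omega>) (g \<omega>))\<^sup>2" for \<omega>
      by (intro power_mono dist_triangle) auto
    have p: "0 < l * (1 - l)" using 3 by simp
    note int' = int[OF L2(1,2)] int[OF L2(2,3)] int[OF L2(1,3)]
    have "0 \<le> D \<omega>" for \<omega>
    proof -
      have "0 \<le> ((1 - l) * dist (f \<omega>) (m \<omega>) - l * dist (m \<omega>) (g \<omega>))\<^sup>2 / (l * (1 - l))" using p by simp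
      then show ?thesis unfolding D_def using sq[of "dist (f \<omega>) (m \<omega>)" "dist (m \<omega>) (g \<omega>)"] tri[of \<omega>] by linarith
    qed
    moreover have "integrable M D" unfolding D_def using int' by auto
    moreover have "integral\<^sup>L M D = 0"
    proof -
      have "integral\<^sup>L M D = (LINT \<omega>|M. (dist (f \<omega>) (m \<omega>))\<^sup>2) / l + (LINT \<omega>|M. (dist (m \<omega>) (g \<omega>))\<^sup>2) / (1 - l)
          - (LINT \<omega>|M. (dist (f \<omega>) (g \<omega>))\<^sup>2)"
        unfolding D_def using int' by simp
      also have "\<dots> = 0" unfolding fm mg using 3 by (simp add: power2_eq_square) (simp add: left_diff_distrib)
      finally show ?thesis .
    qed
    ultimately have "AE \<omega> in M. D \<omega> = 0" using integral_nonneg_eq_0_iff_AE[of M D] by auto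
    then show ?thesis
    proof eventually_elim
      case (elim \<omega>)
      define a b c where "a = dist (f \<omega>) (m \<omega>)" and "b = dist (m \<omega>) (g \<omega>)" and "c = dist (f \<omega>) (g \<omega>)"
      have e: "a\<^sup>2 / l + b\<^sup>2 / (1 - l) - c\<^sup>2 = 0" using elim by (simp add: D_def a_def b_def c_def)
      have t: "c\<^sup>2 \<le> (a + b)\<^sup>2" using tri[of \<omega>] by (simp add: a_def b_def c_def)
      have "0 \<le> ((1 - l) * a - l * b)\<^sup>2 / (l * (1 - l))" using p by simp
      with e t sq[of a b] have z: "((1 - l) * a - l * b)\<^sup>2 / (l * (1 - l)) = 0" "c\<^sup>2 = (a + b)\<^sup>2" by linarith+
      then have "(1 - l) * a = l * b" using p by auto
      moreover have "c = a + b" using z(2) by (rule power2_eq_imp_eq) (auto simp: a_def b_def c_def)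
      ultimately show ?case unfolding a_def[symmetric] b_def[symmetric] c_def[symmetric] by (simp add: algebra_simps)
    qed
  qed
qed

section \<open>The semidistance E and Pythagoras\<close>

text \<open>\<open>G\<close> acts on representatives; that functions equal almost everywhere have
  such images follows from \<open>G_iso\<close>. Without two points no weight could be recovered
  from distances.\<close>

locale L2_embedding = prob_space M for M :: "'a measure" +
  fixes G :: "('a \<Rightarrow> 'x::polish_space) \<Rightarrow> 'a \<Rightarrow> 'x"
  assumes CAT0: "CAT0 (UNIV :: 'x set) dist"
    and rigid: "affinely_rigid_CAT0 (UNIV :: 'x set) dist"
    and complete: "geodesically_complete (UNIV :: 'x set) dist"
    and not_line: "\<not> (\<exists>h :: 'x \<Rightarrow> real. isometry UNIV dist UNIV dist h)"
    and two_points: "\<exists>a b :: 'x. a \<noteq> b"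
    and G_L2: "\<And>f. f \<in> L2_fun M \<Longrightarrow> G f \<in> L2_fun M"
    and G_iso: "\<And>f g. f \<in> L2_fun M \<Longrightarrow> g \<in> L2_fun M \<Longrightarrow>
      (LINT \<omega>|M. (dist (G f \<omega>) (G g \<omega>))\<^sup>2) = (LINT \<omega>|M. (dist (f \<omega>) (g \<omega>))\<^sup>2)"
begin

abbreviation E :: "('a \<Rightarrow> real) \<Rightarrow> ('a \<Rightarrow> 'x) \<Rightarrow> ('a \<Rightarrow> 'x) \<Rightarrow> real" where
  "E w f g \<equiv> wdist2 M w (G f) (G g)"

lemmas finM = finite_measure_axioms

lemma E_triangle:
  assumes "w \<in> weights M" "f \<in> L2_fun M" "g \<in> L2_fun M" "h \<in> L2_fun M"
  shows "sqrt (E w f h) \<le> sqrt (E w f g) + sqrt (E w g h)"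
  using assms by (intro sqrt_wdist2_triangle finM G_L2)

lemma E_le:
  assumes "w \<in> weights M" "f \<in> L2_fun M" "g \<in> L2_fun M"
  shows "E w f g \<le> (LINT \<omega>|M. (dist (f \<omega>) (g \<omega>))\<^sup>2)"
proof -
  have "E w f g \<le> wdist2 M (\<lambda>_. 1) (G f) (G g)"
    using assms weightsD(3)[OF assms(1)] by (intro wdist2_mono finM G_L2 const_1_weight) auto
  then show ?thesis using G_iso assms by (simp add: wdist2_def)
qed

text \<open>Demanded at every point, as the constructions below provide it; for the images under
  \<open>G\<close> it is regained almost everywhere.\<close>

definition fibrewise_between :: "real \<Rightarrow> ('a \<Rightarrow> 'x) \<Rightarrow> ('a \<Rightarrow> 'x) \<Rightarrow> ('a \<Rightarrow> 'x) \<Rightarrow> bool" where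
  "fibrewise_between l f m g \<longleftrightarrow>
    (\<forall>\<omega>. dist (f \<omega>) (m \<omega>) = l * dist (f \<omega>) (g \<omega>) \<and> dist (m \<omega>) (g \<omega>) = (1 - l) * dist (f \<omega>) (g \<omega>))"

lemma G_between:
  assumes L2: "f \<in> L2_fun M" "m \<in> L2_fun M" "g \<in> L2_fun M" and l: "0 \<le> l" "l \<le> 1"
    and b: "fibrewise_between l f m g"
  shows "AE \<omega> in M. dist (G f \<omega>) (G m \<omega>) = l * dist (G f \<omega>) (G g \<omega>) \<and>
    dist (G m \<omega>) (G g \<omega>) = (1 - l) * dist (G f \<omega>) (G g \<omega>)"
proof (rule L2_between_imp_AE_between[OF finM G_L2 G_L2 G_L2 l])
  have "dist (f \<omega>) (m \<omega>) = l * dist (f \<omega>) (g \<omega>)" "dist (m \<omega>) (g \<omega>) = (1 - l) * dist (f \<omega>) (g \<omega>)" for \<omega>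
    using b by (auto simp: fibrewise_between_def)
  then show "(LINT \<omega>|M. (dist (G f \<omega>) (G m \<omega>))\<^sup>2) = l\<^sup>2 * (LINT \<omega>|M. (dist (G f \<omega>) (G g \<omega>))\<^sup>2)"
    "(LINT \<omega>|M. (dist (G m \<omega>) (G g \<omega>))\<^sup>2) = (1 - l)\<^sup>2 * (LINT \<omega>|M. (dist (G f \<omega>) (G g \<omega>))\<^sup>2)"
    using L2 by (simp_all only: G_iso power_mult_distrib integral_mult_right_zero)
qed (use L2 in auto)

lemma E_between:
  assumes w: "w \<in> weights M" and L2: "f \<in> L2_fun M" "m \<in> L2_fun M" "g \<in> L2_fun M" and l: "0 \<le> l" "l \<le> 1"
    and b: "fibrewise_between l f m g"
  shows "E w f m = l\<^sup>2 * E w f g"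
proof -
  have [measurable]: "G f \<in> borel_measurable M" "G m \<in> borel_measurable M" "G g \<in> borel_measurable M"
    "w \<in> borel_measurable M"
    using L2 G_L2 L2_fun_measurable weightsD(1)[OF w] by blast+
  have "E w f m = (LINT \<omega>|M. l\<^sup>2 * (w \<omega> * (dist (G f \<omega>) (G g \<omega>))\<^sup>2))"
    unfolding wdist2_def
  proof (rule integral_cong_AE)
    show "AE \<omega> in M. w \<omega> * (dist (G f \<omega>) (G m \<omega>))\<^sup>2 = l\<^sup>2 * (w \<omega> * (dist (G f \<omega>) (G g \<omega>))\<^sup>2)"
      using G_between[OF L2 l b] by eventually_elim (simp add: power_mult_distrib)
  qed measurable
  then show ?thesis by (simp add: wdist2_def)
qed

lemma E_CN:
  assumes w: "w \<in> weights M" and L2: "f \<in> L2_fun M" "m \<in> L2_fun M" "g \<in> L2_fun M" "z \<in> L2_fun M"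
    and l: "0 \<le> l" "l \<le> 1" and b: "fibrewise_between l f m g"
  shows "E w z m \<le> (1 - l) * E w z f + l * E w z g - l * (1 - l) * E w f g"
proof -
  note int = wdist2_integrable[OF finM w G_L2 G_L2]
  note int' = int[OF L2(4,1)] int[OF L2(4,3)] int[OF L2(1,3)] int[OF L2(4,2)]
  have "E w z m \<le> (LINT \<omega>|M. (1 - l) * (w \<omega> * (dist (G z \<omega>) (G f \<omega>))\<^sup>2) + l * (w \<omega> * (dist (G z \<omega>) (G g \<omega>))\<^sup>2)
      - (l * (1 - l)) * (w \<omega> * (dist (G f \<omega>) (G g \<omega>))\<^sup>2))"
    unfolding wdist2_def
  proof (rule integral_mono_AE)
    show "AE \<omega> in M. w \<omega> * (dist (G z \<omega>) (G m \<omega>))\<^sup>2 \<le> (1 - l) * (w \<omega> * (dist (G z \<omega>) (G f \<omega>))\<^sup>2) + l * (w \<omega> * (dist (G z \<omega>) (G g \<omega>))\<^sup>2)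
      - (l * (1 - l)) * (w \<omega> * (dist (G f \<omega>) (G g \<omega>))\<^sup>2)"
      using G_between[OF L2(1-3) l b]
    proof eventually_elim
      case (elim \<omega>)
      then show ?case
        using mult_left_mono[OF CAT0_CN[OF CAT0 l, of "G f \<omega>" "G m \<omega>" "G g \<omega>" "G z \<omega>"] weightsD(2)[OF w, of \<omega>]]
        by (simp add: algebra_simps)
    qed
  qed (use int' in \<open>auto intro!: Bochner_Integration.integrable_add Bochner_Integration.integrable_diff\<close>)
  also have "\<dots> = (1 - l) * E w z f + l * E w z g - l * (1 - l) * E w f g"
    unfolding wdist2_def using int' by (simp add: Bochner_Integration.integral_diff Bochner_Integration.integral_add)
  finally show ?thesis .
qed

lemmas upd_L2 = upd_L2_fun[OF finM]

text \<open>Moving the value on \<open>A\<close> along a geodesic of \<open>X\<close> is a fibrewise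
  geodesic, at rest off \<open>A\<close>; so \<open>E\<close> restricted to these functions is a
  form on \<open>X\<close> of the kind that rigidity controls.\<close>

lemma E_upd_same:
  assumes w: "w \<in> weights M" and A: "A \<in> sets M" and h: "h \<in> L2_fun M"
  shows "\<exists>k\<ge>0. \<forall>x y. E w (upd A x h) (upd A y h) = k * (dist x y)\<^sup>2"
proof (rule rigid_quadratic[OF CAT0 rigid, where K = 1])
  note L2 = upd_L2[OF A h]
  show "0 \<le> E w (upd A x h) (upd A y h)" for x y by (rule wdist2_nonneg[OF w])
  show "E w (upd A x h) (upd A y h) = E w (upd A y h) (upd A x h)" for x y by (rule wdist2_commute)
  show "sqrt (E w (upd A x h) (upd A z h)) \<le> sqrt (E w (upd A x h) (upd A y h)) + sqrt (E w (upd A y h) (upd A z h))" for x y z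
    using E_triangle[OF w L2 L2 L2] .
  have b: "fibrewise_between l (upd A x h) (upd A m h) (upd A y h)"
    if "dist x m = l * dist x y" "dist m y = (1 - l) * dist x y" for x m y l
    using that by (auto simp: fibrewise_between_def upd_def)
  show "E w (upd A x h) (upd A y h) \<le> 1 * (dist x y)\<^sup>2" for x y
  proof -
    have "E w (upd A x h) (upd A y h) \<le> (LINT \<omega>|M. (dist (upd A x h \<omega>) (upd A y h \<omega>))\<^sup>2)" by (rule E_le[OF w L2 L2])
    also have "\<dots> \<le> (LINT \<omega>|M. (dist x y)\<^sup>2)"
      using L2_fun_integrable_dist[OF finM L2 L2] by (intro integral_mono) (auto simp: upd_def)
    finally show ?thesis by (simp add: prob_space)
  qed
  show "E w (upd A x h) (upd A m h) = l\<^sup>2 * E w (upd A x h) (upd A y h)"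
    if "0 \<le> l" "l \<le> 1" "dist x m = l * dist x y" "dist m y = (1 - l) * dist x y" for x m y l
    by (rule E_between[OF w L2 L2 L2 that(1,2) b[OF that(3,4)]])
  show "E w (upd A z h) (upd A m h) \<le> (1 - l) * E w (upd A z h) (upd A x h) + l * E w (upd A z h) (upd A y h)
      - l * (1 - l) * E w (upd A x h) (upd A y h)"
    if "0 \<le> l" "l \<le> 1" "dist x m = l * dist x y" "dist m y = (1 - l) * dist x y" for x m y l z
    by (rule E_CN[OF w L2 L2 L2 L2 that(1,2) b[OF that(3,4)]])
qed

text \<open>Fibres off \<open>A\<close> move along lines at their own speeds
  \<open>\<kappa> \<omega>\<close>, all with the common parameter \<open>t\<close>. Segments of the
  \<open>(s, t)\<close> plane thus become fibrewise geodesics, and \<open>E\<close> becomes a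
  semidistance on a flat.\<close>

lemma E_upd_flat:
  fixes l :: "real \<Rightarrow> 'x" and h :: "real \<Rightarrow> 'a \<Rightarrow> 'x"
  assumes w: "w \<in> weights M" and A: "A \<in> sets M" and h: "\<And>t. h t \<in> L2_fun M"
    and l: "\<And>s t. dist (l s) (l t) = \<bar>s - t\<bar>"
    and hl: "\<And>\<omega> s t. dist (h s \<omega>) (h t \<omega>) = \<bar>s - t\<bar> * \<kappa> \<omega>"
  shows "\<exists>\<alpha> \<eta> \<tau>. \<forall>s t s' t'. E w (upd A (l s) (h t)) (upd A (l s') (h t')) =
    \<alpha> * (s - s')\<^sup>2 + 2 * \<eta> * (s - s') * (t - t') + \<tau> * (t - t')\<^sup>2"
proof -
  define P where "P a = upd A (l (fst a)) (h (snd a))" for a :: "real \<times> real"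
  have L2: "P a \<in> L2_fun M" for a unfolding P_def by (rule upd_L2[OF A h])
  have \<kappa>: "\<kappa> \<omega> = dist (h 1 \<omega>) (h 0 \<omega>)" for \<omega> using hl[of 1 \<omega> 0] by simp
  have \<kappa>i: "integrable M (\<lambda>\<omega>. (\<kappa> \<omega>)\<^sup>2)" unfolding \<kappa> by (rule L2_fun_integrable_dist[OF finM h h])
  define K where "K = 1 + (LINT \<omega>|M. (\<kappa> \<omega>)\<^sup>2)"
  have b: "fibrewise_between u (P a) (P ((1 - u) *\<^sub>R a + u *\<^sub>R b)) (P b)" if u: "0 \<le> u" "u \<le> 1" for a b u
  proof -
    have d: "\<bar>s - ((1 - u) * s + u * t)\<bar> = u * \<bar>s - t\<bar>" "\<bar>((1 - u) * s + u * t) - t\<bar> = (1 - u) * \<bar>s - t\<bar>" for s t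
    proof -
      have "s - ((1 - u) * s + u * t) = u * (s - t)" "((1 - u) * s + u * t) - t = (1 - u) * (s - t)"
        by (simp_all add: algebra_simps)
      then show "\<bar>s - ((1 - u) * s + u * t)\<bar> = u * \<bar>s - t\<bar>" "\<bar>((1 - u) * s + u * t) - t\<bar> = (1 - u) * \<bar>s - t\<bar>"
        using u by (simp_all add: abs_mult)
    qed
    show ?thesis unfolding fibrewise_between_def P_def upd_def by (simp add: l hl d)
  qed
  have "\<exists>\<alpha> \<eta> \<tau>. \<forall>s t s' t'. E w (P (s, t)) (P (s', t')) = \<alpha> * (s - s')\<^sup>2 + 2 * \<eta> * (s - s') * (t - t') + \<tau> * (t - t')\<^sup>2"
  proof (rule flat_quadratic[where K = K])
    show "0 \<le> E w (P a) (P b)" for a b by (rule wdist2_nonneg[OF w])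
    show "E w (P a) (P b) = E w (P b) (P a)" for a b by (rule wdist2_commute)
    show "sqrt (E w (P a) (P c)) \<le> sqrt (E w (P a) (P b)) + sqrt (E w (P b) (P c))" for a b c
      by (rule E_triangle[OF w L2 L2 L2])
    show "E w (P a) (P b) \<le> K * (norm (a - b))\<^sup>2" for a b
    proof -
      obtain s t s' t' where ab: "a = (s, t)" "b = (s', t')" by (cases a, cases b)
      have n: "(norm (a - b))\<^sup>2 = (s - s')\<^sup>2 + (t - t')\<^sup>2" by (simp add: ab norm_Pair)
      have "E w (P a) (P b) \<le> (LINT \<omega>|M. (dist (P a \<omega>) (P b \<omega>))\<^sup>2)" by (rule E_le[OF w L2 L2])
      also have "\<dots> \<le> (LINT \<omega>|M. (1 + (\<kappa> \<omega>)\<^sup>2) * (norm (a - b))\<^sup>2)"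
      proof (rule integral_mono)
        fix \<omega>
        show "(dist (P a \<omega>) (P b \<omega>))\<^sup>2 \<le> (1 + (\<kappa> \<omega>)\<^sup>2) * (norm (a - b))\<^sup>2"
          unfolding n by (auto simp: P_def upd_def ab l hl power_mult_distrib distrib_right distrib_left mult_ac)
      qed (use L2_fun_integrable_dist[OF finM L2 L2] \<kappa>i in auto)
      also have "\<dots> = K * (norm (a - b))\<^sup>2" using \<kappa>i by (simp add: K_def prob_space)
      finally show ?thesis .
    qed
    show "E w (P a) (P ((1 - u) *\<^sub>R a + u *\<^sub>R b)) = u\<^sup>2 * E w (P a) (P b)" if "0 \<le> u" "u \<le> 1" for a b u
      by (rule E_between[OF w L2 L2 L2 that b[OF that]])
    show "E w (P c) (P ((1 - u) *\<^sub>R a + u *\<^sub>R b)) \<le> (1 - u) * E w (P c) (P a) + u * E w (P c) (P b) - u * (1 - u) * E w (P a) (P b)"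
      if "0 \<le> u" "u \<le> 1" for a b c u
      by (rule E_CN[OF w L2 L2 L2 L2 that b[OF that]])
  qed
  then show ?thesis by (simp add: P_def)
qed

text \<open>All fibres run from \<open>h\<close> to \<open>h'\<close> during the same interval
  \<open>[0, 1]\<close>. A line is chosen for each pair of values; simple functions meet finitely
  many pairs, so arbitrary choices leave the result measurable.\<close>

lemma fibrewise_line:
  fixes h h' :: "'a \<Rightarrow> 'x"
  assumes "simple_function M h" "simple_function M h'"
  obtains H where "H 0 = h" "H 1 = h'" "\<And>t. simple_function M (H t)"
    "\<And>\<omega> s t. dist (H s \<omega>) (H t \<omega>) = \<bar>s - t\<bar> * dist (h \<omega>) (h' \<omega>)"
proof -
  have gs: "geodesic_space (UNIV :: 'x set) dist" using CAT0 unfolding CAT0_def by blast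
  have "\<exists>L. L 0 = y \<and> L 1 = y' \<and> (\<forall>s t. dist (L s) (L t) = \<bar>s - t\<bar> * dist y y')" for y y' :: 'x
  proof -
    obtain l where l: "\<And>s t. dist (l s) (l t) = \<bar>s - t\<bar>" "l 0 = y" "l (dist y y') = y'"
      using geodesic_line_through[OF gs complete two_points, of y y y'] by auto
    have "\<bar>s * dist y y' - t * dist y y'\<bar> = \<bar>s - t\<bar> * dist y y'" for s t
      by (simp add: left_diff_distrib[symmetric] abs_mult)
    then show ?thesis using l by (intro exI[of _ "\<lambda>s. l (s * dist y y')"]) auto
  qed
  then have "\<forall>(y::'x) y'. \<exists>L. L 0 = y \<and> L 1 = y' \<and> (\<forall>s t. dist (L s) (L t) = \<bar>s - t\<bar> * dist y y')"
    by blast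
  then obtain L :: "'x \<Rightarrow> 'x \<Rightarrow> real \<Rightarrow> 'x" where
    L: "\<And>y y'. L y y' 0 = y \<and> L y y' 1 = y' \<and> (\<forall>s t. dist (L y y' s) (L y y' t) = \<bar>s - t\<bar> * dist y y')"
    by (metis (no_types))
  show ?thesis
  proof (rule that[of "\<lambda>t \<omega>. L (h \<omega>) (h' \<omega>) t"])
    show "simple_function M (\<lambda>\<omega>. L (h \<omega>) (h' \<omega>) t)" for t
      using simple_function_compose2[OF assms, of "\<lambda>y y'. L y y' t"] .
  qed (use L in auto)
qed

text \<open>The functions \<open>h\<close> and \<open>h'\<close> are heights 0 and 1 of one
  fibrewise line, to which the vanishing of the mixed term applies. The second claim makes the
  coefficient belonging to \<open>A\<close> independent of what happens off
  \<open>A\<close>.\<close>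

lemma E_upd_Pythagoras:
  assumes w: "w \<in> weights M" and A: "A \<in> sets M" and h: "simple_function M h" "simple_function M h'"
  shows "E w (upd A x h) (upd A x' h') = E w (upd A x h) (upd A x' h) + E w (upd A x' h) (upd A x' h')"
    and "E w (upd A x h) (upd A x' h) = E w (upd A x h') (upd A x' h')"
proof -
  obtain H where H: "H 0 = h" "H 1 = h'" and Hs: "\<And>t. simple_function M (H t)"
    and Hd: "\<And>\<omega> s t. dist (H s \<omega>) (H t \<omega>) = \<bar>s - t\<bar> * dist (h \<omega>) (h' \<omega>)"
    using fibrewise_line[OF h] by blast
  have HL: "H t \<in> L2_fun M" for t by (rule L2_fun_simple[OF finM Hs])
  note L2 = upd_L2[OF A HL]
  obtain k where k: "\<And>x y. E w (upd A x h) (upd A y h) = k * (dist x y)\<^sup>2"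
    using E_upd_same[OF w A HL[of 0]] unfolding H by blast
  have "\<exists>\<tau>. \<forall>x t x' t'. E w (upd A x (H t)) (upd A x' (H t')) = k * (dist x x')\<^sup>2 + \<tau> * (t - t')\<^sup>2"
  proof (rule mixed_term_vanishes[OF CAT0 rigid complete not_line two_points])
    show "0 \<le> E w (upd A x (H t)) (upd A y (H u))" for x t y u by (rule wdist2_nonneg[OF w])
    show "sqrt (E w (upd A x (H t)) (upd A z (H v))) \<le> sqrt (E w (upd A x (H t)) (upd A y (H u))) + sqrt (E w (upd A y (H u)) (upd A z (H v)))"
      for x t y u z v by (rule E_triangle[OF w L2 L2 L2])
    show "E w (upd A x (H 0)) (upd A y (H 0)) = k * (dist x y)\<^sup>2" for x y unfolding H by (rule k)
  next
    fix l :: "real \<Rightarrow> 'x" assume l: "\<And>s t. dist (l s) (l t) = \<bar>s - t\<bar>"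
    show "\<exists>\<alpha> \<eta> \<tau>. \<forall>s t s' t'. E w (upd A (l s) (H t)) (upd A (l s') (H t')) =
      \<alpha> * (s - s')\<^sup>2 + 2 * \<eta> * (s - s') * (t - t') + \<tau> * (t - t')\<^sup>2"
      by (rule E_upd_flat[where \<kappa> = "\<lambda>\<omega>. dist (h \<omega>) (h' \<omega>)", OF w A HL l Hd])
  qed
  then obtain \<tau> where \<tau>: "\<And>x t x' t'. E w (upd A x (H t)) (upd A x' (H t')) = k * (dist x x')\<^sup>2 + \<tau> * (t - t')\<^sup>2"
    by blast
  show "E w (upd A x h) (upd A x' h') = E w (upd A x h) (upd A x' h) + E w (upd A x' h) (upd A x' h')"
    using \<tau>[of x 0 x' 1] \<tau>[of x 0 x' 0] \<tau>[of x' 0 x' 1] by (simp add: H)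
  show "E w (upd A x h) (upd A x' h) = E w (upd A x h') (upd A x' h')"
    using \<tau>[of x 0 x' 0] \<tau>[of x 1 x' 1] by (simp add: H)
qed

end

section \<open>The weight that represents E\<close>

lemma L2_fun_simple_approximation:
  fixes f :: "'a \<Rightarrow> 'x::polish_space"
  assumes M: "finite_measure M" and f: "f \<in> L2_fun M"
  obtains F where "\<And>n. simple_function M (F n)" "(\<lambda>n. LINT \<omega>|M. (dist (F n \<omega>) (f \<omega>))\<^sup>2) \<longlonglongrightarrow> 0"
proof -
  have fm [measurable]: "f \<in> borel_measurable M" using f by (rule L2_fun_measurable)
  fix z :: 'x
  obtain F where F: "\<And>n. simple_function M (F n)" "\<And>\<omega>. \<omega> \<in> space M \<Longrightarrow> (\<lambda>n. F n \<omega>) \<longlonglongrightarrow> f \<omega>"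
    "\<And>n \<omega>. \<omega> \<in> space M \<Longrightarrow> dist (F n \<omega>) z \<le> 2 * dist (f \<omega>) z"
    using borel_measurable_implies_sequence_metric[OF fm, of z] by blast
  have [measurable]: "F n \<in> borel_measurable M" for n using F(1) by (rule borel_measurable_simple_function)
  have "(\<lambda>n. LINT \<omega>|M. (dist (F n \<omega>) (f \<omega>))\<^sup>2) \<longlonglongrightarrow> (LINT \<omega>|M. 0)"
  proof (rule integral_dominated_convergence)
    \<comment> \<open>By the choice of \<open>F\<close> the distance from
      \<open>F n \<omega>\<close> to \<open>f \<omega>\<close> is at most
      \<open>3 * dist (f \<omega>) z\<close>, whence 9.\<close>
    show "integrable M (\<lambda>\<omega>. 9 * (dist (f \<omega>) z)\<^sup>2)" using L2_fun_integrable_dist_const[OF M f] by simp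
    show "AE \<omega> in M. (\<lambda>n. (dist (F n \<omega>) (f \<omega>))\<^sup>2) \<longlonglongrightarrow> 0"
    proof (rule AE_I2)
      fix \<omega> assume "\<omega> \<in> space M"
      then have "(\<lambda>n. (dist (F n \<omega>) (f \<omega>))\<^sup>2) \<longlonglongrightarrow> (dist (f \<omega>) (f \<omega>))\<^sup>2"
        using F(2) by (intro tendsto_intros)
      then show "(\<lambda>n. (dist (F n \<omega>) (f \<omega>))\<^sup>2) \<longlonglongrightarrow> 0" by simp
    qed
    show "AE \<omega> in M. norm ((dist (F n \<omega>) (f \<omega>))\<^sup>2) \<le> 9 * (dist (f \<omega>) z)\<^sup>2" for n
    proof (rule AE_I2)
      fix \<omega> assume "\<omega> \<in> space M"
      then have "dist (F n \<omega>) (f \<omega>) \<le> 3 * dist (f \<omega>) z"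
        using F(3)[of \<omega> n] dist_triangle2[of "F n \<omega>" "f \<omega>" z] by linarith
      then have "(dist (F n \<omega>) (f \<omega>))\<^sup>2 \<le> (3 * dist (f \<omega>) z)\<^sup>2" by (intro power_mono) auto
      then show "norm ((dist (F n \<omega>) (f \<omega>))\<^sup>2) \<le> 9 * (dist (f \<omega>) z)\<^sup>2" by (simp add: power_mult_distrib)
    qed
  qed measurable
  then have "(\<lambda>n. LINT \<omega>|M. (dist (F n \<omega>) (f \<omega>))\<^sup>2) \<longlonglongrightarrow> 0" by simp
  then show ?thesis by (rule that[OF F(1)])
qed

lemma wdist2_tendsto:
  fixes f g :: "'a \<Rightarrow> 'x::polish_space"
  assumes M: "finite_measure M" and w: "w \<in> weights M"
    and L2: "f \<in> L2_fun M" "g \<in> L2_fun M" "\<And>n. F n \<in> L2_fun M" "\<And>n. K n \<in> L2_fun M"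
    and lim: "(\<lambda>n. LINT \<omega>|M. (dist (F n \<omega>) (f \<omega>))\<^sup>2) \<longlonglongrightarrow> 0" "(\<lambda>n. LINT \<omega>|M. (dist (K n \<omega>) (g \<omega>))\<^sup>2) \<longlonglongrightarrow> 0"
  shows "(\<lambda>n. wdist2 M w (F n) (K n)) \<longlonglongrightarrow> wdist2 M w f g"
proof -
  define W where "W f g = sqrt (wdist2 M w f g)" for f g :: "'a \<Rightarrow> 'x"
  have tri: "W a c \<le> W a b + W b c" if "a \<in> L2_fun M" "b \<in> L2_fun M" "c \<in> L2_fun M" for a b c
    unfolding W_def using sqrt_wdist2_triangle[OF M w that] .
  have com: "W a b = W b a" for a b by (simp add: W_def wdist2_commute)
  have le: "W a b \<le> sqrt (LINT \<omega>|M. (dist (a \<omega>) (b \<omega>))\<^sup>2)" if "a \<in> L2_fun M" "b \<in> L2_fun M" for a b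
    unfolding W_def using wdist2_mono[OF M w const_1_weight that] weightsD(3)[OF w] by (simp add: wdist2_def)
  have lim0: "(\<lambda>n. sqrt (LINT \<omega>|M. (dist (F n \<omega>) (f \<omega>))\<^sup>2) + sqrt (LINT \<omega>|M. (dist (K n \<omega>) (g \<omega>))\<^sup>2)) \<longlonglongrightarrow> 0"
    using tendsto_add[OF tendsto_real_sqrt[OF lim(1)] tendsto_real_sqrt[OF lim(2)]] by simp
  have "(\<lambda>n. W (F n) (K n) - W f g) \<longlonglongrightarrow> 0"
  proof (rule Lim_null_comparison[OF always_eventually lim0], rule allI)
    fix n
    have "W (F n) (K n) \<le> W (F n) f + W f g + W g (K n)"
      using tri[of "F n" f "K n"] tri[of f g "K n"] L2 by force
    moreover have "W f g \<le> W f (F n) + W (F n) (K n) + W (K n) g"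
      using tri[of f "F n" g] tri[of "F n" "K n" g] L2 by force
    ultimately have "\<bar>W (F n) (K n) - W f g\<bar> \<le> W (F n) f + W (K n) g"
      using com[of f "F n"] com[of g "K n"] by linarith
    also have "\<dots> \<le> sqrt (LINT \<omega>|M. (dist (F n \<omega>) (f \<omega>))\<^sup>2) + sqrt (LINT \<omega>|M. (dist (K n \<omega>) (g \<omega>))\<^sup>2)"
      using le L2 by (intro add_mono) auto
    finally show "norm (W (F n) (K n) - W f g) \<le> sqrt (LINT \<omega>|M. (dist (F n \<omega>) (f \<omega>))\<^sup>2) + sqrt (LINT \<omega>|M. (dist (K n \<omega>) (g \<omega>))\<^sup>2)"
      by simp
  qed
  then have "(\<lambda>n. W (F n) (K n)) \<longlonglongrightarrow> W f g" using LIM_zero_iff by blast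
  then have "(\<lambda>n. (W (F n) (K n))\<^sup>2) \<longlonglongrightarrow> (W f g)\<^sup>2" by (intro tendsto_intros)
  then show ?thesis unfolding W_def by (simp add: wdist2_nonneg[OF w])
qed

lemma wdist2_cong_AE:
  fixes f g f' g' :: "'a \<Rightarrow> 'x::polish_space"
  assumes "w \<in> weights M" "f \<in> L2_fun M" "g \<in> L2_fun M" "f' \<in> L2_fun M" "g' \<in> L2_fun M"
    and "AE \<omega> in M. f \<omega> = f' \<omega>" "AE \<omega> in M. g \<omega> = g' \<omega>"
  shows "wdist2 M w f g = wdist2 M w f' g'"
proof -
  have [measurable]: "w \<in> borel_measurable M" "f \<in> borel_measurable M" "g \<in> borel_measurable M"
    "f' \<in> borel_measurable M" "g' \<in> borel_measurable M"
    using assms weightsD(1) L2_fun_measurable by blast+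
  show ?thesis unfolding wdist2_def
  proof (rule integral_cong_AE)
    show "AE \<omega> in M. w \<omega> * (dist (f \<omega>) (g \<omega>))\<^sup>2 = w \<omega> * (dist (f' \<omega>) (g' \<omega>))\<^sup>2"
      using assms(6,7) by eventually_elim simp
  qed measurable
qed

lemma wdist2_weight_cong_AE:
  fixes f g :: "'a \<Rightarrow> 'x::polish_space"
  assumes "w \<in> weights M" "v \<in> weights M" "f \<in> L2_fun M" "g \<in> L2_fun M" and "AE \<omega> in M. w \<omega> = v \<omega>"
  shows "wdist2 M w f g = wdist2 M v f g"
proof -
  have [measurable]: "w \<in> borel_measurable M" "v \<in> borel_measurable M" "f \<in> borel_measurable M" "g \<in> borel_measurable M"
    using assms weightsD(1) L2_fun_measurable by blast+
  show ?thesis unfolding wdist2_def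
  proof (rule integral_cong_AE)
    show "AE \<omega> in M. w \<omega> * (dist (f \<omega>) (g \<omega>))\<^sup>2 = v \<omega> * (dist (f \<omega>) (g \<omega>))\<^sup>2"
      using assms(5) by eventually_elim simp
  qed measurable
qed

lemma density_le_1:
  fixes u :: "'a \<Rightarrow> ennreal"
  assumes "finite_measure M" and [measurable]: "u \<in> borel_measurable M"
    and le: "\<And>A. A \<in> sets M \<Longrightarrow> (\<integral>\<^sup>+\<omega>. u \<omega> * indicator A \<omega> \<partial>M) \<le> emeasure M A"
  shows "AE \<omega> in M. u \<omega> \<le> 1"
proof -
  interpret finite_measure M by fact
  define A where "A = {\<omega> \<in> space M. 1 < u \<omega>}"
  have [measurable]: "A \<in> sets M" unfolding A_def by measurable
  define v where "v \<omega> = (u \<omega> - 1) * indicator A \<omega>" for \<omega>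
  have [measurable]: "v \<in> borel_measurable M" unfolding v_def by measurable
  have "integral\<^sup>N M v + emeasure M A = (\<integral>\<^sup>+\<omega>. v \<omega> + indicator A \<omega> \<partial>M)"
    by (subst nn_integral_add) auto
  also have "\<dots> = (\<integral>\<^sup>+\<omega>. u \<omega> * indicator A \<omega> \<partial>M)"
    by (intro nn_integral_cong) (auto simp: v_def A_def indicator_def less_imp_le diff_add_cancel_ennreal)
  also have "\<dots> \<le> 0 + emeasure M A" using le by simp
  finally have "emeasure M A + integral\<^sup>N M v \<le> emeasure M A + 0" by (simp only: add.commute)
  then have "integral\<^sup>N M v \<le> 0" unfolding ennreal_add_left_cancel_le using emeasure_finite[of A] by auto
  then have "AE \<omega> in M. v \<omega> = 0" using nn_integral_0_iff_AE[of v M] by simp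
  then show ?thesis
  proof (rule AE_mp, intro AE_I2 impI)
    fix \<omega> assume "\<omega> \<in> space M" "v \<omega> = 0"
    then show "u \<omega> \<le> 1" by (cases "\<omega> \<in> A") (auto simp: v_def A_def diff_eq_0_iff_ennreal not_less)
  qed
qed

context L2_embedding
begin

lemma E_cong_AE:
  assumes w: "w \<in> weights M" and L2: "f \<in> L2_fun M" "g \<in> L2_fun M" "g' \<in> L2_fun M" and eq: "AE \<omega> in M. g \<omega> = g' \<omega>"
  shows "E w f g = E w f g'"
proof -
  have [measurable]: "g \<in> borel_measurable M" "g' \<in> borel_measurable M" using L2 L2_fun_measurable by blast+
  have "(LINT \<omega>|M. (dist (g \<omega>) (g' \<omega>))\<^sup>2) = (LINT \<omega>|M. 0)"
    by (rule integral_cong_AE) (measurable, use eq in \<open>eventually_elim, simp\<close>)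
  then have "(LINT \<omega>|M. (dist (G g \<omega>) (G g' \<omega>))\<^sup>2) = 0" using G_iso L2 by simp
  then have "AE \<omega> in M. (dist (G g \<omega>) (G g' \<omega>))\<^sup>2 = 0"
    using L2_fun_integrable_dist[OF finM G_L2[OF L2(2)] G_L2[OF L2(3)]]
    by (subst integral_nonneg_eq_0_iff_AE[symmetric]) auto
  then have "AE \<omega> in M. G g \<omega> = G g' \<omega>" by eventually_elim simp
  then show ?thesis using L2 by (intro wdist2_cong_AE w G_L2) auto
qed

text \<open>The set function \<open>k\<close> will be the measure whose density is the new weight;
  it is dominated by \<open>prob\<close> because the given weight is at most 1.\<close>

lemma E_coefficient:
  assumes w: "w \<in> weights M"
  obtains k where "\<And>A. A \<in> sets M \<Longrightarrow> 0 \<le> k A" "\<And>A. A \<in> sets M \<Longrightarrow> k A \<le> prob A"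
    "\<And>A h x y. A \<in> sets M \<Longrightarrow> simple_function M h \<Longrightarrow> E w (upd A x h) (upd A y h) = k A * (dist x y)\<^sup>2"
proof -
  obtain x0 y0 :: 'x where ne: "x0 \<noteq> y0" using two_points by blast
  define c :: "'a \<Rightarrow> 'x" where "c = (\<lambda>_. x0)"
  have cs: "simple_function M c" by (simp add: c_def)
  have cL: "c \<in> L2_fun M" by (rule L2_fun_simple[OF finM cs])
  have "\<exists>k. \<forall>A. A \<in> sets M \<longrightarrow> k A \<ge> 0 \<and> (\<forall>x y. E w (upd A x c) (upd A y c) = k A * (dist x y)\<^sup>2)"
    using E_upd_same[OF w _ cL] by (intro choice) blast
  then obtain k where k: "\<And>A. A \<in> sets M \<Longrightarrow> k A \<ge> 0"
    "\<And>A x y. A \<in> sets M \<Longrightarrow> E w (upd A x c) (upd A y c) = k A * (dist x y)\<^sup>2" by blast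
  show ?thesis
  proof (rule that[of k])
    fix A assume A: "A \<in> sets M"
    have "k A * (dist x0 y0)\<^sup>2 \<le> (LINT \<omega>|M. (dist (upd A x0 c \<omega>) (upd A y0 c \<omega>))\<^sup>2)"
      unfolding k(2)[OF A, symmetric] using E_le[OF w upd_L2[OF A cL] upd_L2[OF A cL]] .
    also have "\<dots> = (LINT \<omega>|M. (dist x0 y0)\<^sup>2 * indicator A \<omega>)"
      by (intro Bochner_Integration.integral_cong) (auto simp: upd_def)
    also have "\<dots> = prob A * (dist x0 y0)\<^sup>2" using A by simp
    finally show "k A \<le> prob A" using ne by simp
  next
    show "E w (upd A x h) (upd A y h) = k A * (dist x y)\<^sup>2" if "A \<in> sets M" "simple_function M h" for A h x y
      using E_upd_Pythagoras(2)[OF w that cs] k(2)[OF that(1)] by simp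
  qed (rule k(1))
qed

text \<open>\<open>f\<close> is turned into \<open>g\<close> on one joint level set after the other;
  by Pythagoras the costs add up.\<close>

lemma E_simple:
  assumes w: "w \<in> weights M"
    and k: "\<And>A h x y. A \<in> sets M \<Longrightarrow> simple_function M h \<Longrightarrow> E w (upd A x h) (upd A y h) = k A * (dist x y)\<^sup>2"
    and f: "simple_function M f" and g: "simple_function M g"
  shows "E w f g = (\<Sum>p\<in>(\<lambda>\<omega>. (f \<omega>, g \<omega>)) ` space M. k {\<omega> \<in> space M. (f \<omega>, g \<omega>) = p} * (dist (fst p) (snd p))\<^sup>2)"
proof -
  define S where "S = (\<lambda>\<omega>. (f \<omega>, g \<omega>)) ` space M"
  have sp: "simple_function M (\<lambda>\<omega>. (f \<omega>, g \<omega>))" using f g by (rule simple_function_Pair)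
  have finS: "finite S" unfolding S_def using sp by (rule simple_functionD)
  define A where "A p = {\<omega> \<in> space M. (f \<omega>, g \<omega>) = p}" for p
  have A: "A p \<in> sets M" for p
  proof -
    have "A p = (\<lambda>\<omega>. (f \<omega>, g \<omega>)) -` {p} \<inter> space M" by (auto simp: A_def)
    then show ?thesis using simple_functionD(2)[OF sp, of "{p}"] by simp
  qed
  define gT where "gT T = (\<lambda>\<omega>. if \<omega> \<in> space M \<and> (f \<omega>, g \<omega>) \<in> T then g \<omega> else f \<omega>)" for T
  have "simple_function M (gT T) \<and> E w (gT T) f = (\<Sum>p\<in>T. k (A p) * (dist (fst p) (snd p))\<^sup>2)" if "finite T" for T
    using that
  proof (induction T rule: finite_induct)
    case empty
    then show ?case using f by (simp add: gT_def wdist2_self)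
  next
    case (insert p T)
    obtain x y where p: "p = (x, y)" by (cases p)
    have 1: "gT (insert p T) = upd (A p) y (gT T)"
      by (auto simp: gT_def upd_def A_def p fun_eq_iff)
    have 2: "gT T = upd (A p) x (gT T)" using insert(2) by (auto simp: gT_def upd_def A_def p fun_eq_iff)
    have 3: "f = upd (A p) x f" by (auto simp: upd_def A_def p fun_eq_iff)
    have s: "simple_function M (gT T)" using insert by blast
    have "E w (gT (insert p T)) f = E w (upd (A p) y (gT T)) (upd (A p) x f)" using 1 3 by simp
    also have "\<dots> = E w (upd (A p) y (gT T)) (upd (A p) x (gT T)) + E w (upd (A p) x (gT T)) (upd (A p) x f)"
      by (rule E_upd_Pythagoras(1)[OF w A s f])
    also have "\<dots> = k (A p) * (dist y x)\<^sup>2 + E w (gT T) f" using k[OF A s, of p y x] 2 3 by simp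
    finally show ?case
      using insert simple_function_upd[OF A s] 1 by (simp add: p dist_commute)
  qed
  from this[OF finS] have s: "simple_function M (gT S)" and e: "E w (gT S) f = (\<Sum>p\<in>S. k (A p) * (dist (fst p) (snd p))\<^sup>2)" by auto
  \<comment> \<open>Off \<open>space M\<close> the functions \<open>g\<close> and
    \<open>gT S\<close> may differ.\<close>
  have "E w f g = E w f (gT S)"
  proof (rule E_cong_AE[OF w])
    show "AE \<omega> in M. g \<omega> = gT S \<omega>" by (rule AE_I2) (auto simp: gT_def S_def)
  qed (use f g s L2_fun_simple[OF finM] in auto)
  then show ?thesis using e by (simp add: wdist2_commute S_def A_def)
qed

text \<open>Domination by \<open>prob\<close> upgrades finite additivity of the coefficients to
  countable additivity, through continuity at the empty set, and bounds the Radon-Nikodym density by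
  1. Both sides are continuous in \<open>f\<close> and \<open>g\<close>, so agreement on simple
  functions suffices.\<close>

lemma E_eq_density:
  assumes w: "w \<in> weights M"
  obtains v where "v \<in> weights M" "\<And>f g. f \<in> L2_fun M \<Longrightarrow> g \<in> L2_fun M \<Longrightarrow> E w f g = wdist2 M v f g"
proof -
  obtain k where k: "\<And>A. A \<in> sets M \<Longrightarrow> 0 \<le> k A" "\<And>A. A \<in> sets M \<Longrightarrow> k A \<le> prob A"
    and kE: "\<And>A h x y. A \<in> sets M \<Longrightarrow> simple_function M h \<Longrightarrow> E w (upd A x h) (upd A y h) = k A * (dist x y)\<^sup>2"
    using E_coefficient[OF w] by metis
  obtain x0 y0 :: 'x where ne: "x0 \<noteq> y0" using two_points by blast
  define c :: "'a \<Rightarrow> 'x" where "c = (\<lambda>_. x0)"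
  have cs: "simple_function M c" by (simp add: c_def)
  \<comment> \<open>The change from \<open>x0\<close> to \<open>y0\<close> on
    \<open>A \<union> B\<close> is made on \<open>B\<close> first and on \<open>A\<close>
    afterwards.\<close>
  have kadd: "k (A \<union> B) = k A + k B" if AB: "A \<in> sets M" "B \<in> sets M" "A \<inter> B = {}" for A B
  proof -
    have s: "simple_function M (upd B y0 c)" using AB cs by (intro simple_function_upd)
    have e: "upd (A \<union> B) y0 c = upd A y0 (upd B y0 c)" "upd (A \<union> B) x0 c = c" "upd A x0 c = c" "upd B x0 c = c"
      "upd A x0 (upd B y0 c) = upd B y0 c"
      using AB(3) by (auto simp: upd_def c_def fun_eq_iff)
    have "k (A \<union> B) * (dist y0 x0)\<^sup>2 = E w (upd A y0 (upd B y0 c)) (upd A x0 c)"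
      using kE[of "A \<union> B" c y0 x0] AB cs e by auto
    also have "\<dots> = E w (upd A y0 (upd B y0 c)) (upd A x0 (upd B y0 c)) + E w (upd A x0 (upd B y0 c)) (upd A x0 c)"
      by (rule E_upd_Pythagoras(1)[OF w AB(1) s cs])
    also have "\<dots> = k A * (dist y0 x0)\<^sup>2 + E w (upd B y0 c) (upd B x0 c)"
      using kE[OF AB(1) s, of y0 x0] e by simp
    also have "\<dots> = (k A + k B) * (dist y0 x0)\<^sup>2" using kE[OF AB(2) cs] by (simp add: distrib_right)
    finally show ?thesis using ne by simp
  qed
  have k0: "k {} = 0" using kadd[of "{}" "{}"] by simp
  have pos: "positive (sets M) (\<lambda>A. ennreal (k A))" by (simp add: positive_def k0)
  have ca: "countably_additive (sets M) (\<lambda>A. ennreal (k A))"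
  proof (rule sets.empty_continuous_imp_countably_additive[OF pos])
    show "Measure_Space.additive (sets M) (\<lambda>A. ennreal (k A))"
      unfolding Measure_Space.additive_def using kadd k(1) by (auto simp: ennreal_plus)
    fix A :: "nat \<Rightarrow> 'a set" assume A: "range A \<subseteq> sets M" "decseq A" "(\<Inter>i. A i) = {}"
    have "(\<lambda>i. prob (A i)) \<longlonglongrightarrow> prob (\<Inter>i. A i)" by (rule finite_Lim_measure_decseq[OF A(1,2)])
    then have lim: "(\<lambda>i. prob (A i)) \<longlonglongrightarrow> 0" using A(3) by simp
    have "\<forall>i. norm (k (A i)) \<le> prob (A i)" using A(1) k by auto
    then have "(\<lambda>i. k (A i)) \<longlonglongrightarrow> 0" by (rule Lim_null_comparison[OF always_eventually lim])
    then show "(\<lambda>i. ennreal (k (A i))) \<longlonglongrightarrow> 0" using tendsto_ennrealI[of "\<lambda>i. k (A i)" 0] by simp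
  qed simp
  define N where "N = measure_of (space M) (sets M) (\<lambda>A. ennreal (k A))"
  have sN: "sets N = sets M" "space N = space M" by (simp_all add: N_def sets.space_closed)
  have eN: "emeasure N A = ennreal (k A)" if "A \<in> sets M" for A
    unfolding N_def using emeasure_measure_of_sigma[OF sets.sigma_algebra_axioms pos ca that] .
  have "absolutely_continuous M N"
    unfolding absolutely_continuous_def
  proof
    fix A assume "A \<in> null_sets M"
    then have "A \<in> sets M" "prob A = 0" by (auto simp: null_sets_def measure_def)
    then show "A \<in> null_sets N" using k(1,2)[of A] eN[of A] sN by (intro null_setsI) auto
  qed
  moreover have "finite_measure N" using eN[of "space M"] sN by (intro finite_measureI) auto
  ultimately obtain u where u: "u \<in> borel_measurable M" "density M u = N"
    using Radon_Nikodym_finite_measure[of N] sN by auto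
  have ku: "ennreal (k A) = (\<integral>\<^sup>+\<omega>. u \<omega> * indicator A \<omega> \<partial>M)" if "A \<in> sets M" for A
    using eN[OF that] u emeasure_density[OF u(1) that] by simp
  have u1: "AE \<omega> in M. u \<omega> \<le> 1"
    using ku k(2) by (intro density_le_1[OF finM u(1)]) (metis emeasure_eq_measure ennreal_leI)
  \<comment> \<open>Cut off at 1 because weights are bounded everywhere, the density only almost
    everywhere.\<close>
  define v where "v \<omega> = enn2real (min (u \<omega>) 1)" for \<omega>
  have v: "v \<in> weights M"
    using u(1) unfolding weights_def v_def by (auto simp: enn2real_leI)
  have [measurable]: "v \<in> borel_measurable M" by (rule weightsD(1)[OF v])
  have kv: "k A = (LINT \<omega>|M. v \<omega> * indicator A \<omega>)" and vi: "integrable M (\<lambda>\<omega>. v \<omega> * indicator A \<omega>)"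
    if A: "A \<in> sets M" for A
  proof -
    show i: "integrable M (\<lambda>\<omega>. v \<omega> * indicator A \<omega>)" using A by (intro integrable_weight_mult[OF v]) (simp add: less_top[symmetric])
    have "ennreal (k A) = (\<integral>\<^sup>+\<omega>. ennreal (v \<omega> * indicator A \<omega>) \<partial>M)"
      unfolding ku[OF A]
    proof (rule nn_integral_cong_AE)
      show "AE \<omega> in M. u \<omega> * indicator A \<omega> = ennreal (v \<omega> * indicator A \<omega>)"
        using u1
      proof eventually_elim
        case (elim \<omega>)
        then have "u \<omega> < top" by (metis ennreal_one_less_top order_le_less_trans)
        then have "ennreal (v \<omega>) = u \<omega>" using elim by (simp add: v_def min_absorb1)
        then show ?case by (simp add: indicator_def)
      qed
    qed
    also have "\<dots> = ennreal (LINT \<omega>|M. v \<omega> * indicator A \<omega>)"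
      using i weightsD(2)[OF v] by (intro nn_integral_eq_integral) auto
    finally show "k A = (LINT \<omega>|M. v \<omega> * indicator A \<omega>)"
      using k(1)[OF A] weightsD(2)[OF v] by (subst (asm) ennreal_inj) (auto intro!: Bochner_Integration.integral_nonneg)
  qed
  have simple_eq: "E w f g = wdist2 M v f g" if f: "simple_function M f" and g: "simple_function M g" for f g
  proof -
    define S where "S = (\<lambda>\<omega>. (f \<omega>, g \<omega>)) ` space M"
    have sp: "simple_function M (\<lambda>\<omega>. (f \<omega>, g \<omega>))" using f g by (rule simple_function_Pair)
    have finS: "finite S" unfolding S_def using sp by (rule simple_functionD)
    define A where "A p = {\<omega> \<in> space M. (f \<omega>, g \<omega>) = p}" for p
    have A: "A p \<in> sets M" for p
    proof -
      have "A p = (\<lambda>\<omega>. (f \<omega>, g \<omega>)) -` {p} \<inter> space M" by (auto simp: A_def)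
      then show ?thesis using simple_functionD(2)[OF sp, of "{p}"] by simp
    qed
    have "E w f g = (\<Sum>p\<in>S. k (A p) * (dist (fst p) (snd p))\<^sup>2)"
      unfolding S_def A_def by (rule E_simple[OF w kE f g])
    also have "\<dots> = (\<Sum>p\<in>S. LINT \<omega>|M. v \<omega> * indicator (A p) \<omega> * (dist (fst p) (snd p))\<^sup>2)"
      by (simp add: kv[OF A])
    also have "\<dots> = (LINT \<omega>|M. (\<Sum>p\<in>S. v \<omega> * indicator (A p) \<omega> * (dist (fst p) (snd p))\<^sup>2))"
      using vi[OF A] by (intro Bochner_Integration.integral_sum[symmetric]) auto
    also have "\<dots> = wdist2 M v f g"
      unfolding wdist2_def
    proof (rule Bochner_Integration.integral_cong[OF refl])
      fix \<omega> assume \<omega>: "\<omega> \<in> space M"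
      then have "(\<Sum>p\<in>S. v \<omega> * indicator (A p) \<omega> * (dist (fst p) (snd p))\<^sup>2)
          = (\<Sum>p\<in>S. if p = (f \<omega>, g \<omega>) then v \<omega> * (dist (f \<omega>) (g \<omega>))\<^sup>2 else 0)"
        by (intro sum.cong) (auto simp: A_def)
      then show "(\<Sum>p\<in>S. v \<omega> * indicator (A p) \<omega> * (dist (fst p) (snd p))\<^sup>2) = v \<omega> * (dist (f \<omega>) (g \<omega>))\<^sup>2"
        using \<omega> finS by (simp add: S_def)
    qed
    finally show ?thesis .
  qed
  show ?thesis
  proof (rule that[OF v])
    fix f g :: "'a \<Rightarrow> 'x" assume L2: "f \<in> L2_fun M" "g \<in> L2_fun M"
    obtain F where F: "\<And>n. simple_function M (F n)" "(\<lambda>n. LINT \<omega>|M. (dist (F n \<omega>) (f \<omega>))\<^sup>2) \<longlonglongrightarrow> 0"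
      using L2_fun_simple_approximation[OF finM L2(1)] by blast
    obtain K where K: "\<And>n. simple_function M (K n)" "(\<lambda>n. LINT \<omega>|M. (dist (K n \<omega>) (g \<omega>))\<^sup>2) \<longlonglongrightarrow> 0"
      using L2_fun_simple_approximation[OF finM L2(2)] by blast
    have FK: "F n \<in> L2_fun M" "K n \<in> L2_fun M" for n using F K L2_fun_simple[OF finM] by blast+
    have "(\<lambda>n. wdist2 M v (F n) (K n)) \<longlonglongrightarrow> wdist2 M v f g"
      by (rule wdist2_tendsto[OF finM v L2 FK F(2) K(2)])
    moreover have "(\<lambda>n. E w (F n) (K n)) \<longlonglongrightarrow> E w f g"
      using F(2) K(2) L2 FK by (intro wdist2_tendsto[OF finM w] G_L2) (simp_all add: G_iso)
    ultimately show "E w f g = wdist2 M v f g"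
      using LIMSEQ_unique simple_eq[OF F(1) K(1)] by simp
  qed
qed

end

section \<open>Weights under an isometry and its inverse\<close>

locale L2_isometry = L2_embedding M G + inv: L2_embedding M H
  for M :: "'a measure" and G H :: "('a \<Rightarrow> 'x::polish_space) \<Rightarrow> 'a \<Rightarrow> 'x" +
  assumes GH: "\<And>f. f \<in> L2_fun M \<Longrightarrow> AE \<omega> in M. G (H f) \<omega> = f \<omega>"
    and HG: "\<And>f. f \<in> L2_fun M \<Longrightarrow> AE \<omega> in M. H (G f) \<omega> = f \<omega>"
begin

lemma wdist2_GH:
  assumes "w \<in> weights M" "f \<in> L2_fun M" "g \<in> L2_fun M"
  shows "wdist2 M w (G (H f)) (G (H g)) = wdist2 M w f g"
  using assms by (intro wdist2_cong_AE GH G_L2 inv.G_L2)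

lemma wdist2_HG:
  assumes "w \<in> weights M" "f \<in> L2_fun M" "g \<in> L2_fun M"
  shows "wdist2 M w (H (G f)) (H (G g)) = wdist2 M w f g"
  using assms by (intro wdist2_cong_AE HG G_L2 inv.G_L2)

text \<open>Tested with two functions that differ exactly on the set where the inequality
  fails.\<close>

lemma weight_le_AE:
  assumes w: "w \<in> weights M" "v \<in> weights M"
    and le: "\<And>f g :: 'a \<Rightarrow> 'x. f \<in> L2_fun M \<Longrightarrow> g \<in> L2_fun M \<Longrightarrow> wdist2 M w f g \<le> wdist2 M v f g"
  shows "AE \<omega> in M. w \<omega> \<le> v \<omega>"
proof -
  obtain x0 y0 :: 'x where ne: "x0 \<noteq> y0" using two_points by blast
  define d where "d = (dist x0 y0)\<^sup>2"
  have d: "0 < d" using ne by (simp add: d_def)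
  have [measurable]: "w \<in> borel_measurable M" "v \<in> borel_measurable M" using w weightsD(1) by blast+
  define A where "A = {\<omega> \<in> space M. v \<omega> < w \<omega>}"
  have A [measurable]: "A \<in> sets M" unfolding A_def by measurable
  have eq: "wdist2 M u (upd A y0 (\<lambda>_. x0)) (\<lambda>_. x0) = (LINT \<omega>|M. d * (u \<omega> * indicator A \<omega>))" for u
    unfolding wdist2_def by (intro Bochner_Integration.integral_cong) (auto simp: upd_def d_def dist_commute)
  have i: "integrable M (\<lambda>\<omega>. u \<omega> * indicator A \<omega>)" if "u \<in> weights M" for u :: "'a \<Rightarrow> real"
    using A by (intro integrable_weight_mult[OF that]) (simp add: less_top[symmetric])
  have "wdist2 M w (upd A y0 (\<lambda>_. x0)) (\<lambda>_. x0) \<le> wdist2 M v (upd A y0 (\<lambda>_. x0)) (\<lambda>_. x0)"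
    by (intro le upd_L2[OF A] L2_fun_const finM)
  then have "(LINT \<omega>|M. w \<omega> * indicator A \<omega>) \<le> (LINT \<omega>|M. v \<omega> * indicator A \<omega>)"
    unfolding eq using d by simp
  then have "(LINT \<omega>|M. w \<omega> * indicator A \<omega> - v \<omega> * indicator A \<omega>) \<le> 0" using i w by simp
  moreover have nn: "0 \<le> w \<omega> * indicator A \<omega> - v \<omega> * indicator A \<omega>" for \<omega> by (auto simp: A_def indicator_def)
  ultimately have "(LINT \<omega>|M. w \<omega> * indicator A \<omega> - v \<omega> * indicator A \<omega>) = 0"
    by (intro antisym Bochner_Integration.integral_nonneg) auto
  then have "AE \<omega> in M. w \<omega> * indicator A \<omega> - v \<omega> * indicator A \<omega> = 0"
    using i w nn by (subst integral_nonneg_eq_0_iff_AE[symmetric]) auto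
  then show ?thesis
    by (rule AE_mp) (intro AE_I2 impI, auto simp: A_def indicator_def split: if_splits)
qed

lemma wdist2_complement:
  fixes f g :: "'a \<Rightarrow> 'x"
  assumes "w \<in> weights M" "f \<in> L2_fun M" "g \<in> L2_fun M"
  shows "wdist2 M (\<lambda>\<omega>. 1 - w \<omega>) f g = wdist2 M (\<lambda>_. 1) f g - wdist2 M w f g"
  unfolding wdist2_def left_diff_distrib
  using wdist2_integrable[OF finM assms] wdist2_integrable[OF finM const_1_weight assms(2,3)]
  by (rule Bochner_Integration.integral_diff[rotated])

lemma indicator_weight: "A \<in> sets M \<Longrightarrow> indicator A \<in> weights M"
  by (auto simp: weights_def indicator_def)

lemma E_one: "f \<in> L2_fun M \<Longrightarrow> g \<in> L2_fun M \<Longrightarrow> E (\<lambda>_. 1) f g = wdist2 M (\<lambda>_. 1) f g"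
  using G_iso by (simp add: wdist2_def)

text \<open>The first set lies on the image side of \<open>G\<close>, the second on the source side.
  A relation, since each set determines the other only up to null sets.\<close>

definition corresponds :: "'a set \<Rightarrow> 'a set \<Rightarrow> bool" where
  "corresponds B A \<longleftrightarrow> B \<in> sets M \<and> A \<in> sets M \<and>
     (\<forall>f\<in>L2_fun M. \<forall>g\<in>L2_fun M. E (indicator B) f g = wdist2 M (indicator A) f g)"

text \<open>
  Indicators are the weights \<open>h\<close> with \<open>min h (1 - h) = 0\<close>, and order isomorphisms preserve this condition.
\<close>

lemma corresponds_exists:
  assumes B: "B \<in> sets M"
  shows "\<exists>A. corresponds B A"
proof -
  note IB = indicator_weight[OF B]
  obtain h where h: "h \<in> weights M" and Eh: "\<And>f g. f \<in> L2_fun M \<Longrightarrow> g \<in> L2_fun M \<Longrightarrow> E (indicator B) f g = wdist2 M h f g"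
    using E_eq_density[OF IB] by metis
  have h': "(\<lambda>\<omega>. 1 - h \<omega>) \<in> weights M" "(\<lambda>\<omega>. 1 - indicator B \<omega>) \<in> weights M"
    using h IB by (auto simp: weights_def)
  \<comment> \<open>The inverse correspondence sends \<open>h\<close> and \<open>1 - h\<close> back
    to the indicators of \<open>B\<close> and of its complement. The weight \<open>v\<close>
    obtained from \<open>u\<close> lies below both.\<close>
  define u where "u \<omega> = min (h \<omega>) (1 - h \<omega>)" for \<omega>
  have [measurable]: "h \<in> borel_measurable M" using h weightsD(1) by blast
  have "u \<in> borel_measurable M" unfolding u_def by measurable
  then have u: "u \<in> weights M" using h by (auto simp: weights_def u_def min_def)
  obtain v where v: "v \<in> weights M" and Ev: "\<And>f g. f \<in> L2_fun M \<Longrightarrow> g \<in> L2_fun M \<Longrightarrow> inv.E u f g = wdist2 M v f g"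
    using inv.E_eq_density[OF u] by metis
  have "AE \<omega> in M. v \<omega> \<le> indicator B \<omega>"
  proof (rule weight_le_AE[OF v IB])
    fix f g :: "'a \<Rightarrow> 'x" assume L2: "f \<in> L2_fun M" "g \<in> L2_fun M"
    have "wdist2 M v f g = inv.E u f g" using Ev L2 by simp
    also have "\<dots> \<le> wdist2 M h (H f) (H g)" using L2 by (intro wdist2_mono finM u h inv.G_L2) (auto simp: u_def)
    also have "\<dots> = wdist2 M (indicator B) f g" using Eh wdist2_GH[OF IB L2] L2 inv.G_L2 by metis
    finally show "wdist2 M v f g \<le> wdist2 M (indicator B) f g" .
  qed
  moreover have "AE \<omega> in M. v \<omega> \<le> 1 - indicator B \<omega>"
  proof (rule weight_le_AE[OF v h'(2)])
    fix f g :: "'a \<Rightarrow> 'x" assume L2: "f \<in> L2_fun M" "g \<in> L2_fun M"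
    have HL: "H f \<in> L2_fun M" "H g \<in> L2_fun M" using L2 inv.G_L2 by auto
    have "wdist2 M v f g = inv.E u f g" using Ev L2 by simp
    also have "\<dots> \<le> wdist2 M (\<lambda>\<omega>. 1 - h \<omega>) (H f) (H g)" using L2 by (intro wdist2_mono finM u h' inv.G_L2) (auto simp: u_def)
    also have "\<dots> = E (\<lambda>_. 1) (H f) (H g) - E (indicator B) (H f) (H g)"
      using HL by (simp add: wdist2_complement[OF h] E_one Eh)
    also have "\<dots> = wdist2 M (\<lambda>\<omega>. 1 - indicator B \<omega>) f g"
      using L2 by (simp add: wdist2_complement[OF IB] wdist2_GH const_1_weight IB)
    finally show "wdist2 M v f g \<le> wdist2 M (\<lambda>\<omega>. 1 - indicator B \<omega>) f g" .
  qed
  ultimately have v0: "AE \<omega> in M. v \<omega> = 0"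
  proof eventually_elim
    case (elim \<omega>)
    then show ?case using weightsD(2)[OF v, of \<omega>] by (cases "\<omega> \<in> B") auto
  qed
  have zero: "(\<lambda>_. 0) \<in> weights M" by (simp add: weights_def)
  \<comment> \<open>Returning through \<open>G\<close>, the weight \<open>u\<close> inherits the
    vanishing of \<open>v\<close>.\<close>
  have "AE \<omega> in M. u \<omega> \<le> 0"
  proof (rule weight_le_AE[OF u zero])
    fix f g :: "'a \<Rightarrow> 'x" assume L2: "f \<in> L2_fun M" "g \<in> L2_fun M"
    have "wdist2 M u f g = inv.E u (G f) (G g)" using wdist2_HG[OF u L2] by simp
    also have "\<dots> = wdist2 M v (G f) (G g)" using Ev L2 G_L2 by simp
    also have "\<dots> = wdist2 M (\<lambda>_. 0) (G f) (G g)" using L2 G_L2 by (intro wdist2_weight_cong_AE v zero v0) auto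
    finally show "wdist2 M u f g \<le> wdist2 M (\<lambda>_. 0) f g" by (simp add: wdist2_def)
  qed
  then have h01: "AE \<omega> in M. h \<omega> = 0 \<or> h \<omega> = 1"
    by eventually_elim (use weightsD(2,3)[OF h] in \<open>auto simp: u_def min_def intro: antisym split: if_splits\<close>)
  define A where "A = {\<omega> \<in> space M. h \<omega> = 1}"
  have A: "A \<in> sets M" unfolding A_def by measurable
  have "AE \<omega> in M. h \<omega> = indicator A \<omega>"
    using h01 AE_space by eventually_elim (auto simp: A_def)
  then have "E (indicator B) f g = wdist2 M (indicator A) f g" if "f \<in> L2_fun M" "g \<in> L2_fun M" for f g
    using Eh that wdist2_weight_cong_AE[OF h indicator_weight[OF A] that] by simp
  then show ?thesis unfolding corresponds_def using A B by blast
qed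

end

section \<open>Standard probability spaces\<close>

text \<open>
  \<open>e\<close> is an injective real coordinate on the co-null set \<open>\<Omega>\<close> with Borel image \<open>R\<close> and inverse \<open>j\<close>.
  If \<open>M\<close> is complete on \<open>\<Omega>\<close>, then \<open>j\<close> is measurable only up to null sets, hence
  the last assumption, in which maps are required to pull null sets back to null sets.
\<close>

locale standard_coordinates = prob_space M for M :: "'a measure" +
  fixes e :: "'a \<Rightarrow> real" and j :: "real \<Rightarrow> 'a" and \<Omega> :: "'a set" and R :: "real set"
  assumes \<Omega>_null: "space M - \<Omega> \<in> null_sets M" and \<Omega>_sets: "\<Omega> \<in> sets M"
    and e_measurable [measurable]: "e \<in> borel_measurable M"
    and e_range: "\<And>\<omega>. 0 \<le> e \<omega> \<and> e \<omega> \<le> 2"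
    and R_sets [measurable]: "R \<in> sets borel"
    and e_R: "\<And>\<omega>. \<omega> \<in> \<Omega> \<Longrightarrow> e \<omega> \<in> R"
    and j_\<Omega>: "\<And>r. j r \<in> \<Omega>"
    and j_e: "\<And>\<omega>. \<omega> \<in> \<Omega> \<Longrightarrow> j (e \<omega>) = \<omega>"
    and e_j: "\<And>r. r \<in> R \<Longrightarrow> e (j r) = r"
    and sets_e: "\<And>A. A \<in> sets M \<Longrightarrow>
      \<exists>C\<in>sets borel. \<exists>Z\<in>sets borel. (AE \<omega> in M. e \<omega> \<notin> Z) \<and> (\<forall>\<omega>\<in>\<Omega>. e \<omega> \<notin> Z \<longrightarrow> (\<omega> \<in> A \<longleftrightarrow> e \<omega> \<in> C))"
    and lift_measurable: "\<And>T. T \<in> borel_measurable M \<Longrightarrow>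
      (\<And>C. C \<in> sets borel \<Longrightarrow> AE \<omega> in M. e \<omega> \<notin> C \<Longrightarrow> AE \<omega> in M. T \<omega> \<notin> C) \<Longrightarrow>
      (\<lambda>\<omega>. if \<omega> \<in> \<Omega> then j (T \<omega>) else j 0) \<in> measurable M M"

section \<open>Real coordinates on a standard probability space\<close>

lemma std_model_space: "space (std_model c p) = {0..1} <+> UNIV"
  unfolding std_model_def by (rule space_measure_of) auto

lemma std_model_sets:
  "sets (std_model c p) = {A. A \<subseteq> {0..1} <+> UNIV \<and> Inl -` A \<in> sets borel}"
proof -
  let ?\<Omega> = "{0..1::real} <+> (UNIV::nat set)"
  let ?S = "{A. A \<subseteq> ?\<Omega> \<and> Inl -` A \<in> sets borel}"
  have "sigma_algebra ?\<Omega> ?S"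
  proof (rule sigma_algebra_iff2[THEN iffD2], intro conjI ballI allI impI)
    show "?S \<subseteq> Pow ?\<Omega>" by auto
    show "{} \<in> ?S" by auto
    fix A assume A: "A \<in> ?S"
    have "Inl -` (?\<Omega> - A) = {0..1} - Inl -` A" by auto
    then show "?\<Omega> - A \<in> ?S" using A by auto
  next
    fix A :: "nat \<Rightarrow> (real + nat) set" assume A: "range A \<subseteq> ?S"
    have "Inl -` (\<Union>i. A i) = (\<Union>i. Inl -` A i)" by auto
    moreover have "Inl -` A i \<in> sets borel" "A i \<subseteq> ?\<Omega>" for i using A by auto
    then have "(\<Union>i. Inl -` A i) \<in> sets borel" "(\<Union>i. A i) \<subseteq> ?\<Omega>" by blast+
    ultimately show "(\<Union>i. A i) \<in> ?S" by simp
  qed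
  then have "sigma_sets ?\<Omega> ?S = ?S" by (rule sigma_algebra.sigma_sets_eq)
  then show ?thesis unfolding std_model_def by (subst sets_measure_of) auto
qed

text \<open>The atoms go to points of the interval from 1 to 2, excluding 1, hence apart from
  \<open>{0..1}\<close>; the whole image is bounded and Borel.\<close>

definition sum_to_real :: "real + nat \<Rightarrow> real" where
  "sum_to_real x = (case x of Inl r \<Rightarrow> r | Inr n \<Rightarrow> 1 + 1 / (real n + 1))"

text \<open>At the image of the atom \<open>n\<close> the quotient \<open>1 / (r - 1)\<close> equals
  \<open>n + 1\<close>; the floor only extends the decoding to all reals.\<close>

definition sum_of_real :: "real \<Rightarrow> real + nat" where
  "sum_of_real r = (if r \<in> {0..1} then Inl r else Inr (nat \<lfloor>1 / (r - 1)\<rfloor> - 1))"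

definition sum_range :: "real set" where
  "sum_range = {0..1} \<union> (\<Union>n::nat. {1 + 1 / (real n + 1)})"

lemma sum_range_borel: "sum_range \<in> sets borel"
  unfolding sum_range_def by (intro sets.Un sets.countable_UN) auto

lemma sum_of_to_real: "x \<in> {0..1} <+> UNIV \<Longrightarrow> sum_of_real (sum_to_real x) = x"
proof (cases x)
  case (Inr n)
  have "1 / (1 + 1 / (real n + 1) - 1) = real (Suc n)" by simp
  then have "nat \<lfloor>1 / (1 + 1 / (real n + 1) - 1)\<rfloor> - 1 = n" by (simp only: floor_of_nat nat_int diff_Suc_1)
  then show ?thesis using Inr by (simp add: sum_of_real_def sum_to_real_def)
qed (auto simp: sum_of_real_def sum_to_real_def)

lemma sum_to_real_range: "x \<in> {0..1} <+> UNIV \<Longrightarrow> sum_to_real x \<in> sum_range"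
  by (cases x) (auto simp: sum_to_real_def sum_range_def)

lemma sum_of_real_range: "r \<in> sum_range \<Longrightarrow> sum_of_real r \<in> {0..1} <+> UNIV"
  by (auto simp: sum_of_real_def)

lemma sum_to_of_real: "r \<in> sum_range \<Longrightarrow> sum_to_real (sum_of_real r) = r"
proof -
  assume r: "r \<in> sum_range"
  then obtain x where x: "r = sum_to_real x" "x \<in> {0..1} <+> UNIV"
  proof -
    consider "r \<in> {0..1}" | n where "r = 1 + 1 / (real n + 1)" using r unfolding sum_range_def by blast
    then show ?thesis
    proof cases
      case 1 then show ?thesis by (intro that[of "Inl r"]) (auto simp: sum_to_real_def)
    next
      case 2 then show ?thesis by (intro that[of "Inr n"]) (auto simp: sum_to_real_def)
    qed
  qed
  then show ?thesis using sum_of_to_real by simp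
qed

lemma sum_to_real_bounds: "x \<in> {0..1} <+> UNIV \<Longrightarrow> 0 \<le> sum_to_real x \<and> sum_to_real x \<le> 2"
  by (cases x) (auto simp: sum_to_real_def)

lemma sum_to_real_measurable: "sum_to_real \<in> borel_measurable (std_model c p)"
proof (rule measurableI)
  fix C :: "real set" assume C: "C \<in> sets borel"
  have "Inl -` (sum_to_real -` C \<inter> ({0..1} <+> UNIV)) = C \<inter> {0..1}" by (auto simp: sum_to_real_def)
  then show "sum_to_real -` C \<inter> space (std_model c p) \<in> sets (std_model c p)"
    using C by (auto simp: std_model_sets std_model_space)
qed auto

lemma sum_of_real_borel:
  assumes "A \<in> sets (std_model c p)"
  shows "{r. sum_of_real r \<in> A} \<in> sets borel"
proof -
  have [measurable]: "Inl -` A \<in> sets borel" using assms by (auto simp: std_model_sets)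
  have [measurable]: "(\<lambda>r::real. nat \<lfloor>1 / (r - 1)\<rfloor> - 1) \<in> measurable borel (count_space UNIV)" by measurable
  have [measurable]: "Inr -` A \<in> sets (count_space (UNIV::nat set))" by simp
  have "{r. sum_of_real r \<in> A} = {r \<in> space borel. (r \<in> {0..1} \<and> r \<in> Inl -` A) \<or> (r \<notin> {0..1} \<and> nat \<lfloor>1 / (r - 1)\<rfloor> - 1 \<in> Inr -` A)}"
    by (auto simp: sum_of_real_def)
  also have "\<dots> \<in> sets borel" by measurable
  finally show ?thesis .
qed

text \<open>The coordinate is the given isomorphism followed by \<open>sum_to_real\<close>.
  \<open>N\<close> is the model with either of its two sigma-algebras, \<open>S\<close> always the
  Borel one.\<close>

lemma standard_coordinates_exist:
  assumes "standard_prob_space M"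
  obtains e j \<Omega> R where "standard_coordinates M e j \<Omega> R"
proof -
  interpret prob_space M using assms unfolding standard_prob_space_def by blast
  obtain c p where "isomorphic_mod_null M (std_model c p) \<or> isomorphic_mod_null M (completion (std_model c p))"
    using assms unfolding standard_prob_space_def by blast
  then obtain N where N: "N = std_model c p \<or> N = completion (std_model c p)" and iso: "isomorphic_mod_null M N" by blast
  define S where "S = std_model c p"
  have NS: "N = S \<or> N = completion S" using N S_def by simp
  have spN: "space N = space S" and spS: "space S = {0..1} <+> UNIV" using NS by (auto simp: S_def std_model_space)
  have SN: "A \<in> sets N" if "A \<in> sets S" for A using NS that by auto
  obtain A B \<psi> where A: "A \<in> null_sets M" and B: "B \<in> null_sets N"
    and bij: "bij_betw \<psi> (space M - A) (space N - B)"
    and \<psi>m: "\<psi> \<in> measurable (restrict_space M (space M - A)) (restrict_space N (space N - B))"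
    and \<psi>im: "the_inv_into (space M - A) \<psi> \<in> measurable (restrict_space N (space N - B)) (restrict_space M (space M - A))"
    and dist: "distr (restrict_space M (space M - A)) (restrict_space N (space N - B)) \<psi> = restrict_space N (space N - B)"
    using iso unfolding isomorphic_mod_null_def by blast
  define \<xi> where "\<xi> = the_inv_into (space M - A) \<psi>"
  have As: "A \<in> sets M" and Bs: "B \<in> sets N" using A B by auto
  have spA: "space M - A \<in> sets M" and spB: "space N - B \<in> sets N" using As Bs by auto
  have inj: "inj_on \<psi> (space M - A)" and img: "\<psi> ` (space M - A) = space N - B" using bij by (auto simp: bij_betw_def)
  have \<xi>\<psi>: "\<xi> (\<psi> \<omega>) = \<omega>" if "\<omega> \<in> space M - A" for \<omega> unfolding \<xi>_def using the_inv_into_f_f[OF inj that] .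
  have \<psi>\<xi>: "\<psi> (\<xi> y) = y" and \<xi>in: "\<xi> y \<in> space M - A" if "y \<in> space N - B" for y
    unfolding \<xi>_def using f_the_inv_into_f_bij_betw[OF bij] the_inv_into_into[OF inj, of y] img that by auto
  have \<psi>in: "\<psi> \<omega> \<in> space N - B" if "\<omega> \<in> space M - A" for \<omega> using img that by blast
  have pre\<psi>: "{\<omega> \<in> space M - A. \<psi> \<omega> \<in> D} \<in> sets M" if D: "D \<in> sets N" for D
  proof -
    have "D \<inter> (space N - B) \<in> sets (restrict_space N (space N - B))" using D spB by (auto simp: sets_restrict_space)
    then have "\<psi> -` (D \<inter> (space N - B)) \<inter> space (restrict_space M (space M - A)) \<in> sets (restrict_space M (space M - A))"
      by (rule measurable_sets[OF \<psi>m])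
    then have "\<psi> -` (D \<inter> (space N - B)) \<inter> space (restrict_space M (space M - A)) \<in> sets M"
      using spA by (simp add: sets_restrict_space_iff)
    moreover have "\<psi> -` (D \<inter> (space N - B)) \<inter> space (restrict_space M (space M - A)) = {\<omega> \<in> space M - A. \<psi> \<omega> \<in> D}"
      using \<psi>in by (auto simp: space_restrict_space)
    ultimately show ?thesis by simp
  qed
  have pre\<xi>: "{y \<in> space N - B. \<xi> y \<in> D} \<in> sets N" if D: "D \<in> sets M" for D
  proof -
    have "D \<inter> (space M - A) \<in> sets (restrict_space M (space M - A))" using D spA by (auto simp: sets_restrict_space)
    then have "\<xi> -` (D \<inter> (space M - A)) \<inter> space (restrict_space N (space N - B)) \<in> sets (restrict_space N (space N - B))"
      unfolding \<xi>_def by (rule measurable_sets[OF \<psi>im])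
    then have "\<xi> -` (D \<inter> (space M - A)) \<inter> space (restrict_space N (space N - B)) \<in> sets N"
      using spB by (simp add: sets_restrict_space_iff)
    moreover have "\<xi> -` (D \<inter> (space M - A)) \<inter> space (restrict_space N (space N - B)) = {y \<in> space N - B. \<xi> y \<in> D}"
      using \<xi>in by (auto simp: space_restrict_space)
    ultimately show ?thesis by simp
  qed
  have em: "emeasure M {\<omega> \<in> space M - A. \<psi> \<omega> \<in> D} = emeasure N (D - B)" if D: "D \<in> sets N" for D
  proof -
    have D': "D - B \<in> sets (restrict_space N (space N - B))"
      using D spB Bs sets.sets_into_space[OF D] by (auto simp: sets_restrict_space_iff)
    have DB: "D - B \<subseteq> space N - B" using sets.sets_into_space[OF D] by auto
    have "emeasure N (D - B) = emeasure (restrict_space N (space N - B)) (D - B)"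
      using DB spB by (simp add: emeasure_restrict_space)
    also have "\<dots> = emeasure (restrict_space M (space M - A)) (\<psi> -` (D - B) \<inter> space (restrict_space M (space M - A)))"
      by (subst dist[symmetric]) (rule emeasure_distr[OF \<psi>m D'])
    also have "\<psi> -` (D - B) \<inter> space (restrict_space M (space M - A)) = {\<omega> \<in> space M - A. \<psi> \<omega> \<in> D}"
      using \<psi>in by (auto simp: space_restrict_space)
    also have "emeasure (restrict_space M (space M - A)) {\<omega> \<in> space M - A. \<psi> \<omega> \<in> D} = emeasure M {\<omega> \<in> space M - A. \<psi> \<omega> \<in> D}"
      using spA by (intro emeasure_restrict_space) auto
    finally show ?thesis by simp
  qed
  have null_pre: "{\<omega> \<in> space M - A. \<psi> \<omega> \<in> Z} \<in> null_sets M" if Z: "Z \<in> null_sets S" for Z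
  proof -
    have ZN: "Z \<in> null_sets N" using NS Z by (auto simp: null_sets_completionI)
    then have "emeasure N (Z - B) = 0" using B by (metis null_setsD1 null_set_Diff null_setsD2)
    then show ?thesis using pre\<psi>[of Z] em[of Z] ZN by (intro null_setsI) auto
  qed
  \<comment> \<open>A null set of the completion need not be Borel; it is enlarged to one that is,
    and the preimage is removed as well.\<close>
  obtain B' where B': "B' \<in> null_sets S" "B \<subseteq> B'"
    using NS B by (auto simp: null_sets_completion_iff2) 
  define \<Omega> where "\<Omega> = {\<omega> \<in> space M - A. \<psi> \<omega> \<notin> B'}"
  have B's: "B' \<in> sets S" "B' \<in> sets N" using B' SN by auto
  have \<Omega>s: "\<Omega> \<in> sets M"
  proof -
    have "\<Omega> = {\<omega> \<in> space M - A. \<psi> \<omega> \<in> space N - B'}" using \<psi>in by (auto simp: \<Omega>_def)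
    then show ?thesis using pre\<psi>[of "space N - B'"] B's by auto
  qed
  have \<Omega>n: "space M - \<Omega> \<in> null_sets M"
  proof -
    have "A \<union> {\<omega> \<in> space M - A. \<psi> \<omega> \<in> B'} \<in> null_sets M" using A null_pre[OF B'(1)] by (rule null_sets.Un)
    moreover have "space M - \<Omega> = A \<union> {\<omega> \<in> space M - A. \<psi> \<omega> \<in> B'}"
      using sets.sets_into_space[OF As] by (auto simp: \<Omega>_def)
    ultimately show ?thesis by simp
  qed
  have "\<Omega> \<noteq> {}" using \<Omega>n prob_space by (auto simp: null_sets_def emeasure_eq_measure)
  then obtain \<omega>0 where \<omega>0: "\<omega>0 \<in> \<Omega>" by blast
  define R where "R = {r \<in> sum_range. sum_of_real r \<notin> B'}"
  have Rs: "R \<in> sets borel"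
    unfolding R_def using sum_range_borel sum_of_real_borel[of B' c p] B's
    by (auto simp: S_def Collect_conj_eq Collect_neg_eq intro!: sets.Int)
  \<comment> \<open>Off \<open>\<Omega>\<close> the coordinate is 0, and off \<open>R\<close> its
    inverse takes a fixed value in \<open>\<Omega>\<close>; so both maps are total and
    \<open>j\<close> never leaves \<open>\<Omega>\<close>.\<close>
  define e where "e \<omega> = (if \<omega> \<in> \<Omega> then sum_to_real (\<psi> \<omega>) else 0)" for \<omega>
  define j where "j r = (if r \<in> R then \<xi> (sum_of_real r) else \<omega>0)" for r
  have \<psi>S: "\<psi> \<omega> \<in> {0..1} <+> UNIV" "\<psi> \<omega> \<in> space S" "\<psi> \<omega> \<notin> B'" "\<omega> \<in> space M - A" if "\<omega> \<in> \<Omega>" for \<omega>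
    using that \<psi>in spN spS by (auto simp: \<Omega>_def)
  have Rin: "sum_of_real r \<in> space N - B" "sum_of_real r \<notin> B'" if "r \<in> R" for r
    using that sum_of_real_range[of r] spN spS B' by (auto simp: R_def)
  have eR: "e \<omega> \<in> R" "j (e \<omega>) = \<omega>" "sum_of_real (e \<omega>) = \<psi> \<omega>" if "\<omega> \<in> \<Omega>" for \<omega>
    using that \<psi>S[OF that] sum_of_to_real[of "\<psi> \<omega>"] sum_to_real_range[of "\<psi> \<omega>"] \<xi>\<psi>[of \<omega>] by (auto simp: e_def j_def R_def)
  have j\<Omega>: "j r \<in> \<Omega>" for r
  proof (cases "r \<in> R")
    case True
    then show ?thesis using \<xi>in[of "sum_of_real r"] \<psi>\<xi>[of "sum_of_real r"] Rin[of r] by (auto simp: j_def \<Omega>_def)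
  qed (simp add: j_def \<omega>0)
  have ej: "e (j r) = r" if "r \<in> R" for r
  proof -
    have "e (j r) = sum_to_real (\<psi> (\<xi> (sum_of_real r)))" using that j\<Omega>[of r] by (simp add: e_def j_def)
    also have "\<dots> = r" using that Rin[OF that] \<psi>\<xi> sum_to_of_real[of r] by (simp add: R_def)
    finally show ?thesis .
  qed
  have em2: "e \<in> borel_measurable M"
  proof (rule measurableI)
    fix C :: "real set" assume C: "C \<in> sets borel"
    have "sum_to_real -` C \<inter> space S \<in> sets S"
      unfolding S_def by (rule measurable_sets[OF sum_to_real_measurable C])
    then have "sum_to_real -` C \<inter> space S \<in> sets N" by (rule SN)
    then have 1: "{\<omega> \<in> space M - A. \<psi> \<omega> \<in> sum_to_real -` C \<inter> space S} \<inter> \<Omega> \<in> sets M"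
      by (intro sets.Int[OF pre\<psi> \<Omega>s])
    have "e \<omega> \<in> C \<longleftrightarrow> \<omega> \<in> {\<omega> \<in> space M - A. \<psi> \<omega> \<in> sum_to_real -` C \<inter> space S}" if "\<omega> \<in> \<Omega>" for \<omega>
      using \<psi>S(2,4)[OF that] that by (simp add: e_def)
    then have "e -` C \<inter> space M = ({\<omega> \<in> space M - A. \<psi> \<omega> \<in> sum_to_real -` C \<inter> space S} \<inter> \<Omega>) \<union> (if 0 \<in> C then space M - \<Omega> else {})"
      using sets.sets_into_space[OF \<Omega>s] by (intro set_eqI, rename_tac \<omega>, case_tac "\<omega> \<in> \<Omega>") (auto simp: e_def)
    moreover have "(if 0 \<in> C then space M - \<Omega> else {}) \<in> sets M" using \<Omega>s by simp
    ultimately show "e -` C \<inter> space M \<in> sets M" using sets.Un[OF 1] by simp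
  qed simp
  \<comment> \<open>A Lebesgue set is Borel up to a Borel null set \<open>Z\<close>. In the Borel
    case \<open>Z = {}\<close>, so that no arbitrary subset of a null set ever arises.\<close>
  have almost: "\<exists>D'\<in>sets S. \<exists>Z\<in>null_sets S. (N = S \<longrightarrow> Z = {}) \<and> (\<forall>d. d \<notin> Z \<longrightarrow> (d \<in> D \<longleftrightarrow> d \<in> D'))" if D: "D \<in> sets N" for D
  proof (cases "N = S")
    case True
    then show ?thesis using D by (intro bexI[of _ D] bexI[of _ "{}"]) auto
  next
    case False
    then have "D \<in> sets (completion S)" using NS D by simp
    then obtain D' P Z where "D = D' \<union> P" "P \<subseteq> Z" "Z \<in> null_sets S" "D' \<in> sets S"
      by (rule sets_completionE)
    then show ?thesis using False by (intro bexI[of _ D'] bexI[of _ Z]) auto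
  qed
  \<comment> \<open>For the completed model \<open>M\<close> is complete on \<open>\<Omega>\<close>:
    \<open>\<psi>\<close> carries a subset of a null set to a subset of a null set of
    \<open>N\<close>. This is measurable, and its preimage is the original set.\<close>
  have nullsub: "P \<in> sets M" if "N \<noteq> S" "Q \<in> null_sets M" "P \<subseteq> Q" "P \<subseteq> \<Omega>" for P Q
  proof -
    have C: "N = completion S" using NS that by blast
    have Qs: "Q \<in> sets M" using that by auto
    define D where "D = {y \<in> space N - B. \<xi> y \<in> Q}"
    have D: "D \<in> sets N" unfolding D_def by (rule pre\<xi>[OF Qs])
    have "{\<omega> \<in> space M - A. \<psi> \<omega> \<in> D} \<subseteq> Q" using \<xi>\<psi> by (auto simp: D_def)
    then have "emeasure M {\<omega> \<in> space M - A. \<psi> \<omega> \<in> D} = 0"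
      using that(2) Qs by (metis emeasure_mono le_zero_eq null_setsD1)
    moreover have "D - B = D" by (auto simp: D_def)
    ultimately have "D \<in> null_sets N" using em[OF D] D by (intro null_setsI) auto
    then have "\<psi> ` P \<in> sets N"
    proof -
      have "\<psi> ` P \<subseteq> D"
      proof
        fix y assume "y \<in> \<psi> ` P"
        then obtain \<omega> where w: "\<omega> \<in> P" "y = \<psi> \<omega>" by blast
        then have "\<omega> \<in> space M - A" "\<omega> \<in> Q" using that \<psi>S by auto
        then show "y \<in> D" using w \<xi>\<psi> \<psi>in by (auto simp: D_def)
      qed
      then show ?thesis using \<open>D \<in> null_sets N\<close> C null_sets_completion_subset by blast
    qed
    then have "{\<omega> \<in> space M - A. \<psi> \<omega> \<in> \<psi> ` P} \<in> sets M" by (rule pre\<psi>)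
    moreover have "{\<omega> \<in> space M - A. \<psi> \<omega> \<in> \<psi> ` P} = P"
      using that(4) \<psi>S(4) inj by (auto simp: inj_on_def)
    ultimately show ?thesis by simp
  qed
  have AE\<Omega>: "AE \<omega> in M. \<omega> \<in> \<Omega>" using AE_not_in[OF \<Omega>n] AE_space by eventually_elim auto
  have "standard_coordinates M e j \<Omega> R"
  proof
    show "0 \<le> e \<omega> \<and> e \<omega> \<le> 2" for \<omega> using \<psi>S sum_to_real_bounds by (simp add: e_def)
    show "\<exists>C\<in>sets borel. \<exists>Z\<in>sets borel. (AE \<omega> in M. e \<omega> \<notin> Z) \<and> (\<forall>\<omega>\<in>\<Omega>. e \<omega> \<notin> Z \<longrightarrow> (\<omega> \<in> D \<longleftrightarrow> e \<omega> \<in> C))"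
      if D: "D \<in> sets M" for D
    proof -
      obtain D' Z where D': "D' \<in> sets S" and Z: "Z \<in> null_sets S"
        "\<forall>d. d \<notin> Z \<longrightarrow> (d \<in> {y \<in> space N - B. \<xi> y \<in> D} \<longleftrightarrow> d \<in> D')"
        using almost[OF pre\<xi>[OF D]] by blast
      have "AE \<omega> in M. e \<omega> \<notin> {r. sum_of_real r \<in> Z}"
        using AE_not_in[OF null_pre[OF Z(1)]] AE\<Omega>
      proof eventually_elim
        case (elim \<omega>)
        then have "\<psi> \<omega> \<notin> Z" using \<psi>S(4)[OF elim(2)] by blast
        then show ?case using eR(3)[OF elim(2)] by simp
      qed
      moreover have "\<omega> \<in> D \<longleftrightarrow> e \<omega> \<in> {r. sum_of_real r \<in> D'}" if "\<omega> \<in> \<Omega>" "e \<omega> \<notin> {r. sum_of_real r \<in> Z}" for \<omega>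
      proof -
        have "\<psi> \<omega> \<notin> Z" using that eR(3)[OF that(1)] by simp
        then show ?thesis using Z(2)[rule_format, of "\<psi> \<omega>"] \<xi>\<psi>[OF \<psi>S(4)[OF that(1)]] \<psi>in[OF \<psi>S(4)[OF that(1)]] eR(3)[OF that(1)]
          by simp
      qed
      moreover have "{r. sum_of_real r \<in> D'} \<in> sets borel" "{r. sum_of_real r \<in> Z} \<in> sets borel"
        using sum_of_real_borel[of D' c p] sum_of_real_borel[of Z c p] D' Z unfolding S_def by auto
      ultimately show ?thesis by blast
    qed
    show "(\<lambda>\<omega>. if \<omega> \<in> \<Omega> then j (T \<omega>) else j 0) \<in> measurable M M"
      if T: "T \<in> borel_measurable M" and ns: "\<And>C. C \<in> sets borel \<Longrightarrow> AE \<omega> in M. e \<omega> \<notin> C \<Longrightarrow> AE \<omega> in M. T \<omega> \<notin> C" for T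
    proof (rule measurableI)
      fix D assume D: "D \<in> sets M"
      obtain D' Z where D': "D' \<in> sets S" and Z: "Z \<in> null_sets S" "N = S \<longrightarrow> Z = {}"
        "\<forall>d. d \<notin> Z \<longrightarrow> (d \<in> {y \<in> space N - B. \<xi> y \<in> D} \<longleftrightarrow> d \<in> D')"
        using almost[OF pre\<xi>[OF D]] by (elim bexE conjE) (rule that)
      define C where "C = {r. sum_of_real r \<in> D'} \<inter> R \<union> (if \<omega>0 \<in> D then - R else {})"
      define CZ where "CZ = {r. sum_of_real r \<in> Z} \<inter> R"
      have C: "C \<in> sets borel" "CZ \<in> sets borel"
        using sum_of_real_borel[of D' c p] sum_of_real_borel[of Z c p] D' Z Rs by (auto simp: S_def C_def CZ_def)
      have jC: "j r \<in> D \<longleftrightarrow> r \<in> C" if "r \<notin> CZ" for r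
      proof (cases "r \<in> R")
        case True
        then have "sum_of_real r \<notin> Z" using that by (auto simp: CZ_def)
        then show ?thesis using Z(3)[rule_format, of "sum_of_real r"] Rin[OF True] True by (auto simp: j_def C_def)
      qed (simp add: j_def C_def)
      have "AE \<omega> in M. e \<omega> \<notin> CZ"
        using AE_not_in[OF null_pre[OF Z(1)]] AE\<Omega>
      proof eventually_elim
        case (elim \<omega>)
        then show ?case using \<psi>S eR(3)[OF elim(2)] by (auto simp: CZ_def)
      qed
      then have "AE \<omega> in M. T \<omega> \<notin> CZ" using ns C by blast
      then have TZ: "T -` CZ \<inter> space M \<in> null_sets M"
        using C(2) T by (subst (asm) AE_iff_null) (auto simp: vimage_def Int_def conj_commute intro: measurable_sets)
      \<comment> \<open>The part of the preimage that Borel sets do not control: empty in the Borel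
        case, a subset of a null set otherwise.\<close>
      define P where "P = {\<omega> \<in> \<Omega>. j (T \<omega>) \<in> D \<and> T \<omega> \<in> CZ}"
      have "P \<in> sets M"
      proof (cases "N = S")
        case True
        then have "P = {}" using Z(2) by (auto simp: P_def CZ_def)
        then show ?thesis by simp
      next
        case False
        then show ?thesis using sets.sets_into_space[OF \<Omega>s] by (intro nullsub[OF False TZ]) (auto simp: P_def)
      qed
      moreover have "(\<lambda>\<omega>. if \<omega> \<in> \<Omega> then j (T \<omega>) else j 0) -` D \<inter> space M
        = ((T -` C \<inter> space M) - (T -` CZ \<inter> space M)) \<inter> \<Omega> \<union> P \<union> (if j 0 \<in> D then space M - \<Omega> else {})"
        using jC sets.sets_into_space[OF \<Omega>s] by (auto simp: P_def split: if_splits)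
      ultimately show "(\<lambda>\<omega>. if \<omega> \<in> \<Omega> then j (T \<omega>) else j 0) -` D \<inter> space M \<in> sets M"
        using measurable_sets[OF T C(1)] TZ \<Omega>s by auto
    qed (use j\<Omega> \<Omega>s sets.sets_into_space in auto)
  qed (use \<Omega>n \<Omega>s em2 Rs eR j\<Omega> ej in auto)
  then show ?thesis by (rule that)
qed

section \<open>Recovering functions from level sets\<close>

text \<open>A Dedekind cut: if \<open>U q\<close> is the set where a real function is below
  \<open>q\<close>, that function is recovered. The extended reals keep the infimum defined where no
  \<open>U q\<close> contains the point.\<close>

definition cut :: "(rat \<Rightarrow> 'b set) \<Rightarrow> 'b \<Rightarrow> real" where
  "cut U x = real_of_ereal (INF q. if x \<in> U q then ereal (of_rat q) else \<infinity>)"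

lemma cut_measurable:
  assumes [measurable]: "\<And>q. U q \<in> sets N"
  shows "cut U \<in> borel_measurable N"
  unfolding cut_def by measurable

lemma cut_eq:
  assumes U: "\<And>q. x \<in> U q \<longleftrightarrow> v < of_rat q"
  shows "cut U x = v"
proof -
  have "(INF q. if x \<in> U q then ereal (of_rat q) else \<infinity>) = ereal v"
  proof (rule antisym)
    show "ereal v \<le> (INF q. if x \<in> U q then ereal (of_rat q) else \<infinity>)"
      using U by (intro INF_greatest) (auto simp: less_imp_le)
    show "(INF q. if x \<in> U q then ereal (of_rat q) else \<infinity>) \<le> ereal v"
    proof (rule ereal_le_epsilon2)
      fix d :: real assume "0 < d"
      then obtain q where q: "v < of_rat q" "of_rat q < v + d" using of_rat_dense[of v "v + d"] by auto
      have "(INF q. if x \<in> U q then ereal (of_rat q) else \<infinity>) \<le> (if x \<in> U q then ereal (of_rat q) else \<infinity>)"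
        by (rule INF_lower) simp
      also have "\<dots> \<le> ereal v + ereal d" using q U by simp
      finally show "(INF q. if x \<in> U q then ereal (of_rat q) else \<infinity>) \<le> ereal v + ereal d" .
    qed
  qed
  then show ?thesis by (simp add: cut_def)
qed

lemma cut_less_iff:
  assumes "x \<in> U q0" and lo: "\<And>q. x \<in> U q \<Longrightarrow> (lo::real) \<le> of_rat q"
  shows "cut U x < r \<longleftrightarrow> (\<exists>q. x \<in> U q \<and> of_rat q < r)"
proof -
  define I where "I = (INF q. if x \<in> U q then ereal (of_rat q) else \<infinity>)"
  have "I \<le> (if x \<in> U q0 then ereal (of_rat q0) else \<infinity>)" unfolding I_def by (rule INF_lower) simp
  then have "I \<le> ereal (of_rat q0)" using assms by simp
  moreover have "ereal lo \<le> I" unfolding I_def using lo by (intro INF_greatest) auto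
  ultimately have "I = ereal (cut U x)" unfolding cut_def I_def[symmetric] by (cases I) auto
  then have "cut U x < r \<longleftrightarrow> I < ereal r" by simp
  also have "\<dots> \<longleftrightarrow> (\<exists>q. x \<in> U q \<and> of_rat q < r)"
    unfolding I_def INF_less_iff by (auto split: if_splits)
  finally show ?thesis .
qed

text \<open>Doob's factorization up to null sets. Only the countably many sets where
  \<open>f\<close> is below a rational are pulled back, so one null set serves for all of
  them.\<close>

lemma factor_through:
  fixes f :: "'a \<Rightarrow> real"
  assumes p: "p \<in> measurable M N" and f [measurable]: "f \<in> borel_measurable M"
    and sets: "\<And>A. A \<in> sets M \<Longrightarrow> \<exists>C\<in>sets N. AE \<omega> in M. \<omega> \<in> A \<longleftrightarrow> p \<omega> \<in> C"
  shows "\<exists>t\<in>borel_measurable N. AE \<omega> in M. f \<omega> = t (p \<omega>)"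
proof -
  have "\<exists>C\<in>sets N. AE \<omega> in M. \<omega> \<in> {\<omega> \<in> space M. f \<omega> < of_rat q} \<longleftrightarrow> p \<omega> \<in> C" for q by (rule sets) measurable
  then obtain U where U: "\<And>q. U q \<in> sets N" "\<And>q. AE \<omega> in M. \<omega> \<in> {\<omega> \<in> space M. f \<omega> < of_rat q} \<longleftrightarrow> p \<omega> \<in> U q"
    by metis
  have "AE \<omega> in M. f \<omega> = cut U (p \<omega>)"
    using AE_space U(2)[THEN AE_all_countable[THEN iffD2, OF allI]]
    by eventually_elim (rule cut_eq[symmetric], auto)
  then show ?thesis using cut_measurable[of U N] U(1) by blast
qed

section \<open>The correspondence of sets\<close>

context L2_isometry
begin

lemma swap: "L2_isometry M H G"
  by unfold_locales (use HG GH in auto)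

lemma corresponds_inverse: "corresponds B A \<Longrightarrow> L2_isometry.corresponds M H A B"
proof -
  assume c: "corresponds B A"
  then have s: "B \<in> sets M" "A \<in> sets M" by (auto simp: corresponds_def)
  interpret sw: L2_isometry M H G by (rule swap)
  have "inv.E (indicator A) f g = wdist2 M (indicator B) f g" if "f \<in> L2_fun M" "g \<in> L2_fun M" for f g
  proof -
    have "inv.E (indicator A) f g = E (indicator B) (H f) (H g)"
      using c inv.G_L2 that by (auto simp: corresponds_def)
    also have "\<dots> = wdist2 M (indicator B) f g" by (rule wdist2_GH[OF indicator_weight[OF s(1)] that])
    finally show ?thesis .
  qed
  then show ?thesis using s by (simp add: sw.corresponds_def)
qed

lemma corresponds_mono_left:
  assumes c: "corresponds B A" "corresponds B' A'" and AE: "AE \<omega> in M. \<omega> \<in> A \<longrightarrow> \<omega> \<in> A'"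
  shows "AE \<omega> in M. \<omega> \<in> B \<longrightarrow> \<omega> \<in> B'"
proof -
  have s: "B \<in> sets M" "A \<in> sets M" "B' \<in> sets M" "A' \<in> sets M" using c by (auto simp: corresponds_def)
  have "AE \<omega> in M. (indicator B \<omega> :: real) \<le> indicator B' \<omega>"
  proof (rule weight_le_AE)
    fix f g :: "'a \<Rightarrow> 'x" assume L2: "f \<in> L2_fun M" "g \<in> L2_fun M"
    then have HL: "H f \<in> L2_fun M" "H g \<in> L2_fun M" using inv.G_L2 by auto
    have "wdist2 M (indicator B) f g = wdist2 M (indicator A) (H f) (H g)"
      using wdist2_GH[OF indicator_weight[OF s(1)] L2] c HL by (simp add: corresponds_def)
    also have "\<dots> \<le> wdist2 M (indicator A') (H f) (H g)"
    proof (rule wdist2_mono[OF finM])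
      show "AE \<omega> in M. indicator A \<omega> \<le> (indicator A' \<omega> :: real)" using AE by eventually_elim (auto simp: indicator_def)
    qed (use s HL indicator_weight in auto)
    also have "\<dots> = wdist2 M (indicator B') f g"
      using wdist2_GH[OF indicator_weight[OF s(3)] L2] c HL by (simp add: corresponds_def)
    finally show "wdist2 M (indicator B) f g \<le> wdist2 M (indicator B') f g" .
  qed (use s indicator_weight in auto)
  then show ?thesis by eventually_elim (auto simp: indicator_def split: if_splits)
qed

lemma corresponds_eq_left:
  assumes "corresponds B A" "corresponds B' A'" "AE \<omega> in M. \<omega> \<in> A \<longleftrightarrow> \<omega> \<in> A'"
  shows "AE \<omega> in M. \<omega> \<in> B \<longleftrightarrow> \<omega> \<in> B'"
proof -
  have "AE \<omega> in M. \<omega> \<in> A \<longrightarrow> \<omega> \<in> A'" "AE \<omega> in M. \<omega> \<in> A' \<longrightarrow> \<omega> \<in> A" using assms(3) by (auto elim: eventually_mono)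
  then have "AE \<omega> in M. \<omega> \<in> B \<longrightarrow> \<omega> \<in> B'" "AE \<omega> in M. \<omega> \<in> B' \<longrightarrow> \<omega> \<in> B"
    using corresponds_mono_left assms(1,2) by blast+
  then show ?thesis by eventually_elim blast
qed

lemma corresponds_cong:
  assumes c: "corresponds B A" and s: "B' \<in> sets M" "A' \<in> sets M"
    and AE: "AE \<omega> in M. \<omega> \<in> B \<longleftrightarrow> \<omega> \<in> B'" "AE \<omega> in M. \<omega> \<in> A \<longleftrightarrow> \<omega> \<in> A'"
  shows "corresponds B' A'"
proof -
  have i: "B \<in> sets M" "A \<in> sets M" using c by (auto simp: corresponds_def)
  have eq: "wdist2 M (indicator C) f g = wdist2 M (indicator C') f g"
    if "C \<in> sets M" "C' \<in> sets M" "AE \<omega> in M. \<omega> \<in> C \<longleftrightarrow> \<omega> \<in> C'" "f \<in> L2_fun M" "g \<in> L2_fun M"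
    for C C' and f g :: "'a \<Rightarrow> 'x"
  proof (rule wdist2_weight_cong_AE[OF indicator_weight[OF that(1)] indicator_weight[OF that(2)] that(4,5)])
    show "AE \<omega> in M. indicator C \<omega> = (indicator C' \<omega> :: real)"
      using that(3) by eventually_elim (simp add: indicator_def)
  qed
  have "E (indicator B') f g = wdist2 M (indicator A') f g" if L2: "f \<in> L2_fun M" "g \<in> L2_fun M" for f g
  proof -
    have "E (indicator B') f g = E (indicator B) f g"
      using eq[OF i(1) s(1) AE(1) G_L2[OF L2(1)] G_L2[OF L2(2)]] by simp
    also have "\<dots> = wdist2 M (indicator A) f g" using c L2 by (simp add: corresponds_def)
    also have "\<dots> = wdist2 M (indicator A') f g" by (rule eq[OF i(2) s(2) AE(2) L2])
    finally show ?thesis .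
  qed
  then show ?thesis using s by (simp add: corresponds_def)
qed

lemma corresponds_empty: "corresponds {} {}"
  by (simp add: corresponds_def wdist2_def)

lemma corresponds_compl:
  assumes c: "corresponds B A"
  shows "corresponds (space M - B) (space M - A)"
proof -
  have s: "B \<in> sets M" "A \<in> sets M" using c by (auto simp: corresponds_def)
  have compl: "wdist2 M (indicator (space M - C)) f g = wdist2 M (\<lambda>_. 1) f g - wdist2 M (indicator C) f g"
    if "C \<in> sets M" "f \<in> L2_fun M" "g \<in> L2_fun M" for C and f g :: "'a \<Rightarrow> 'x"
  proof -
    have "wdist2 M (indicator (space M - C)) f g = wdist2 M (\<lambda>\<omega>. 1 - indicator C \<omega>) f g"
      unfolding wdist2_def by (intro Bochner_Integration.integral_cong) (auto simp: indicator_def)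
    then show ?thesis using wdist2_complement[OF indicator_weight[OF that(1)] that(2,3)] by simp
  qed
  show ?thesis using c s G_L2 by (simp add: corresponds_def compl E_one)
qed

lemma corresponds_space: "corresponds (space M) (space M)"
  using corresponds_compl[OF corresponds_empty] by simp

lemma corresponds_null_iff:
  assumes c: "corresponds B A"
  shows "B \<in> null_sets M \<longleftrightarrow> A \<in> null_sets M"
proof -
  \<comment> \<open>One direction for an arbitrary pair of mutually inverse embeddings; the other is
    the same statement with the two exchanged.\<close>
  have half: "B \<in> null_sets M" if c: "L2_isometry.corresponds M G' B A" and A: "A \<in> null_sets M" and I: "L2_isometry M G' H'"
    for G' H' B A
  proof -
    interpret I: L2_isometry M G' H' by (rule I)
    have "AE \<omega> in M. \<omega> \<in> A \<longrightarrow> \<omega> \<in> {}" using AE_not_in[OF A] by eventually_elim simp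
    then have "AE \<omega> in M. \<omega> \<in> B \<longrightarrow> \<omega> \<in> {}" by (rule I.corresponds_mono_left[OF c I.corresponds_empty])
    then have "AE \<omega> in M. \<omega> \<notin> B" by simp
    then show ?thesis using c AE_iff_null_sets[of B M] by (simp add: I.corresponds_def)
  qed
  show ?thesis using half[OF c] half[OF corresponds_inverse[OF c]] swap L2_isometry_axioms by blast
qed

lemma wdist2_disjoint_UN:
  fixes f g :: "'a \<Rightarrow> 'x"
  assumes "\<And>n::nat. C n \<in> sets M" "disjoint_family C" "f \<in> L2_fun M" "g \<in> L2_fun M"
  shows "wdist2 M (indicator (\<Union>n. C n)) f g = (\<Sum>n. wdist2 M (indicator (C n)) f g)"
proof -
  have U: "(\<Union>n. C n) \<in> sets M" using assms(1) by auto
  have "set_integrable M (\<Union>n. C n) (\<lambda>\<omega>. (dist (f \<omega>) (g \<omega>))\<^sup>2)"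
    using wdist2_integrable[OF finM indicator_weight[OF U] assms(3,4)] by (simp add: set_integrable_def)
  then show ?thesis
    using lebesgue_integral_countable_add[of C M "\<lambda>\<omega>. (dist (f \<omega>) (g \<omega>))\<^sup>2"] assms(1,2)
    by (simp add: set_lebesgue_integral_def wdist2_def disjoint_family_on_def)
qed

lemma corresponds_UN:
  assumes c: "\<And>n::nat. corresponds (B n) (A n)" and d: "disjoint_family B" "disjoint_family A"
  shows "corresponds (\<Union>n. B n) (\<Union>n. A n)"
proof -
  have s: "B n \<in> sets M" "A n \<in> sets M" for n using c by (auto simp: corresponds_def)
  have e: "E (indicator (B n)) f g = wdist2 M (indicator (A n)) f g" if "f \<in> L2_fun M" "g \<in> L2_fun M" for f g n
    using c that by (auto simp: corresponds_def)
  show ?thesis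
    unfolding corresponds_def
    using s G_L2 by (auto simp: wdist2_disjoint_UN[OF s(1) d(1)] wdist2_disjoint_UN[OF s(2) d(2)] e)
qed

lemma wdist2_indicator_lim:
  fixes f g :: "'a \<Rightarrow> 'x"
  assumes C: "\<And>n::nat. C n \<in> sets M" "C' \<in> sets M" and L2: "f \<in> L2_fun M" "g \<in> L2_fun M"
    and lim: "AE \<omega> in M. (\<lambda>n. indicator (C n) \<omega> :: real) \<longlonglongrightarrow> indicator C' \<omega>"
  shows "(\<lambda>n. wdist2 M (indicator (C n)) f g) \<longlonglongrightarrow> wdist2 M (indicator C') f g"
  unfolding wdist2_def
proof (rule integral_dominated_convergence)
  have [measurable]: "f \<in> borel_measurable M" "g \<in> borel_measurable M" using L2 L2_fun_measurable by blast+
  show "integrable M (\<lambda>\<omega>. (dist (f \<omega>) (g \<omega>))\<^sup>2)" by (rule L2_fun_integrable_dist[OF finM L2])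
  show "(\<lambda>\<omega>. indicator C' \<omega> * (dist (f \<omega>) (g \<omega>))\<^sup>2) \<in> borel_measurable M" using C by measurable
  show "(\<lambda>\<omega>. indicator (C n) \<omega> * (dist (f \<omega>) (g \<omega>))\<^sup>2) \<in> borel_measurable M" for n using C(1)[of n] by measurable
  show "AE \<omega> in M. (\<lambda>n. indicator (C n) \<omega> * (dist (f \<omega>) (g \<omega>))\<^sup>2) \<longlonglongrightarrow> indicator C' \<omega> * (dist (f \<omega>) (g \<omega>))\<^sup>2"
    using lim by eventually_elim (intro tendsto_intros)
  show "AE \<omega> in M. norm (indicator (C n) \<omega> * (dist (f \<omega>) (g \<omega>))\<^sup>2) \<le> (dist (f \<omega>) (g \<omega>))\<^sup>2" for n
    by (rule AE_I2) (simp add: indicator_def)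
qed

text \<open>Both sides of the defining identity pass to the limit by dominated convergence. This
  leads from rational levels to real ones.\<close>

lemma corresponds_lim:
  assumes c: "\<And>n::nat. corresponds (B n) (A n)" and s': "B' \<in> sets M" "A' \<in> sets M"
    and lim: "AE \<omega> in M. (\<lambda>n. indicator (B n) \<omega> :: real) \<longlonglongrightarrow> indicator B' \<omega>"
      "AE \<omega> in M. (\<lambda>n. indicator (A n) \<omega> :: real) \<longlonglongrightarrow> indicator A' \<omega>"
  shows "corresponds B' A'"
proof -
  have s: "B n \<in> sets M" "A n \<in> sets M" for n using c by (auto simp: corresponds_def)
  have "E (indicator B') f g = wdist2 M (indicator A') f g" if L2: "f \<in> L2_fun M" "g \<in> L2_fun M" for f g
  proof (rule LIMSEQ_unique)
    show "(\<lambda>n. E (indicator (B n)) f g) \<longlonglongrightarrow> E (indicator B') f g"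
      by (rule wdist2_indicator_lim[OF s(1) s'(1) G_L2[OF L2(1)] G_L2[OF L2(2)] lim(1)])
    show "(\<lambda>n. E (indicator (B n)) f g) \<longlonglongrightarrow> wdist2 M (indicator A') f g"
      using wdist2_indicator_lim[OF s(2) s'(2) L2 lim(2)] c L2 by (simp add: corresponds_def)
  qed
  then show ?thesis using s' by (simp add: corresponds_def)
qed

end

section \<open>The induced point map\<close>

lemma (in standard_coordinates) AE_\<Omega>: "AE \<omega> in M. \<omega> \<in> \<Omega>"
  using AE_not_in[OF \<Omega>_null] AE_space by eventually_elim auto

text \<open>Between the fixed point sets of the two composites the maps are mutually inverse; the
  complements are the exceptional sets.\<close>

lemma (in standard_coordinates) ae_bijectiveI:
  assumes m: "\<phi> \<in> measurable M M" "\<psi> \<in> measurable M M" and r: "\<And>\<omega>. \<phi> \<omega> \<in> \<Omega>" "\<And>\<omega>. \<psi> \<omega> \<in> \<Omega>"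
    and id: "AE \<omega> in M. \<psi> (\<phi> \<omega>) = \<omega>" "AE \<omega> in M. \<phi> (\<psi> \<omega>) = \<omega>"
  shows "ae_bijective M \<phi>"
proof -
  have \<Omega>s: "\<Omega> \<subseteq> space M" using sets.sets_into_space[OF \<Omega>_sets] .
  have null: "space M - {\<omega> \<in> space M. \<beta> (\<alpha> \<omega>) = \<omega>} \<in> null_sets M"
    if m: "\<alpha> \<in> measurable M M" "\<beta> \<in> measurable M M" and r: "\<And>\<omega>. \<beta> \<omega> \<in> \<Omega>" and id: "AE \<omega> in M. \<beta> (\<alpha> \<omega>) = \<omega>" for \<alpha> \<beta>
  proof -
    note [measurable] = m \<Omega>_sets
    \<comment> \<open>Equality of points of \<open>M\<close> is not obviously a measurable
      condition; the injective coordinate replaces it by equality of two measurable real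
      functions.\<close>
    have "{\<omega> \<in> space M. \<beta> (\<alpha> \<omega>) = \<omega>} = {\<omega> \<in> space M. \<omega> \<in> \<Omega> \<and> e (\<beta> (\<alpha> \<omega>)) = e \<omega>}"
      using r j_e by (auto, metis, metis)
    also have "\<dots> \<in> sets M" by measurable
    finally have s: "{\<omega> \<in> space M. \<beta> (\<alpha> \<omega>) = \<omega>} \<in> sets M" .
    have "AE \<omega> in M. \<omega> \<notin> space M - {\<omega> \<in> space M. \<beta> (\<alpha> \<omega>) = \<omega>}" using id by eventually_elim auto
    then show ?thesis using AE_iff_null_sets[of "space M - {\<omega> \<in> space M. \<beta> (\<alpha> \<omega>) = \<omega>}" M] s by auto
  qed
  define G0 where "G0 = {\<omega> \<in> space M. \<psi> (\<phi> \<omega>) = \<omega>}"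
  define G1 where "G1 = {\<omega> \<in> space M. \<phi> (\<psi> \<omega>) = \<omega>}"
  have "bij_betw \<phi> G0 G1"
    by (rule bij_betw_byWitness[where f' = \<psi>]) (use r \<Omega>s in \<open>auto simp: G0_def G1_def\<close>)
  moreover have "space M - (space M - G0) = G0" "space M - (space M - G1) = G1" by (auto simp: G0_def G1_def)
  ultimately show ?thesis
    unfolding ae_bijective_def using null[OF m r(2) id(1)] null[OF m(2,1) r(1) id(2)]
    by (intro bexI[of _ "space M - G0"] bexI[of _ "space M - G1"]) (auto simp: G0_def[symmetric] G1_def[symmetric])
qed

locale L2_isometry_standard = L2_isometry M G H + standard_coordinates M e j \<Omega> R
  for M :: "'a measure" and G H :: "('a \<Rightarrow> 'x::polish_space) \<Rightarrow> 'a \<Rightarrow> 'x" and e j \<Omega> R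
begin

text \<open>\<open>T\<close> is the coordinate of the point map to be found. The sets that
  correspond to \<open>e < q\<close> for rational \<open>q\<close> are its level sets up to null
  sets and define it as a cut; the correspondence then spreads from half lines to Borel
  sets.\<close>

lemma real_map_exists:
  "\<exists>T\<in>borel_measurable M. \<forall>C\<in>sets borel. corresponds (T -` C \<inter> space M) (e -` C \<inter> space M)"
proof -
  interpret sw: L2_isometry M H G by (rule swap)
  have ex: "\<exists>B. corresponds B A" if A: "A \<in> sets M" for A
  proof -
    obtain B where "sw.corresponds A B" using sw.corresponds_exists[OF A] by blast
    then show ?thesis using sw.corresponds_inverse by blast
  qed
  have "\<exists>B. corresponds B {\<omega> \<in> space M. e \<omega> < of_rat q}" for q by (rule ex) measurable
  then obtain \<Theta> where \<Theta>: "\<And>q. corresponds (\<Theta> q) {\<omega> \<in> space M. e \<omega> < of_rat q}" by metis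
  have \<Theta>s: "\<Theta> q \<in> sets M" for q using \<Theta>[of q] by (simp add: corresponds_def)
  define T where "T = cut \<Theta>"
  have Tm [measurable]: "T \<in> borel_measurable M" unfolding T_def by (rule cut_measurable[OF \<Theta>s])
  have "AE \<omega> in M. \<forall>q q'. q \<le> q' \<longrightarrow> \<omega> \<in> \<Theta> q \<longrightarrow> \<omega> \<in> \<Theta> q'"
  proof (intro AE_all_countable[THEN iffD2] allI)
    fix q q' :: rat
    show "AE \<omega> in M. q \<le> q' \<longrightarrow> \<omega> \<in> \<Theta> q \<longrightarrow> \<omega> \<in> \<Theta> q'"
    proof (cases "q \<le> q'")
      case True
      then have "of_rat q \<le> (of_rat q' :: real)" by (simp add: of_rat_less_eq)
      then have "AE \<omega> in M. \<omega> \<in> \<Theta> q \<longrightarrow> \<omega> \<in> \<Theta> q'"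
        by (intro corresponds_mono_left[OF \<Theta> \<Theta>] AE_I2) auto
      then show ?thesis by simp
    qed simp
  qed
  moreover have "AE \<omega> in M. \<forall>q. q \<le> 0 \<longrightarrow> \<omega> \<notin> \<Theta> q"
  proof (intro AE_all_countable[THEN iffD2] allI)
    fix q :: rat
    show "AE \<omega> in M. q \<le> 0 \<longrightarrow> \<omega> \<notin> \<Theta> q"
    proof (cases "q \<le> 0")
      case True
      then have "of_rat q \<le> (0 :: real)" by (simp add: of_rat_le_0_iff)
      then have empty: "{\<omega> \<in> space M. e \<omega> < of_rat q} = {}"
        using e_range by (metis (mono_tags, lifting) Collect_empty_eq not_less order_trans)
      have "\<Theta> q \<in> null_sets M" using corresponds_null_iff[OF \<Theta>[of q]] unfolding empty by simp
      then show ?thesis using AE_not_in by fastforce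
    qed simp
  qed
  \<comment> \<open>As \<open>e\<close> lies between 0 and 2, level 3 contains everything and levels
    up to 0 nothing; this keeps the infimum in the cut finite.\<close>
  moreover have "AE \<omega> in M. \<omega> \<in> \<Theta> 3"
  proof -
    have "e \<omega> < of_rat 3" for \<omega> using e_range[of \<omega>] by simp
    then have "{\<omega> \<in> space M. e \<omega> < of_rat 3} = space M" by auto
    then have "AE \<omega> in M. \<omega> \<in> \<Theta> 3 \<longleftrightarrow> \<omega> \<in> space M"
      using corresponds_eq_left[OF \<Theta>[of 3] corresponds_space] by simp
    then show ?thesis using AE_space by eventually_elim blast
  qed
  ultimately have AE\<Theta>: "AE \<omega> in M. (\<forall>q q'. q \<le> q' \<longrightarrow> \<omega> \<in> \<Theta> q \<longrightarrow> \<omega> \<in> \<Theta> q') \<and> (\<forall>r. T \<omega> < r \<longleftrightarrow> (\<exists>q. \<omega> \<in> \<Theta> q \<and> of_rat q < r))"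
  proof eventually_elim
    case (elim \<omega>)
    have lo: "0 \<le> (of_rat q :: real)" if "\<omega> \<in> \<Theta> q" for q
      using elim(2) that by (cases "q \<le> 0") (auto simp: zero_le_of_rat_iff)
    have "cut \<Theta> \<omega> < r \<longleftrightarrow> (\<exists>q. \<omega> \<in> \<Theta> q \<and> of_rat q < r)" for r
      using cut_less_iff[of \<omega> \<Theta> 3 0 r, OF elim(3)] lo by simp
    then show ?case unfolding T_def using elim(1) by blast
  qed
  \<comment> \<open>Up to a null set \<open>T < r\<close> holds on the union of the
    \<open>\<Theta> q\<close> with \<open>q < r\<close>; rationals approaching \<open>r\<close>
    strictly from below give it as a limit of corresponding pairs.\<close>
  have less: "corresponds (T -` {..<r} \<inter> space M) (e -` {..<r} \<inter> space M)" for r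
  proof -
    have "\<exists>q. r - 1 / (real n + 1) < of_rat q \<and> of_rat q < r" for n by (rule of_rat_dense) simp
    then obtain q where q: "\<And>n. r - 1 / (real n + 1) < of_rat (q n)" "\<And>n. of_rat (q n) < r" by metis
    have qlim: "(\<lambda>n. of_rat (q n) :: real) \<longlonglongrightarrow> r"
    proof (rule tendsto_sandwich[OF _ _ _ tendsto_const])
      show "(\<lambda>n. r - 1 / (real n + 1)) \<longlonglongrightarrow> r"
        using tendsto_diff[OF tendsto_const LIMSEQ_inverse_real_of_nat, of r] by (simp add: inverse_eq_divide add.commute)
    qed (use q less_imp_le in \<open>auto intro!: always_eventually\<close>)
    have ev: "\<forall>\<^sub>F n in sequentially. v < of_rat (q n)" if "v < r" for v :: real
      using order_tendstoD(1)[OF qlim that] .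
    show ?thesis
    proof (rule corresponds_lim[where B = "\<lambda>n. \<Theta> (q n)" and A = "\<lambda>n. {\<omega> \<in> space M. e \<omega> < of_rat (q n)}", OF \<Theta>])
      show "AE \<omega> in M. (\<lambda>n. indicator (\<Theta> (q n)) \<omega> :: real) \<longlonglongrightarrow> indicator (T -` {..<r} \<inter> space M) \<omega>"
        using AE\<Theta> AE_space
      proof eventually_elim
        case (elim \<omega>)
        show ?case
        proof (cases "T \<omega> < r")
          case True
          then obtain q0 where q0: "\<omega> \<in> \<Theta> q0" "of_rat q0 < r" using elim by blast
          have "\<forall>\<^sub>F n in sequentially. indicator (\<Theta> (q n)) \<omega> = (1 :: real)"
            using ev[OF q0(2)]
          proof eventually_elim
            case (elim n)
            then have "q0 \<le> q n" by (simp add: of_rat_less less_imp_le)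
            then show ?case using \<open>(\<forall>q q'. q \<le> q' \<longrightarrow> \<omega> \<in> \<Theta> q \<longrightarrow> \<omega> \<in> \<Theta> q') \<and> _\<close> q0 by (simp add: indicator_def)
          qed
          then show ?thesis using True elim by (simp add: tendsto_eventually)
        next
          case False
          then have "\<omega> \<notin> \<Theta> (q n)" for n using elim q(2) by blast
          then show ?thesis using False by simp
        qed
      qed
      show "AE \<omega> in M. (\<lambda>n. indicator {\<omega> \<in> space M. e \<omega> < of_rat (q n)} \<omega> :: real) \<longlonglongrightarrow> indicator (e -` {..<r} \<inter> space M) \<omega>"
      proof (rule AE_I2)
        fix \<omega> assume \<omega>: "\<omega> \<in> space M"
        show "(\<lambda>n. indicator {\<omega> \<in> space M. e \<omega> < of_rat (q n)} \<omega> :: real) \<longlonglongrightarrow> indicator (e -` {..<r} \<inter> space M) \<omega>"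
        proof (cases "e \<omega> < r")
          case True
          have "\<forall>\<^sub>F n in sequentially. indicator {\<omega> \<in> space M. e \<omega> < of_rat (q n)} \<omega> = (1 :: real)"
            using ev[OF True] by eventually_elim (use \<omega> in simp)
          then show ?thesis using True \<omega> by (simp add: tendsto_eventually)
        next
          case False
          then have "\<not> e \<omega> < of_rat (q n)" for n using q(2)[of n] by linarith
          then show ?thesis using False by simp
        qed
      qed
    qed measurable
  qed
  have "corresponds (T -` C \<inter> space M) (e -` C \<inter> space M)" if "C \<in> sets borel" for C
  proof -
    \<comment> \<open>Correspondence is available for complements and disjoint unions, which form a
      Dynkin system; hence a generator stable under intersection.\<close>
    have 1: "Int_stable (range (lessThan :: real \<Rightarrow> real set))"
    proof (rule Int_stableI_image)
      show "\<exists>k\<in>UNIV. {..<x} \<inter> {..<y} = {..<k}" for x y :: real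
        by (rule bexI[of _ "min x y"]) auto
    qed
    have 2: "range lessThan \<subseteq> Pow (UNIV :: real set)" by simp
    have 3: "C \<in> sigma_sets UNIV (range lessThan)" using that by (simp add: borel_Iio)
    show ?thesis
      using 1 2 3
    proof (induction rule: sigma_sets_induct_disjoint)
      show "corresponds (T -` {} \<inter> space M) (e -` {} \<inter> space M)" using corresponds_empty by simp
    next
      fix C :: "real set" assume "C \<in> range lessThan"
      then show "corresponds (T -` C \<inter> space M) (e -` C \<inter> space M)" using less by blast
    next
      fix C :: "real set" assume "corresponds (T -` C \<inter> space M) (e -` C \<inter> space M)"
      from corresponds_compl[OF this] show "corresponds (T -` (UNIV - C) \<inter> space M) (e -` (UNIV - C) \<inter> space M)"
        by (simp add: vimage_Diff Diff_Int_distrib2 Diff_Int)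
    next
      fix C :: "nat \<Rightarrow> real set" assume d: "disjoint_family C"
        and c: "\<And>i. corresponds (T -` C i \<inter> space M) (e -` C i \<inter> space M)"
      have "corresponds (\<Union>i. T -` C i \<inter> space M) (\<Union>i. e -` C i \<inter> space M)"
        using d by (intro corresponds_UN c) (auto simp: disjoint_family_on_def)
      then show "corresponds (T -` (\<Union>i. C i) \<inter> space M) (e -` (\<Union>i. C i) \<inter> space M)"
        by (simp add: vimage_UN UN_extend_simps(4)[symmetric])
    qed
  qed
  then show ?thesis using Tm by blast
qed

text \<open>\<open>T\<close> is lifted through the inverse \<open>j\<close> of the coordinate.
  Corresponding sets are null together, so \<open>T\<close> pulls null sets back to null sets, and
  this makes the lift measurable for either sigma-algebra.\<close>

lemma point_map_exists:
  "\<exists>\<phi>\<in>measurable M M. (\<forall>\<omega>. \<phi> \<omega> \<in> \<Omega>) \<and> (\<forall>A\<in>sets M. corresponds (\<phi> -` A \<inter> space M) A)"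
proof -
  obtain T where T [measurable]: "T \<in> borel_measurable M"
    and c: "\<And>C. C \<in> sets borel \<Longrightarrow> corresponds (T -` C \<inter> space M) (e -` C \<inter> space M)"
    using real_map_exists by blast
  have ns: "AE \<omega> in M. T \<omega> \<notin> C" if C: "C \<in> sets borel" "AE \<omega> in M. e \<omega> \<notin> C" for C
  proof -
    have "AE \<omega> in M. \<omega> \<notin> e -` C \<inter> space M" using C(2) by eventually_elim simp
    then have "e -` C \<inter> space M \<in> null_sets M"
      using AE_iff_null_sets[of "e -` C \<inter> space M" M] measurable_sets[OF e_measurable C(1)] by simp
    then have "T -` C \<inter> space M \<in> null_sets M" using corresponds_null_iff[OF c[OF C(1)]] by simp
    from AE_not_in[OF this] AE_space show ?thesis by eventually_elim simp
  qed
  define \<phi> where "\<phi> \<omega> = (if \<omega> \<in> \<Omega> then j (T \<omega>) else j 0)" for \<omega>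
  have \<phi>m: "\<phi> \<in> measurable M M" unfolding \<phi>_def by (rule lift_measurable[OF T ns])
  have \<phi>\<Omega>: "\<phi> \<omega> \<in> \<Omega>" for \<omega> by (simp add: \<phi>_def j_\<Omega>)
  have "AE \<omega> in M. e \<omega> \<notin> - R" using AE_\<Omega> by eventually_elim (simp add: e_R)
  then have "AE \<omega> in M. T \<omega> \<notin> - R" by (rule ns[rotated]) (use R_sets in auto)
  then have e\<phi>: "AE \<omega> in M. e (\<phi> \<omega>) = T \<omega>"
    using AE_\<Omega> by eventually_elim (simp add: \<phi>_def e_j)
  have "corresponds (\<phi> -` A \<inter> space M) A" if A: "A \<in> sets M" for A
  proof -
    obtain C Z where C: "C \<in> sets borel" "Z \<in> sets borel" "AE \<omega> in M. e \<omega> \<notin> Z"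
      and CZ: "\<And>\<omega>. \<omega> \<in> \<Omega> \<Longrightarrow> e \<omega> \<notin> Z \<Longrightarrow> \<omega> \<in> A \<longleftrightarrow> e \<omega> \<in> C"
      using sets_e[OF A] by blast
    show ?thesis
    proof (rule corresponds_cong[OF c[OF C(1)] measurable_sets[OF \<phi>m A] A])
      show "AE \<omega> in M. \<omega> \<in> T -` C \<inter> space M \<longleftrightarrow> \<omega> \<in> \<phi> -` A \<inter> space M"
        using e\<phi> ns[OF C(2,3)]
      proof eventually_elim
        case (elim \<omega>)
        then show ?case using CZ[OF \<phi>\<Omega>[of \<omega>]] by auto
      qed
      show "AE \<omega> in M. \<omega> \<in> e -` C \<inter> space M \<longleftrightarrow> \<omega> \<in> A"
        using C(3) AE_\<Omega> AE_space by eventually_elim (use CZ in auto)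
    qed
  qed
  then show ?thesis using \<phi>m \<phi>\<Omega> by blast
qed

text \<open>A set \<open>A\<close> and its preimage under \<open>\<psi>\<close> followed by that
  under \<open>\<phi>\<close> both correspond to the \<open>\<psi>\<close>-preimage of
  \<open>A\<close>, so they agree up to a null set. Applied to rational level sets of
  \<open>e\<close>, this identifies the points.\<close>

lemma point_map_inverse:
  assumes \<phi>: "\<phi> \<in> measurable M M" "\<And>A. A \<in> sets M \<Longrightarrow> corresponds (\<phi> -` A \<inter> space M) A"
    and \<psi>: "\<psi> \<in> measurable M M" "\<And>\<omega>. \<psi> \<omega> \<in> \<Omega>" "\<And>A. A \<in> sets M \<Longrightarrow> L2_isometry.corresponds M H (\<psi> -` A \<inter> space M) A"
  shows "AE \<omega> in M. \<psi> (\<phi> \<omega>) = \<omega>"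
proof -
  interpret sw: L2_isometry M H G by (rule swap)
  have "AE \<omega> in M. \<forall>q. e (\<psi> (\<phi> \<omega>)) < of_rat q \<longleftrightarrow> e \<omega> < of_rat q"
  proof (intro AE_all_countable[THEN iffD2] allI)
    fix q :: rat
    define A where "A = {\<omega> \<in> space M. e \<omega> < of_rat q}"
    have A: "A \<in> sets M" unfolding A_def by measurable
    have B: "\<psi> -` A \<inter> space M \<in> sets M" by (rule measurable_sets[OF \<psi>(1) A])
    have "AE \<omega> in M. \<omega> \<in> \<phi> -` (\<psi> -` A \<inter> space M) \<inter> space M \<longleftrightarrow> \<omega> \<in> A"
      by (rule corresponds_eq_left[OF \<phi>(2)[OF B] sw.corresponds_inverse[OF \<psi>(3)[OF A]]]) simp
    then show "AE \<omega> in M. e (\<psi> (\<phi> \<omega>)) < of_rat q \<longleftrightarrow> e \<omega> < of_rat q"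
      using AE_space
    proof eventually_elim
      case (elim \<omega>)
      have "\<phi> \<omega> \<in> space M" using measurable_space[OF \<phi>(1)] elim by blast
      moreover have "\<psi> (\<phi> \<omega>) \<in> space M" using \<psi>(2) sets.sets_into_space[OF \<Omega>_sets] by blast
      ultimately show ?case using elim by (auto simp: A_def)
    qed
  qed
  then show ?thesis
    using AE_\<Omega>
  proof eventually_elim
    case (elim \<omega>)
    have "e (\<psi> (\<phi> \<omega>)) = e \<omega>"
    proof (rule ccontr)
      assume "e (\<psi> (\<phi> \<omega>)) \<noteq> e \<omega>"
      then obtain q where "(e (\<psi> (\<phi> \<omega>)) < of_rat q \<and> of_rat q < e \<omega>) \<or> (e \<omega> < of_rat q \<and> of_rat q < e (\<psi> (\<phi> \<omega>)))"
        using of_rat_dense by (metis linorder_neq_iff)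
      then show False using elim(1) by (metis less_asym)
    qed
    then show ?case using j_e[OF \<psi>(2)] j_e[OF elim(2)] by metis
  qed
qed

end

section \<open>Isometries of \<open>L\<^sup>2(\<Omega>, X)\<close>\<close>

lemma dilation_extension:
  fixes k :: "'x::metric_space \<Rightarrow> 'y::complete_space"
  assumes D: "closure D = UNIV" and k: "\<And>x y. x \<in> D \<Longrightarrow> y \<in> D \<Longrightarrow> dist (k x) (k y) = r * dist x y"
  shows "\<exists>h. (\<forall>x\<in>D. h x = k x) \<and> (\<forall>x y. dist (h x) (h y) = r * dist x y)"
proof -
  have "uniformly_continuous_on D k"
    unfolding uniformly_continuous_on_def
  proof (intro allI impI)
    fix e :: real assume "0 < e"
    show "\<exists>d>0. \<forall>x\<in>D. \<forall>x'\<in>D. dist x' x < d \<longrightarrow> dist (k x') (k x) < e"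
    proof (rule exI[of _ "e / (\<bar>r\<bar> + 1)"], intro conjI ballI impI)
      show "0 < e / (\<bar>r\<bar> + 1)" using \<open>0 < e\<close> by simp
      fix x x' assume x: "x \<in> D" "x' \<in> D" "dist x' x < e / (\<bar>r\<bar> + 1)"
      have "dist (k x') (k x) \<le> (\<bar>r\<bar> + 1) * dist x' x" using k[OF x(2,1)] by (simp add: mult_right_mono)
      also have "\<dots> < e" using x(3) by (simp add: field_simps)
      finally show "dist (k x') (k x) < e" .
    qed
  qed
  then obtain h where h: "uniformly_continuous_on (closure D) h" "\<And>x. x \<in> D \<Longrightarrow> k x = h x"
    by (rule uniformly_continuous_on_extension_on_closure) blast
  have c: "continuous_on UNIV h" using uniformly_continuous_imp_continuous[OF h(1)] D by simp
  have "dist (h x) (h y) = r * dist x y" for x y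
  proof -
    obtain xs where xs: "\<And>n. xs n \<in> D" "xs \<longlonglongrightarrow> x" using D closure_sequential[of x D] by auto
    obtain ys where ys: "\<And>n. ys n \<in> D" "ys \<longlonglongrightarrow> y" using D closure_sequential[of y D] by auto
    have "(\<lambda>n. h (xs n)) \<longlonglongrightarrow> h x" "(\<lambda>n. h (ys n)) \<longlonglongrightarrow> h y"
      using continuous_on_tendsto_compose[OF c] xs ys by auto
    then have "(\<lambda>n. dist (h (xs n)) (h (ys n))) \<longlonglongrightarrow> dist (h x) (h y)" by (rule tendsto_dist)
    moreover have "dist (h (xs n)) (h (ys n)) = r * dist (xs n) (ys n)" for n
      using k[OF xs(1)[of n] ys(1)[of n]] h(2)[OF xs(1)[of n]] h(2)[OF ys(1)[of n]] by simp
    moreover have "(\<lambda>n. r * dist (xs n) (ys n)) \<longlonglongrightarrow> r * dist x y"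
      by (intro tendsto_mult tendsto_const tendsto_dist xs ys)
    ultimately show ?thesis using LIMSEQ_unique by fastforce
  qed
  then show ?thesis using h(2) by (intro exI[of _ h]) auto
qed

text \<open>A dilation with positive factor has a complete, hence closed range; this one contains a
  dense set.\<close>

lemma dilation_surj:
  fixes h :: "'x::complete_space \<Rightarrow> 'y::metric_space"
  assumes r: "0 < r" and h: "\<And>x y. dist (h x) (h y) = r * dist x y"
    and D: "closure D = UNIV" "D \<subseteq> range h"
  shows "surj h"
proof -
  have "y \<in> range h" for y
  proof -
    obtain ys where ys: "\<And>n. ys n \<in> D" "ys \<longlonglongrightarrow> y" using D closure_sequential[of y D] by auto
    have "\<forall>n. \<exists>x. ys n = h x" using ys(1) D(2) by blast
    then obtain xs where xs: "\<And>n. ys n = h (xs n)" by metis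
    have "Cauchy ys" using ys(2) LIMSEQ_imp_Cauchy by blast
    have "Cauchy xs"
      unfolding Cauchy_def
    proof (intro allI impI)
      fix e :: real assume "0 < e"
      then have "0 < r * e" using r by simp
      then obtain N where "\<forall>m\<ge>N. \<forall>n\<ge>N. dist (ys m) (ys n) < r * e" using \<open>Cauchy ys\<close> unfolding Cauchy_def by blast
      then show "\<exists>N. \<forall>m\<ge>N. \<forall>n\<ge>N. dist (xs m) (xs n) < e" using r by (auto simp: xs h)
    qed
    then obtain x where x: "xs \<longlonglongrightarrow> x" using Cauchy_convergent convergentD by blast
    have "(\<lambda>n. r * dist (xs n) x) \<longlonglongrightarrow> r * dist x x" by (intro tendsto_mult tendsto_const tendsto_dist x)
    then have "(\<lambda>n. dist (ys n) (h x)) \<longlonglongrightarrow> 0" by (simp add: xs h)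
    then have "ys \<longlonglongrightarrow> h x" by (rule tendsto_dist_iff[THEN iffD2])
    then show ?thesis using LIMSEQ_unique ys(2) by blast
  qed
  then show ?thesis by blast
qed

lemma countable_dense_exists_closure:
  obtains D :: "'x::second_countable_topology set" where "countable D" "closure D = UNIV"
proof -
  obtain D :: "'x set" where D: "countable D" "\<And>X. open X \<Longrightarrow> X \<noteq> {} \<Longrightarrow> \<exists>d\<in>D. d \<in> X"
    by (erule countable_dense_setE)
  have "closure D = UNIV"
  proof (rule ccontr)
    assume "closure D \<noteq> UNIV"
    then have "- closure D \<noteq> {}" by blast
    then obtain d where "d \<in> D" "d \<in> - closure D" using D(2)[of "- closure D"] by auto
    then show False using closure_subset by auto
  qed
  then show ?thesis using D(1) that by blast
qed

lemma Dil_iff: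
  assumes gs: "geodesic_space (UNIV :: 'x::metric_space set) dist"
  shows "(h :: 'x \<Rightarrow> 'x) \<in> Dil r \<longleftrightarrow> 0 \<le> r \<and> (\<forall>x y. dist (h x) (h y) = r * dist x y)"
proof
  assume h: "h \<in> Dil r"
  have "dist (h x) (h y) = r * dist x y" for x y
  proof -
    obtain c where c: "geodesic_from_to UNIV dist x y c" using gs unfolding geodesic_space_def by blast
    then have c': "geodesic UNIV dist {0..dist x y} c" "c 0 = x" "c (dist x y) = y" by (auto simp: geodesic_from_to_def)
    have "\<forall>s\<in>{0..dist x y}. \<forall>t\<in>{0..dist x y}. dist (h (c s)) (h (c t)) = r * \<bar>s - t\<bar>"
      using h c'(1) unfolding Dil_def dilation_by_def by blast
    from this[rule_format, of 0 "dist x y"] show ?thesis using c' by simp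
  qed
  then show "0 \<le> r \<and> (\<forall>x y. dist (h x) (h y) = r * dist x y)" using h by (auto simp: Dil_def dilation_by_def)
next
  assume "0 \<le> r \<and> (\<forall>x y. dist (h x) (h y) = r * dist x y)"
  then show "h \<in> Dil r" by (auto simp: Dil_def dilation_by_def geodesic_def)
qed

section \<open>Change of variables\<close>

locale nonsingular_map = prob_space M for M :: "'a measure" +
  fixes \<phi> :: "'a \<Rightarrow> 'a"
  assumes \<phi>_measurable: "\<phi> \<in> measurable M M"
    and quasi_invariant: "mutually_abs_continuous (distr M M \<phi>) M"
begin

definition dens :: "'a \<Rightarrow> real" where
  "dens \<omega> = enn2real (RN_deriv M (distr M M \<phi>) \<omega>)"

lemma dens_measurable [measurable]: "dens \<in> borel_measurable M"
  unfolding dens_def by measurable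

lemma ac: "absolutely_continuous M (distr M M \<phi>)" "absolutely_continuous (distr M M \<phi>) M"
  using quasi_invariant by (auto simp: mutually_abs_continuous_def)

lemma finite_distr: "finite_measure (distr M M \<phi>)"
  using prob_space_distr[OF \<phi>_measurable] by (simp add: prob_space.finite_measure)

lemma sigma_finite_distr: "sigma_finite_measure (distr M M \<phi>)"
  using finite_distr by (simp add: finite_measure.axioms(1))

lemma dens_pos: "AE \<omega> in M. 0 < dens \<omega>"
proof -
  obtain D where D: "D \<in> borel_measurable M" "AE \<omega> in M. RN_deriv M (distr M M \<phi>) \<omega> = ennreal (D \<omega>)"
    "AE \<omega> in distr M M \<phi>. 0 < D \<omega>" "\<And>\<omega>. 0 \<le> D \<omega>"
    using real_RN_deriv[OF finite_distr ac(1)] by auto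
  have "AE \<omega> in M. 0 < D \<omega>" using absolutely_continuous_AE[OF _ ac(2) D(3)] by simp
  then show ?thesis using D(2) by eventually_elim (simp add: dens_def)
qed

lemma AE_comp: "AE \<omega> in M. P \<omega> \<Longrightarrow> AE \<omega> in M. P (\<phi> \<omega>)"
  using AE_distrD[OF \<phi>_measurable absolutely_continuous_AE[OF _ ac(1)]] by simp

text \<open>The image measure has density \<open>dens\<close> with respect to \<open>M\<close>, so
  integrating \<open>u / dens\<close> against it gives back the integral of
  \<open>u\<close>.\<close>

lemma change_of_variables:
  assumes u [measurable]: "u \<in> borel_measurable M"
  shows "integral\<^sup>L M u = (LINT \<omega>|M. u (\<phi> \<omega>) / dens (\<phi> \<omega>))"
    and "integrable M u \<longleftrightarrow> integrable M (\<lambda>\<omega>. u (\<phi> \<omega>) / dens (\<phi> \<omega>))"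
proof -
  define v where "v \<omega> = u \<omega> / dens \<omega>" for \<omega>
  have v [measurable]: "v \<in> borel_measurable M" unfolding v_def by measurable
  have eq: "AE \<omega> in M. dens \<omega> * v \<omega> = u \<omega>" using dens_pos by eventually_elim (simp add: v_def)
  have "integral\<^sup>L (distr M M \<phi>) v = (LINT \<omega>|M. dens \<omega> * v \<omega>)"
    unfolding dens_def by (rule RN_deriv_integral[OF sigma_finite_distr ac(1) _ v]) simp
  also have "\<dots> = integral\<^sup>L M u" using eq by (intro integral_cong_AE) auto
  finally show "integral\<^sup>L M u = (LINT \<omega>|M. u (\<phi> \<omega>) / dens (\<phi> \<omega>))"
    using integral_distr[OF \<phi>_measurable v] by (simp add: v_def)
  have "integrable (distr M M \<phi>) v \<longleftrightarrow> integrable M (\<lambda>\<omega>. dens \<omega> * v \<omega>)"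
    unfolding dens_def by (rule RN_deriv_integrable[OF sigma_finite_distr ac(1) _ v]) simp
  also have "\<dots> \<longleftrightarrow> integrable M u" using eq by (intro integrable_cong_AE) auto
  finally show "integrable M u \<longleftrightarrow> integrable M (\<lambda>\<omega>. u (\<phi> \<omega>) / dens (\<phi> \<omega>))"
    using integrable_distr_eq[OF \<phi>_measurable v] by (simp add: v_def)
qed

end

section \<open>From an isometry to dilations of the fibres\<close>

context L2_isometry_standard
begin

lemma corresponding_map_nonsingular:
  assumes \<phi>: "\<phi> \<in> measurable M M" "\<And>A. A \<in> sets M \<Longrightarrow> corresponds (\<phi> -` A \<inter> space M) A"
  shows "nonsingular_map M \<phi>"
proof
  have "A \<in> null_sets (distr M M \<phi>) \<longleftrightarrow> A \<in> null_sets M" for A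
  proof (cases "A \<in> sets M")
    case True
    then have "A \<in> null_sets (distr M M \<phi>) \<longleftrightarrow> \<phi> -` A \<inter> space M \<in> null_sets M"
      using \<phi>(1) by (simp add: null_sets_def emeasure_distr measurable_sets)
    then show ?thesis using corresponds_null_iff[OF \<phi>(2)[OF True]] by simp
  qed (auto simp: null_sets_def)
  then show "mutually_abs_continuous (distr M M \<phi>) M"
    by (auto simp: mutually_abs_continuous_def absolutely_continuous_def)
qed (rule \<phi>(1))

text \<open>Integrable functions with equal integrals over every \<open>B\<close> agree almost
  everywhere. Up to a null set \<open>B\<close> is the \<open>\<phi>\<close>-preimage of its own
  \<open>\<psi>\<close>-preimage \<open>A\<close>, so the correspondence of sets and a change of
  variables evaluate the integral over \<open>B\<close>.\<close>

lemma fibrewise_dilation: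
  assumes \<phi>: "\<phi> \<in> measurable M M" "\<And>A. A \<in> sets M \<Longrightarrow> corresponds (\<phi> -` A \<inter> space M) A"
    and \<psi>: "\<psi> \<in> measurable M M" "AE \<omega> in M. \<psi> (\<phi> \<omega>) = \<omega>"
    and L2: "f \<in> L2_fun M" "g \<in> L2_fun M"
  shows "AE \<omega> in M. dist (G f \<omega>) (G g \<omega>) = inverse (sqrt (nonsingular_map.dens M \<phi> (\<phi> \<omega>))) * dist (f (\<phi> \<omega>)) (g (\<phi> \<omega>))"
proof -
  interpret \<phi>: nonsingular_map M \<phi> by (rule corresponding_map_nonsingular[OF \<phi>])
  note [measurable] = \<phi>(1)
  have [measurable]: "f \<in> borel_measurable M" "g \<in> borel_measurable M" "G f \<in> borel_measurable M" "G g \<in> borel_measurable M"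
    using L2 G_L2 L2_fun_measurable by blast+
  define u where "u \<omega> = (dist (f \<omega>) (g \<omega>))\<^sup>2" for \<omega>
  have u [measurable]: "u \<in> borel_measurable M" unfolding u_def by measurable
  have ui: "integrable M u" unfolding u_def by (rule L2_fun_integrable_dist[OF finM L2])
  have "AE \<omega> in M. (dist (G f \<omega>) (G g \<omega>))\<^sup>2 = u (\<phi> \<omega>) / \<phi>.dens (\<phi> \<omega>)"
  proof (rule density_unique_real)
    show "integrable M (\<lambda>\<omega>. (dist (G f \<omega>) (G g \<omega>))\<^sup>2)" by (rule L2_fun_integrable_dist[OF finM G_L2 G_L2]) (rule L2)+
    show "integrable M (\<lambda>\<omega>. u (\<phi> \<omega>) / \<phi>.dens (\<phi> \<omega>))" using \<phi>.change_of_variables(2)[OF u] ui by simp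
    fix B assume B [measurable]: "B \<in> sets M"
    define A where "A = \<psi> -` B \<inter> space M"
    have A [measurable]: "A \<in> sets M" unfolding A_def by (rule measurable_sets[OF \<psi>(1) B])
    have A': "\<phi> -` A \<inter> space M \<in> sets M" by (rule measurable_sets[OF \<phi>(1) A])
    have BA: "AE \<omega> in M. \<omega> \<in> B \<longleftrightarrow> \<phi> \<omega> \<in> A"
      using \<psi>(2) AE_space by eventually_elim (use measurable_space[OF \<phi>(1)] in \<open>auto simp: A_def\<close>)
    have "(LINT \<omega>:B|M. (dist (G f \<omega>) (G g \<omega>))\<^sup>2) = (LINT \<omega>|M. indicator (\<phi> -` A \<inter> space M) \<omega> * (dist (G f \<omega>) (G g \<omega>))\<^sup>2)"
      unfolding set_lebesgue_integral_def
    proof (rule integral_cong_AE)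
      show "AE \<omega> in M. indicator B \<omega> *\<^sub>R (dist (G f \<omega>) (G g \<omega>))\<^sup>2 = indicator (\<phi> -` A \<inter> space M) \<omega> * (dist (G f \<omega>) (G g \<omega>))\<^sup>2"
        using BA AE_space by eventually_elim (simp add: indicator_def)
    qed (use A' in measurable)
    also have "\<dots> = (LINT \<omega>|M. indicator A \<omega> * u \<omega>)"
      using \<phi>(2)[OF A] L2 by (simp add: corresponds_def wdist2_def u_def)
    also have "\<dots> = (LINT \<omega>|M. indicator A (\<phi> \<omega>) * u (\<phi> \<omega>) / \<phi>.dens (\<phi> \<omega>))"
      by (rule \<phi>.change_of_variables(1)) measurable
    also have "\<dots> = (LINT \<omega>:B|M. u (\<phi> \<omega>) / \<phi>.dens (\<phi> \<omega>))"
      unfolding set_lebesgue_integral_def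
    proof (rule integral_cong_AE)
      show "AE \<omega> in M. indicator A (\<phi> \<omega>) * u (\<phi> \<omega>) / \<phi>.dens (\<phi> \<omega>) = indicator B \<omega> *\<^sub>R (u (\<phi> \<omega>) / \<phi>.dens (\<phi> \<omega>))"
        using BA by eventually_elim (simp add: indicator_def)
    qed measurable
    finally show "(LINT \<omega>:B|M. (dist (G f \<omega>) (G g \<omega>))\<^sup>2) = (LINT \<omega>:B|M. u (\<phi> \<omega>) / \<phi>.dens (\<phi> \<omega>))" .
  qed
  then show ?thesis
  proof eventually_elim
    case (elim \<omega>)
    then have "sqrt ((dist (G f \<omega>) (G g \<omega>))\<^sup>2) = sqrt ((dist (f (\<phi> \<omega>)) (g (\<phi> \<omega>)))\<^sup>2 / \<phi>.dens (\<phi> \<omega>))" by (simp add: u_def)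
    then show ?case by (simp add: real_sqrt_divide field_simps)
  qed
qed

lemma representation:
  "\<exists>\<phi> (\<rho> :: 'a \<Rightarrow> 'x \<Rightarrow> 'x). \<phi> \<in> measurable M M \<and> ae_bijective M \<phi> \<and> mutually_abs_continuous (distr M M \<phi>) M \<and>
     (AE \<omega> in M. \<rho> \<omega> \<in> Dil (inverse (sqrt (enn2real (RN_deriv M (distr M M \<phi>) \<omega>)))) \<and> surj (\<rho> \<omega>)) \<and>
     (\<exists>x. \<exists>g\<in>L2_fun (distr M M \<phi>). AE \<omega> in M. \<rho> \<omega> x = g \<omega>) \<and>
     (\<forall>f\<in>L2_fun M. AE \<omega> in M. G f \<omega> = \<rho> (\<phi> \<omega>) (f (\<phi> \<omega>)))"
proof -
  interpret sw: L2_isometry_standard M H G e j \<Omega> R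
    by (intro L2_isometry_standard.intro swap standard_coordinates_axioms)
  have gs: "geodesic_space (UNIV :: 'x set) dist" using CAT0 unfolding CAT0_def by blast
  obtain \<phi> where \<phi>: "\<phi> \<in> measurable M M" "\<And>\<omega>. \<phi> \<omega> \<in> \<Omega>" "\<And>A. A \<in> sets M \<Longrightarrow> corresponds (\<phi> -` A \<inter> space M) A"
    using point_map_exists by blast
  obtain \<psi> where \<psi>: "\<psi> \<in> measurable M M" "\<And>\<omega>. \<psi> \<omega> \<in> \<Omega>" "\<And>A. A \<in> sets M \<Longrightarrow> sw.corresponds (\<psi> -` A \<inter> space M) A"
    using sw.point_map_exists by blast
  have \<psi>\<phi>: "AE \<omega> in M. \<psi> (\<phi> \<omega>) = \<omega>" by (rule point_map_inverse[OF \<phi>(1,3) \<psi>])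
  have \<phi>\<psi>: "AE \<omega> in M. \<phi> (\<psi> \<omega>) = \<omega>" by (rule sw.point_map_inverse[OF \<psi>(1,3) \<phi>])
  interpret \<phi>: nonsingular_map M \<phi> by (rule corresponding_map_nonsingular[OF \<phi>(1,3)])
  interpret \<psi>: nonsingular_map M \<psi> by (rule sw.corresponding_map_nonsingular[OF \<psi>(1,3)])
  define r where "r \<omega> = inverse (sqrt (\<phi>.dens \<omega>))" for \<omega>
  have r0: "AE \<omega> in M. 0 < r \<omega>" using \<phi>.dens_pos by eventually_elim (simp add: r_def)
  have dil: "AE \<omega> in M. dist (G f \<omega>) (G g \<omega>) = r (\<phi> \<omega>) * dist (f (\<phi> \<omega>)) (g (\<phi> \<omega>))"
    if "f \<in> L2_fun M" "g \<in> L2_fun M" for f g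
    unfolding r_def by (rule fibrewise_dilation[OF \<phi>(1) _ \<psi>(1) \<psi>\<phi> that]) (rule \<phi>(3))
  obtain D :: "'x set" where D: "countable D" "closure D = UNIV" by (rule countable_dense_exists_closure)
  have cL: "(\<lambda>_. x) \<in> L2_fun M" for x :: 'x by (rule L2_fun_const[OF finM])
  define k where "k \<omega> x = G (\<lambda>_. x) \<omega>" for \<omega> x
  \<comment> \<open>Each pair of constants has its own null set, so only countably many are
    compared; completeness of \<open>X\<close> extends the dilation from \<open>D\<close>.\<close>
  have "AE \<omega> in M. \<forall>x\<in>D. \<forall>y\<in>D. dist (k \<omega> x) (k \<omega> y) = r (\<phi> \<omega>) * dist x y"
    unfolding k_def using D(1) dil[OF cL cL] by (simp add: AE_ball_countable)
  then have ext: "AE \<omega> in M. \<exists>h. (\<forall>x\<in>D. h x = k \<omega> x) \<and> (\<forall>x y. dist (h x) (h y) = r (\<phi> \<omega>) * dist x y)"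
    by eventually_elim (rule dilation_extension[OF D(2)], blast)
  define \<rho>' where "\<rho>' \<omega> = (SOME h. (\<forall>x\<in>D. h x = k \<omega> x) \<and> (\<forall>x y. dist (h x) (h y) = r (\<phi> \<omega>) * dist x y))" for \<omega>
  have \<rho>': "AE \<omega> in M. (\<forall>x\<in>D. \<rho>' \<omega> x = k \<omega> x) \<and> (\<forall>x y. dist (\<rho>' \<omega> x) (\<rho>' \<omega> y) = r (\<phi> \<omega>) * dist x y)"
    using ext
  proof eventually_elim
    case (elim \<omega>)
    then show ?case unfolding \<rho>'_def by (rule someI_ex)
  qed
  \<comment> \<open>Let points of \<open>D\<close> tend to \<open>f (\<phi> \<omega>)\<close>: their
    images tend to both sides, since \<open>G f\<close> and the images of constants satisfy the same
    distance formula.\<close>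
  have formula: "AE \<omega> in M. G f \<omega> = \<rho>' \<omega> (f (\<phi> \<omega>))" if f: "f \<in> L2_fun M" for f
  proof -
    have "AE \<omega> in M. \<forall>x\<in>D. dist (G f \<omega>) (k \<omega> x) = r (\<phi> \<omega>) * dist (f (\<phi> \<omega>)) x"
      unfolding k_def using D(1) dil[OF f cL] by (simp add: AE_ball_countable)
    with \<rho>' show ?thesis
    proof eventually_elim
      case (elim \<omega>)
      obtain xs where xs: "\<And>n. xs n \<in> D" "xs \<longlonglongrightarrow> f (\<phi> \<omega>)" using D closure_sequential[of "f (\<phi> \<omega>)" D] by auto
      have d0: "(\<lambda>n. r (\<phi> \<omega>) * dist (f (\<phi> \<omega>)) (xs n)) \<longlonglongrightarrow> r (\<phi> \<omega>) * dist (f (\<phi> \<omega>)) (f (\<phi> \<omega>))"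
        by (intro tendsto_mult tendsto_const tendsto_dist xs)
      have "dist (\<rho>' \<omega> (xs n)) (G f \<omega>) = r (\<phi> \<omega>) * dist (f (\<phi> \<omega>)) (xs n)"
        "dist (\<rho>' \<omega> (xs n)) (\<rho>' \<omega> (f (\<phi> \<omega>))) = r (\<phi> \<omega>) * dist (f (\<phi> \<omega>)) (xs n)" for n
        using elim xs(1)[of n] by (metis dist_commute)+
      then have "(\<lambda>n. dist (\<rho>' \<omega> (xs n)) (G f \<omega>)) \<longlonglongrightarrow> 0" "(\<lambda>n. dist (\<rho>' \<omega> (xs n)) (\<rho>' \<omega> (f (\<phi> \<omega>)))) \<longlonglongrightarrow> 0"
        using d0 by simp_all
      then have "(\<lambda>n. \<rho>' \<omega> (xs n)) \<longlonglongrightarrow> G f \<omega>" "(\<lambda>n. \<rho>' \<omega> (xs n)) \<longlonglongrightarrow> \<rho>' \<omega> (f (\<phi> \<omega>))"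
        using tendsto_dist_iff by blast+
      then show ?case using LIMSEQ_unique by blast
    qed
  qed
  \<comment> \<open>Each constant with value in \<open>D\<close> is, up to a null set,
    \<open>G\<close> applied to some function; hence almost every range contains
    \<open>D\<close>.\<close>
  have surj: "AE \<omega> in M. surj (\<rho>' \<omega>)"
  proof -
    have "AE \<omega> in M. x \<in> range (\<rho>' \<omega>)" for x
      using formula[OF inv.G_L2[OF cL[of x]]] GH[OF cL[of x]] by eventually_elim (metis rangeI)
    then have "AE \<omega> in M. \<forall>x\<in>D. x \<in> range (\<rho>' \<omega>)" using D(1) by (simp add: AE_ball_countable)
    then show ?thesis
      using \<rho>' \<phi>.AE_comp[OF r0]
    proof eventually_elim
      case (elim \<omega>)
      then show ?case by (intro dilation_surj[OF elim(3) _ D(2)]) auto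
    qed
  qed
  \<comment> \<open>\<open>\<rho>'\<close> is indexed by points of the image side; composed with
    \<open>\<psi>\<close> it returns, for almost every \<open>\<omega>\<close>, when evaluated at
    \<open>\<phi> \<omega>\<close>.\<close>
  define \<rho> where "\<rho> \<omega> = \<rho>' (\<psi> \<omega>)" for \<omega>
  obtain x0 where x0: "x0 \<in> D" using D(2) by (metis closure_empty UNIV_not_empty all_not_in_conv)
  have L2x: "\<exists>x. \<exists>g\<in>L2_fun (distr M M \<phi>). AE \<omega> in M. \<rho> \<omega> x = g \<omega>"
  proof (intro exI bexI)
    \<comment> \<open>Its integrability against the image measure is that of \<open>G\<close> of a
      constant against \<open>M\<close>.\<close>
    define g where "g \<omega> = k (\<psi> \<omega>) x0" for \<omega>
    have km: "(\<lambda>\<omega>. k \<omega> x0) \<in> borel_measurable M" unfolding k_def using G_L2[OF cL] by (rule L2_fun_measurable)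
    have gm [measurable]: "g \<in> borel_measurable M" unfolding g_def using measurable_compose[OF \<psi>(1) km] .
    have "integrable M (\<lambda>\<omega>. (dist (k \<omega> x0) x0)\<^sup>2)"
      unfolding k_def by (rule L2_fun_integrable_dist_const[OF finM G_L2[OF cL]])
    then have "integrable M (\<lambda>\<omega>. (dist (g (\<phi> \<omega>)) x0)\<^sup>2)"
    proof (rule integrable_cong_AE_imp)
      show "(\<lambda>\<omega>. (dist (g (\<phi> \<omega>)) x0)\<^sup>2) \<in> borel_measurable M"
        using measurable_compose[OF \<phi>(1) gm] by measurable
      show "AE \<omega> in M. (dist (k \<omega> x0) x0)\<^sup>2 = (dist (g (\<phi> \<omega>)) x0)\<^sup>2" using \<psi>\<phi> by eventually_elim (simp add: g_def)
    qed
    then have "integrable (distr M M \<phi>) (\<lambda>\<omega>. (dist (g \<omega>) x0)\<^sup>2)"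
      by (subst integrable_distr_eq[OF \<phi>(1)]) auto
    then show "g \<in> L2_fun (distr M M \<phi>)" by (auto simp: L2_fun_iff)
    show "AE \<omega> in M. \<rho> \<omega> x0 = g \<omega>"
      using \<psi>.AE_comp[OF \<rho>'] by eventually_elim (use x0 in \<open>auto simp: \<rho>_def g_def\<close>)
  qed
  show ?thesis
  proof (intro exI[of _ \<phi>] exI[of _ \<rho>] conjI)
    show "ae_bijective M \<phi>" by (rule ae_bijectiveI[OF \<phi>(1) \<psi>(1) \<phi>(2) \<psi>(2) \<psi>\<phi> \<phi>\<psi>])
    show "AE \<omega> in M. \<rho> \<omega> \<in> Dil (inverse (sqrt (enn2real (RN_deriv M (distr M M \<phi>) \<omega>)))) \<and> surj (\<rho> \<omega>)"
      using \<psi>.AE_comp[OF \<rho>'] \<psi>.AE_comp[OF surj] \<phi>\<psi> r0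
    proof eventually_elim
      case (elim \<omega>)
      then show ?case by (simp add: \<rho>_def Dil_iff[OF gs] r_def \<phi>.dens_def)
    qed
    show "\<exists>x. \<exists>g\<in>L2_fun (distr M M \<phi>). AE \<omega> in M. \<rho> \<omega> x = g \<omega>" by (rule L2x)
    show "\<forall>f\<in>L2_fun M. AE \<omega> in M. G f \<omega> = \<rho> (\<phi> \<omega>) (f (\<phi> \<omega>))"
    proof
      fix f :: "'a \<Rightarrow> 'x" assume "f \<in> L2_fun M"
      from formula[OF this] \<psi>\<phi> show "AE \<omega> in M. G f \<omega> = \<rho> (\<phi> \<omega>) (f (\<phi> \<omega>))"
        by eventually_elim (simp add: \<rho>_def)
    qed
  qed (rule \<phi>(1), rule \<phi>.quasi_invariant)
qed

end

section \<open>The converse: measurability of the inverse point map\<close>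

lemma co_null_measurable_subset:
  assumes "AE \<omega> in M. P \<omega>"
  shows "\<exists>Q\<in>sets M. (AE \<omega> in M. \<omega> \<in> Q) \<and> (\<forall>\<omega>\<in>Q. P \<omega>)"
proof -
  obtain N where N: "N \<in> null_sets M" "{\<omega> \<in> space M. \<not> P \<omega>} \<subseteq> N"
    using assms unfolding eventually_ae_filter by auto
  have "AE \<omega> in M. \<omega> \<in> space M - N" using AE_not_in[OF N(1)] AE_space by eventually_elim auto
  then show ?thesis using N by (intro bexI[of _ "space M - N"]) auto
qed

text \<open>Membership in an open set is decided by countably many balls with centres in
  \<open>D\<close> and rational radii. This makes maps measurable that come from an arbitrary
  choice.\<close>

lemma AE_eq_measurable_if_dist:
  fixes k :: "'a \<Rightarrow> 'x::{metric_space, second_countable_topology}"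
  assumes D: "countable D" "closure D = UNIV"
    and v: "\<And>y. y \<in> D \<Longrightarrow> v y \<in> borel_measurable M" "\<And>y. y \<in> D \<Longrightarrow> AE \<omega> in M. dist (k \<omega>) y = v y \<omega>"
  obtains k' where "k' \<in> borel_measurable M" "AE \<omega> in M. k \<omega> = k' \<omega>"
proof -
  have "AE \<omega> in M. \<forall>y\<in>D. dist (k \<omega>) y = v y \<omega>" using D(1) v(2) by (simp add: AE_ball_countable)
  then obtain Q where Q: "Q \<in> sets M" "AE \<omega> in M. \<omega> \<in> Q" "\<And>\<omega> y. \<omega> \<in> Q \<Longrightarrow> y \<in> D \<Longrightarrow> dist (k \<omega>) y = v y \<omega>"
    using co_null_measurable_subset[of "\<lambda>\<omega>. \<forall>y\<in>D. dist (k \<omega>) y = v y \<omega>" M] by blast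
  have QM: "Q \<subseteq> space M" using sets.sets_into_space[OF Q(1)] .
  fix x0 :: 'x
  define k' where "k' \<omega> = (if \<omega> \<in> Q then k \<omega> else x0)" for \<omega>
  have "k' \<in> borel_measurable M"
  proof (rule borel_measurableI)
    fix U :: "'x set" assume U: "open U"
    define I where "I = {(y, q). y \<in> D \<and> q \<in> \<rat> \<and> ball y q \<subseteq> U}"
    have "countable I"
      using D(1) countable_rat by (intro countable_subset[of I "D \<times> \<rat>"]) (auto simp: I_def)
    have UI: "x \<in> U \<longleftrightarrow> (\<exists>(y, q)\<in>I. dist x y < q)" for x
    proof
      assume "x \<in> U"
      then obtain \<epsilon> where \<epsilon>: "0 < \<epsilon>" "ball x \<epsilon> \<subseteq> U" using U open_contains_ball by blast
      obtain q where q: "q \<in> \<rat>" "\<epsilon> / 4 < q" "q < \<epsilon> / 2" using Rats_dense_in_real[of "\<epsilon> / 4" "\<epsilon> / 2"] \<epsilon> by auto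
      have "0 < \<epsilon> / 4" using \<epsilon> by simp
      then obtain y where y: "y \<in> D" "dist y x < \<epsilon> / 4" using D(2) closure_approachable[of x D] by (metis UNIV_I)
      have "ball y q \<subseteq> U"
      proof
        fix z assume "z \<in> ball y q"
        then have "dist x z < \<epsilon>" using y q dist_triangle[of x z y] by (simp add: dist_commute)
        then show "z \<in> U" using \<epsilon> by auto
      qed
      then have "(y, q) \<in> I" using y q by (simp add: I_def)
      moreover have "dist x y < q" using y q by (simp add: dist_commute)
      ultimately show "\<exists>(y, q)\<in>I. dist x y < q" by blast
    qed (auto simp: I_def dist_commute)
    define V where "V p = {\<omega> \<in> space M. v (fst p) \<omega> < snd p} \<inter> Q" for p
    have kU: "k \<omega> \<in> U \<longleftrightarrow> (\<exists>p\<in>I. v (fst p) \<omega> < snd p)" if "\<omega> \<in> Q" for \<omega>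
      unfolding UI using Q(3)[OF that] by (intro bex_cong refl) (auto simp: I_def)
    have "k' -` U \<inter> space M = (\<Union>p\<in>I. V p) \<union> (if x0 \<in> U then space M - Q else {})"
    proof (rule set_eqI)
      fix \<omega>
      show "\<omega> \<in> k' -` U \<inter> space M \<longleftrightarrow> \<omega> \<in> (\<Union>p\<in>I. V p) \<union> (if x0 \<in> U then space M - Q else {})"
      proof (cases "\<omega> \<in> Q")
        case True
        then show ?thesis using QM kU[OF True] by (auto simp: k'_def V_def)
      next
        case False
        then show ?thesis by (auto simp: k'_def V_def)
      qed
    qed
    moreover have "(\<Union>p\<in>I. V p) \<in> sets M"
    proof (rule sets.countable_UN''[OF \<open>countable I\<close>])
      fix p assume "p \<in> I"
      then have [measurable]: "v (fst p) \<in> borel_measurable M" "Q \<in> sets M" using v(1) Q by (auto simp: I_def)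
      show "V p \<in> sets M" unfolding V_def by measurable
    qed
    moreover have "(if x0 \<in> U then space M - Q else {}) \<in> sets M" using Q(1) by simp
    ultimately show "k' -` U \<inter> space M \<in> sets M" by (simp only: sets.Un)
  qed
  moreover have "AE \<omega> in M. k \<omega> = k' \<omega>" using Q(2) by eventually_elim (simp add: k'_def)
  ultimately show ?thesis by (rule that)
qed

text \<open>
  The graph of an injective Borel map is exhausted, up to a null set, by compact sets, and both
  projections map these to compact sets. This replaces the Lusin--Souslin theorem.
\<close>

lemma ae_injective_image:
  fixes e :: "'a \<Rightarrow> real" and t' :: "real \<Rightarrow> real" and P :: "real set"
  assumes fin: "finite_measure M" and e [measurable]: "e \<in> borel_measurable M"
    and t [measurable]: "t' \<in> borel_measurable borel" and P [measurable]: "P \<in> sets borel"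
  obtains A' where "A' \<in> sets borel" "A' \<subseteq> t' ` P" "AE \<omega> in M. e \<omega> \<in> P \<longrightarrow> t' (e \<omega>) \<in> A'"
proof -
  interpret finite_measure M by fact
  define \<Gamma> where "\<Gamma> = {p :: real \<times> real. fst p \<in> P \<and> snd p = t' (fst p)}"
  define \<kappa> where "\<kappa> \<omega> = (e \<omega>, t' (e \<omega>))" for \<omega>
  have \<kappa>: "\<kappa> \<in> borel_measurable M" unfolding \<kappa>_def by measurable
  have "{p \<in> space (borel \<Otimes>\<^sub>M borel). fst p \<in> P \<and> snd p = t' (fst p)} \<in> sets (borel \<Otimes>\<^sub>M (borel :: real measure))"
    by measurable
  then have \<Gamma>s: "\<Gamma> \<in> sets borel" unfolding borel_prod by (simp add: \<Gamma>_def)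
  define \<nu> where "\<nu> = distr M borel \<kappa>"
  have s\<nu>: "sets \<nu> = sets borel" by (simp add: \<nu>_def)
  interpret \<nu>: finite_measure \<nu> unfolding \<nu>_def by (rule finite_measure_distr[OF \<kappa>])
  have ir: "emeasure \<nu> \<Gamma> = (SUP K\<in>{K. K \<subseteq> \<Gamma> \<and> compact K}. emeasure \<nu> K)"
    by (rule inner_regular[OF s\<nu> _ \<Gamma>s]) (simp add: \<nu>.emeasure_eq_measure)
  have ne: "{K. K \<subseteq> \<Gamma> \<and> compact K} \<noteq> {}" by (auto intro!: exI[of _ "{}"])
  have "\<exists>K. K \<subseteq> \<Gamma> \<and> compact K \<and> emeasure \<nu> \<Gamma> < emeasure \<nu> K + ennreal (1 / (real n + 1))" for n
    using SUP_approx_ennreal[OF _ ne ir, of "1 / (real n + 1)"] \<nu>.emeasure_finite by auto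
  then obtain K where K: "\<And>n. K n \<subseteq> \<Gamma>" "\<And>n. compact (K n)" "\<And>n. emeasure \<nu> \<Gamma> < emeasure \<nu> (K n) + ennreal (1 / (real n + 1))"
    by metis
  have Ks: "K n \<in> sets borel" for n using K(2) by (simp add: compact_imp_closed)
  have "measure \<nu> (\<Gamma> - (\<Union>n. K n)) \<le> 1 / (real n + 1)" for n
  proof -
    have "measure \<nu> \<Gamma> < measure \<nu> (K n) + 1 / (real n + 1)"
    proof -
      have "ennreal (measure \<nu> \<Gamma>) < ennreal (measure \<nu> (K n) + 1 / (real n + 1))"
        using K(3)[of n] by (simp add: \<nu>.emeasure_eq_measure)
      then show ?thesis by (subst (asm) ennreal_less_iff) (rule measure_nonneg)
    qed
    moreover have "measure \<nu> (\<Gamma> - K n) = measure \<nu> \<Gamma> - measure \<nu> (K n)"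
      using K(1) Ks \<Gamma>s by (intro \<nu>.finite_measure_Diff) (auto simp: s\<nu>)
    moreover have "measure \<nu> (\<Gamma> - (\<Union>n. K n)) \<le> measure \<nu> (\<Gamma> - K n)"
      using Ks \<Gamma>s by (intro \<nu>.finite_measure_mono) (auto simp: s\<nu>)
    ultimately show ?thesis by simp
  qed
  then have "measure \<nu> (\<Gamma> - (\<Union>n. K n)) \<le> 0"
    using LIMSEQ_le_const[OF LIMSEQ_inverse_real_of_nat, of "measure \<nu> (\<Gamma> - (\<Union>n. K n))"]
    by (auto simp: inverse_eq_divide add.commute)
  then have "measure \<nu> (\<Gamma> - (\<Union>n. K n)) = 0" by (simp add: measure_le_0_iff)
  then have "\<Gamma> - (\<Union>n. K n) \<in> null_sets \<nu>"
    using \<Gamma>s Ks by (intro null_setsI) (auto simp: \<nu>.emeasure_eq_measure s\<nu>)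
  then have "AE p in distr M borel \<kappa>. p \<notin> \<Gamma> - (\<Union>n. K n)" unfolding \<nu>_def by (rule AE_not_in)
  then have AE\<kappa>: "AE \<omega> in M. \<kappa> \<omega> \<notin> \<Gamma> - (\<Union>n. K n)" by (rule AE_distrD[OF \<kappa>])
  \<comment> \<open>The full image of \<open>P\<close> is only known to be analytic. The projected
    compact sets form a sigma-compact part of it that is missed with probability 0.\<close>
  define A' where "A' = (\<Union>n. snd ` K n)"
  show ?thesis
  proof (rule that[of A'])
    have "compact (snd ` K n)" for n by (intro compact_continuous_image continuous_intros K(2))
    then have "snd ` K n \<in> sets borel" for n by (simp add: compact_imp_closed)
    then show "A' \<in> sets borel" unfolding A'_def by auto
    show "A' \<subseteq> t' ` P" using K(1) by (fastforce simp: A'_def \<Gamma>_def)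
    show "AE \<omega> in M. e \<omega> \<in> P \<longrightarrow> t' (e \<omega>) \<in> A'"
      using AE\<kappa>
    proof eventually_elim
      case (elim \<omega>)
      show ?case
      proof
        assume "e \<omega> \<in> P"
        then have "\<kappa> \<omega> \<in> \<Gamma>" by (simp add: \<kappa>_def \<Gamma>_def)
        then obtain n where "\<kappa> \<omega> \<in> K n" using elim by blast
        then have "snd (\<kappa> \<omega>) \<in> A'" unfolding A'_def by blast
        then show "t' (e \<omega>) \<in> A'" by (simp add: \<kappa>_def)
      qed
    qed
  qed
qed

locale ae_bijection = nonsingular_map M \<phi> + standard_coordinates M e j \<Omega> R
  for M :: "'a measure" and \<phi> e j \<Omega> R +
  assumes bijective: "ae_bijective M \<phi>"
begin

lemma sets_e_AE:
  assumes "A \<in> sets M"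
  shows "\<exists>C\<in>sets borel. AE \<omega> in M. \<omega> \<in> A \<longleftrightarrow> e \<omega> \<in> C"
proof -
  obtain C Z where C: "C \<in> sets borel" "AE \<omega> in M. e \<omega> \<notin> Z" and CZ: "\<forall>\<omega>\<in>\<Omega>. e \<omega> \<notin> Z \<longrightarrow> (\<omega> \<in> A \<longleftrightarrow> e \<omega> \<in> C)"
    using sets_e[OF assms] by blast
  have "AE \<omega> in M. \<omega> \<in> A \<longleftrightarrow> e \<omega> \<in> C" using C(2) AE_\<Omega> by eventually_elim (use CZ in blast)
  then show ?thesis using C(1) by blast
qed

text \<open>In effect the inverse of \<open>\<phi>\<close> is measurable up to null sets. In
  coordinates \<open>\<phi>\<close> is a Borel function \<open>t\<close>, injective on a Borel set
  of full measure, and images under it can be replaced by Borel sets.\<close>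

lemma sets_pullback:
  assumes B: "B \<in> sets M"
  shows "\<exists>A\<in>sets M. AE \<omega> in M. \<omega> \<in> B \<longleftrightarrow> \<phi> \<omega> \<in> A"
proof -
  obtain N1 N2 where N1: "N1 \<in> null_sets M" and bij: "bij_betw \<phi> (space M - N1) (space M - N2)"
    using bijective unfolding ae_bijective_def by blast
  have inj: "inj_on \<phi> (space M - N1)" using bij by (simp add: bij_betw_def)
  have e\<phi>m: "(\<lambda>\<omega>. e (\<phi> \<omega>)) \<in> borel_measurable M" using measurable_compose[OF \<phi>_measurable e_measurable] .
  obtain t where t: "t \<in> borel_measurable borel" "AE \<omega> in M. e (\<phi> \<omega>) = t (e \<omega>)"
    using factor_through[OF e_measurable e\<phi>m sets_e_AE] by blast
  have "AE \<omega> in M. \<omega> \<in> \<Omega> \<and> \<omega> \<in> space M - N1 \<and> \<phi> \<omega> \<in> \<Omega> \<and> e (\<phi> \<omega>) = t (e \<omega>)"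
    using AE_\<Omega> AE_not_in[OF N1] AE_space AE_comp[OF AE_\<Omega>] t(2) by eventually_elim simp
  then obtain Q where Q: "Q \<in> sets M" "AE \<omega> in M. \<omega> \<in> Q"
    "\<And>\<omega>. \<omega> \<in> Q \<Longrightarrow> \<omega> \<in> \<Omega> \<and> \<omega> \<in> space M - N1 \<and> \<phi> \<omega> \<in> \<Omega> \<and> e (\<phi> \<omega>) = t (e \<omega>)"
    using co_null_measurable_subset[of "\<lambda>\<omega>. \<omega> \<in> \<Omega> \<and> \<omega> \<in> space M - N1 \<and> \<phi> \<omega> \<in> \<Omega> \<and> e (\<phi> \<omega>) = t (e \<omega>)" M] by blast
  obtain C Z where C: "C \<in> sets borel" "Z \<in> sets borel" "AE \<omega> in M. e \<omega> \<notin> Z"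
    and CZ: "\<forall>\<omega>\<in>\<Omega>. e \<omega> \<notin> Z \<longrightarrow> (\<omega> \<in> Q \<longleftrightarrow> e \<omega> \<in> C)"
    using sets_e[OF Q(1)] by blast
  \<comment> \<open>Coordinates of good points: \<open>j\<close> maps \<open>R'\<close> into
    \<open>Q\<close>, where \<open>\<phi>\<close> is injective and given by \<open>t\<close>.
    Removing \<open>Z\<close> is necessary because \<open>Q\<close> is described by the Borel set
    \<open>C\<close> only off \<open>Z\<close>.\<close>
  define R' where "R' = R \<inter> C - Z"
  have R's: "R' \<in> sets borel" using C R_sets by (simp add: R'_def)
  have jR': "j r \<in> Q" "e (j r) = r" if "r \<in> R'" for r
    using that CZ[rule_format, of "j r"] j_\<Omega>[of r] e_j[of r] by (auto simp: R'_def)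
  have tinj: "r = s" if r: "r \<in> R'" "s \<in> R'" "t r = t s" for r s
  proof -
    have "e (\<phi> (j r)) = e (\<phi> (j s))" using Q(3) jR' r by metis
    then have "\<phi> (j r) = \<phi> (j s)" using Q(3)[OF jR'(1)[OF r(1)]] Q(3)[OF jR'(1)[OF r(2)]] j_e by metis
    then have "j r = j s" using inj Q(3)[OF jR'(1)[OF r(1)]] Q(3)[OF jR'(1)[OF r(2)]] by (auto dest: inj_onD)
    then show ?thesis using jR' r by metis
  qed
  have eR': "AE \<omega> in M. e \<omega> \<in> R'"
    using AE_\<Omega> Q(2) C(3) by eventually_elim (use CZ e_R in \<open>auto simp: R'_def\<close>)
  obtain CB where CB: "CB \<in> sets borel" "AE \<omega> in M. \<omega> \<in> B \<longleftrightarrow> e \<omega> \<in> CB" using sets_e_AE[OF B] by blast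
  have P: "CB \<inter> R' \<in> sets borel" using CB R's by simp
  obtain A' where A': "A' \<in> sets borel" "A' \<subseteq> t ` (CB \<inter> R')" "AE \<omega> in M. e \<omega> \<in> CB \<inter> R' \<longrightarrow> t (e \<omega>) \<in> A'"
    by (rule ae_injective_image[OF finite_measure_axioms e_measurable t(1) P])
  define A where "A = e -` A' \<inter> space M"
  have "A \<in> sets M" unfolding A_def by (rule measurable_sets[OF e_measurable A'(1)])
  moreover have "AE \<omega> in M. \<omega> \<in> B \<longleftrightarrow> \<phi> \<omega> \<in> A"
    using AE_space A'(3) CB(2) eR' t(2)
  proof eventually_elim
    case (elim \<omega>)
    have "\<phi> \<omega> \<in> A \<longleftrightarrow> t (e \<omega>) \<in> A'" using measurable_space[OF \<phi>_measurable elim(1)] elim(5) by (simp add: A_def)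
    \<comment> \<open>Injectivity on \<open>R'\<close> excludes that \<open>t (e \<omega>)\<close>
      is also the value at a coordinate outside \<open>CB\<close>.\<close>
    moreover have "e \<omega> \<in> CB" if tA: "t (e \<omega>) \<in> A'"
    proof -
      obtain r where "r \<in> CB" "r \<in> R'" "t (e \<omega>) = t r" using subsetD[OF A'(2) tA] by blast
      then show ?thesis using tinj elim(4) by metis
    qed
    ultimately show ?case using elim by blast
  qed
  ultimately show ?thesis by blast
qed

text \<open>Since every set is a preimage under \<open>\<phi>\<close> up to a null set, the
  coordinate \<open>e\<close> factors through \<open>\<phi>\<close>; the factor is the coordinate of
  the inverse.\<close>

lemma left_inverse: "\<exists>\<psi>\<in>measurable M M. AE \<omega> in M. \<psi> (\<phi> \<omega>) = \<omega>"
proof -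
  obtain S where S: "S \<in> borel_measurable M" "AE \<omega> in M. e \<omega> = S (\<phi> \<omega>)"
    using factor_through[OF \<phi>_measurable e_measurable sets_pullback] by blast
  \<comment> \<open>\<open>S\<close> is controlled only at values of \<open>\<phi>\<close>, that is,
    almost everywhere for the image measure; absolute continuity of \<open>M\<close> carries this
    over to \<open>M\<close>.\<close>
  have ns: "AE \<omega> in M. S \<omega> \<notin> C" if C: "C \<in> sets borel" "AE \<omega> in M. e \<omega> \<notin> C" for C
  proof -
    have "{\<omega> \<in> space M. S \<omega> \<notin> C} = space M - (S -` C \<inter> space M)" by auto
    also have "\<dots> \<in> sets M" using measurable_sets[OF S(1) C(1)] by blast
    finally have s: "{\<omega> \<in> space M. S \<omega> \<notin> C} \<in> sets M" .
    have "AE \<omega> in M. S (\<phi> \<omega>) \<notin> C" using C(2) S(2) by eventually_elim simp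
    then have "AE \<omega> in distr M M \<phi>. S \<omega> \<notin> C" using AE_distr_iff[OF \<phi>_measurable s] by simp
    then show ?thesis using absolutely_continuous_AE[OF _ ac(2)] by simp
  qed
  define \<psi> where "\<psi> \<omega> = (if \<omega> \<in> \<Omega> then j (S \<omega>) else j 0)" for \<omega>
  have "\<psi> \<in> measurable M M" unfolding \<psi>_def by (rule lift_measurable[OF S(1) ns])
  moreover have "AE \<omega> in M. \<psi> (\<phi> \<omega>) = \<omega>"
    using AE_\<Omega> AE_comp[OF AE_\<Omega>] S(2)
  proof eventually_elim
    case (elim \<omega>)
    then show ?case using j_e[of \<omega>] by (simp add: \<psi>_def)
  qed
  ultimately show ?thesis by blast
qed

section \<open>Maps of functions given by dilations of the fibres\<close>

context
  fixes \<rho> :: "'a \<Rightarrow> 'x::polish_space \<Rightarrow> 'x" and G :: "('a \<Rightarrow> 'x) \<Rightarrow> 'a \<Rightarrow> 'x"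
  assumes gs: "geodesic_space (UNIV :: 'x set) dist"
    and \<rho>: "AE \<omega> in M. \<rho> \<omega> \<in> Dil (inverse (sqrt (dens \<omega>))) \<and> surj (\<rho> \<omega>)"
    and G: "\<And>f. f \<in> L2_fun M \<Longrightarrow> G f \<in> L2_fun M"
      "\<And>f. f \<in> L2_fun M \<Longrightarrow> AE \<omega> in M. G f \<omega> = \<rho> (\<phi> \<omega>) (f (\<phi> \<omega>))"
begin

lemma \<rho>_dist: "AE \<omega> in M. \<forall>x y. (dist (\<rho> (\<phi> \<omega>) x) (\<rho> (\<phi> \<omega>) y))\<^sup>2 = (dist x y)\<^sup>2 / dens (\<phi> \<omega>)"
  using AE_comp[OF \<rho>] AE_comp[OF dens_pos]
proof eventually_elim
  case (elim \<omega>)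
  then have d: "dist (\<rho> (\<phi> \<omega>) x) (\<rho> (\<phi> \<omega>) y) = inverse (sqrt (dens (\<phi> \<omega>))) * dist x y" for x y
    using Dil_iff[OF gs] by blast
  have s: "(inverse (sqrt (dens (\<phi> \<omega>))))\<^sup>2 = inverse (dens (\<phi> \<omega>))"
    using elim(2) by (simp only: power_inverse) simp
  show ?case unfolding d power_mult_distrib s by (simp add: divide_inverse)
qed

lemma isometric:
  assumes L2: "f \<in> L2_fun M" "g \<in> L2_fun M"
  shows "(LINT \<omega>|M. (dist (G f \<omega>) (G g \<omega>))\<^sup>2) = (LINT \<omega>|M. (dist (f \<omega>) (g \<omega>))\<^sup>2)"
proof -
  note [measurable] = \<phi>_measurable
  have [measurable]: "f \<in> borel_measurable M" "g \<in> borel_measurable M" "G f \<in> borel_measurable M" "G g \<in> borel_measurable M"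
    using L2 G L2_fun_measurable by blast+
  have "(LINT \<omega>|M. (dist (f \<omega>) (g \<omega>))\<^sup>2) = (LINT \<omega>|M. (dist (f (\<phi> \<omega>)) (g (\<phi> \<omega>)))\<^sup>2 / dens (\<phi> \<omega>))"
    by (rule change_of_variables(1)) measurable
  also have "\<dots> = (LINT \<omega>|M. (dist (G f \<omega>) (G g \<omega>))\<^sup>2)"
  proof (rule integral_cong_AE)
    show "AE \<omega> in M. (dist (f (\<phi> \<omega>)) (g (\<phi> \<omega>)))\<^sup>2 / dens (\<phi> \<omega>) = (dist (G f \<omega>) (G g \<omega>))\<^sup>2"
      using \<rho>_dist G(2)[OF L2(1)] G(2)[OF L2(2)] by eventually_elim simp
  qed measurable
  finally show ?thesis by simp
qed

text \<open>The family \<open>\<rho>\<close> has no measurability of its own; the images of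
  constants under \<open>G\<close> supply it. A preimage \<open>k\<close> is chosen pointwise, and
  its distance to \<open>y\<close> is determined by that of \<open>g\<close> to the image of the
  constant \<open>y\<close>, which is measurable.\<close>

lemma surjective:
  assumes g: "g \<in> L2_fun M"
  shows "\<exists>f\<in>L2_fun M. AE \<omega> in M. G f \<omega> = g \<omega>"
proof -
  note [measurable] = \<phi>_measurable
  have [measurable]: "g \<in> borel_measurable M" by (rule L2_fun_measurable[OF g])
  have cL: "(\<lambda>_. x) \<in> L2_fun M" for x :: 'x by (rule L2_fun_const[OF finite_measure_axioms])
  have [measurable]: "G (\<lambda>_. x) \<in> borel_measurable M" for x using G(1)[OF cL] by (rule L2_fun_measurable)
  obtain D :: "'x set" where D: "countable D" "closure D = UNIV" by (rule countable_dense_exists_closure)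
  define k where "k \<omega> = (SOME z. \<rho> (\<phi> \<omega>) z = g \<omega>)" for \<omega>
  have k: "AE \<omega> in M. \<rho> (\<phi> \<omega>) (k \<omega>) = g \<omega>"
    using AE_comp[OF \<rho>]
  proof eventually_elim
    case (elim \<omega>)
    then have "\<exists>z. \<rho> (\<phi> \<omega>) z = g \<omega>" by (metis surjD)
    then show ?case unfolding k_def by (rule someI_ex)
  qed
  have kd: "AE \<omega> in M. (dist (g \<omega>) (G (\<lambda>_. y) \<omega>))\<^sup>2 = (dist (k \<omega>) y)\<^sup>2 / dens (\<phi> \<omega>)" for y
    using k \<rho>_dist G(2)[OF cL[of y]] by eventually_elim metis
  define v where "v y \<omega> = sqrt ((dist (g \<omega>) (G (\<lambda>_. y) \<omega>))\<^sup>2 * dens (\<phi> \<omega>))" for y \<omega>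
  have v: "v y \<in> borel_measurable M" for y unfolding v_def by measurable
  have vd: "AE \<omega> in M. dist (k \<omega>) y = v y \<omega>" for y
    using kd[of y] AE_comp[OF dens_pos] by eventually_elim (simp add: v_def)
  obtain k' where k' [measurable]: "k' \<in> borel_measurable M" and kk': "AE \<omega> in M. k \<omega> = k' \<omega>"
    by (rule AE_eq_measurable_if_dist[OF D v vd])
  obtain \<psi> where \<psi> [measurable]: "\<psi> \<in> measurable M M" and \<psi>\<phi>: "AE \<omega> in M. \<psi> (\<phi> \<omega>) = \<omega>" using left_inverse by blast
  \<comment> \<open>\<open>k'\<close> lives on the image side of \<open>\<phi>\<close> and is
    carried back by the left inverse.\<close>
  define f where "f \<omega> = k' (\<psi> \<omega>)" for \<omega>
  have fm [measurable]: "f \<in> borel_measurable M" unfolding f_def by measurable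
  have f\<phi>: "AE \<omega> in M. f (\<phi> \<omega>) = k \<omega>" using \<psi>\<phi> kk' by eventually_elim (simp add: f_def)
  fix x :: 'x
  have "integrable M (\<lambda>\<omega>. (dist (g \<omega>) (G (\<lambda>_. x) \<omega>))\<^sup>2)"
    by (rule L2_fun_integrable_dist[OF finite_measure_axioms g G(1)[OF cL]])
  then have "integrable M (\<lambda>\<omega>. (dist (f (\<phi> \<omega>)) x)\<^sup>2 / dens (\<phi> \<omega>))"
  proof (rule integrable_cong_AE_imp)
    show "AE \<omega> in M. (dist (g \<omega>) (G (\<lambda>_. x) \<omega>))\<^sup>2 = (dist (f (\<phi> \<omega>)) x)\<^sup>2 / dens (\<phi> \<omega>)"
      using kd[of x] f\<phi> by eventually_elim simp
  qed measurable
  then have "integrable M (\<lambda>\<omega>. (dist (f \<omega>) x)\<^sup>2)"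
    using change_of_variables(2)[of "\<lambda>\<omega>. (dist (f \<omega>) x)\<^sup>2"] by simp
  then have fL: "f \<in> L2_fun M" using fm L2_fun_iff by blast
  have "AE \<omega> in M. G f \<omega> = g \<omega>" using G(2)[OF fL] f\<phi> k by eventually_elim simp
  then show ?thesis using fL by blast
qed

end

end

section \<open>From classes to representatives\<close>

lemma equiv_ae_eq: "equiv (L2_fun M) (ae_eq M :: (('a \<Rightarrow> 'x::polish_space) \<times> _) set)"
proof (rule equivI)
  show "trans (ae_eq M :: (('a \<Rightarrow> 'x) \<times> _) set)"
  proof (rule transI)
    fix f g h :: "'a \<Rightarrow> 'x" assume "(f, g) \<in> ae_eq M" "(g, h) \<in> ae_eq M"
    moreover from this have "AE \<omega> in M. f \<omega> = h \<omega>" unfolding ae_eq_def by (auto elim: eventually_elim2)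
    ultimately show "(f, h) \<in> ae_eq M" by (simp add: ae_eq_def)
  qed
  show "sym (ae_eq M :: (('a \<Rightarrow> 'x) \<times> _) set)" by (rule symI) (auto simp: ae_eq_def eq_commute)
qed (auto simp: ae_eq_def refl_on_def)

definition L2_class :: "'a measure \<Rightarrow> ('a \<Rightarrow> 'x::polish_space) \<Rightarrow> ('a \<Rightarrow> 'x) set" where
  "L2_class M f = ae_eq M `` {f}"

lemma mem_L2_class_iff: "g \<in> L2_class M f \<longleftrightarrow> f \<in> L2_fun M \<and> g \<in> L2_fun M \<and> (AE \<omega> in M. f \<omega> = g \<omega>)"
  by (simp add: L2_class_def ae_eq_def)

lemma L2_class_in_L2: "f \<in> L2_fun M \<Longrightarrow> L2_class M f \<in> L2 M"
  unfolding L2_class_def L2_def by (rule quotientI)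

lemma L2_class_self: "f \<in> L2_fun M \<Longrightarrow> f \<in> L2_class M f"
  by (simp add: mem_L2_class_iff)

lemma mem_L2_D:
  assumes "F \<in> L2 M" "f \<in> F"
  shows "f \<in> L2_fun M" "F = L2_class M f"
proof -
  obtain g where g: "F = ae_eq M `` {g}" "g \<in> L2_fun M" using assms(1) unfolding L2_def by (rule quotientE)
  then have "(g, f) \<in> ae_eq M" using assms(2) by blast
  then show "f \<in> L2_fun M" "F = L2_class M f"
    using g equiv_class_eq[OF equiv_ae_eq] by (auto simp: L2_class_def ae_eq_def)
qed

lemma L2_nonempty: "F \<in> L2 M \<Longrightarrow> \<exists>f. f \<in> F" for F :: "('a \<Rightarrow> 'x::polish_space) set"
  unfolding L2_def using in_quotient_imp_non_empty[OF equiv_ae_eq] by blast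

lemma L2_class_eq_iff:
  assumes "f \<in> L2_fun M"
  shows "L2_class M f = L2_class M g \<longleftrightarrow> g \<in> L2_class M f"
proof
  assume "L2_class M f = L2_class M g"
  then have "f \<in> L2_class M g" using L2_class_self[OF assms] by simp
  then show "g \<in> L2_class M f" by (auto simp: mem_L2_class_iff eq_commute)
next
  assume "g \<in> L2_class M f"
  then show "L2_class M f = L2_class M g" by (rule mem_L2_D(2)[OF L2_class_in_L2[OF assms]])
qed

lemma L2_dist_eq:
  fixes f g :: "'a \<Rightarrow> 'x::polish_space"
  assumes F: "F \<in> L2 M" "f \<in> F" and K: "K \<in> L2 M" "g \<in> K"
  shows "L2_dist M F K = sqrt (LINT \<omega>|M. (dist (f \<omega>) (g \<omega>))\<^sup>2)"
proof -
  have f': "(SOME f. f \<in> F) \<in> F" "(SOME g. g \<in> K) \<in> K"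
    using someI[of "\<lambda>f. f \<in> F", OF F(2)] someI[of "\<lambda>g. g \<in> K", OF K(2)] by auto
  have AE: "AE \<omega> in M. (SOME f. f \<in> F) \<omega> = f \<omega>" "AE \<omega> in M. (SOME g. g \<in> K) \<omega> = g \<omega>"
    using f' mem_L2_D[OF F] mem_L2_D[OF K] by (auto simp: mem_L2_class_iff eq_commute)
  have [measurable]: "f \<in> borel_measurable M" "g \<in> borel_measurable M"
    "(SOME f. f \<in> F) \<in> borel_measurable M" "(SOME g. g \<in> K) \<in> borel_measurable M"
    using mem_L2_D(1)[OF F] mem_L2_D(1)[OF K] mem_L2_D(1)[OF F(1) f'(1)] mem_L2_D(1)[OF K(1) f'(2)] L2_fun_measurable by blast+
  have "(LINT \<omega>|M. (dist ((SOME f. f \<in> F) \<omega>) ((SOME g. g \<in> K) \<omega>))\<^sup>2) = (LINT \<omega>|M. (dist (f \<omega>) (g \<omega>))\<^sup>2)"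
  proof (rule integral_cong_AE)
    show "AE \<omega> in M. (dist ((SOME f. f \<in> F) \<omega>) ((SOME g. g \<in> K) \<omega>))\<^sup>2 = (dist (f \<omega>) (g \<omega>))\<^sup>2"
      using AE by eventually_elim simp
  qed measurable
  then show ?thesis by (simp add: L2_dist_def)
qed

lemma L2_isometry_of_class_map:
  fixes \<gamma> :: "('a \<Rightarrow> 'x::polish_space) set \<Rightarrow> ('a \<Rightarrow> 'x) set"
  assumes M: "prob_space M" and X: "CAT0 (UNIV :: 'x set) dist" "geodesically_complete (UNIV :: 'x set) dist"
    "affinely_rigid_CAT0 (UNIV :: 'x set) dist" "\<not> (\<exists>h :: 'x \<Rightarrow> real. isometry UNIV dist UNIV dist h)"
    "\<exists>a b :: 'x. a \<noteq> b"
    and \<gamma>: "isometry (L2 M) (L2_dist M) (L2 M) (L2_dist M) \<gamma>"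
  obtains G H where "L2_isometry M G H" "\<And>f. f \<in> L2_fun M \<Longrightarrow> G f \<in> \<gamma> (L2_class M f)"
proof -
  have bij: "bij_betw \<gamma> (L2 M) (L2 M)" and iso: "\<And>F K. F \<in> L2 M \<Longrightarrow> K \<in> L2 M \<Longrightarrow> L2_dist M (\<gamma> F) (\<gamma> K) = L2_dist M F K"
    using \<gamma> by (auto simp: isometry_def)
  define \<delta> where "\<delta> = the_inv_into (L2 M) \<gamma>"
  have \<gamma>in: "\<gamma> F \<in> L2 M" if "F \<in> L2 M" for F using bij that by (auto simp: bij_betw_def)
  have \<delta>in: "\<delta> F \<in> L2 M" and \<gamma>\<delta>: "\<gamma> (\<delta> F) = F" and \<delta>\<gamma>: "\<delta> (\<gamma> F) = F" if "F \<in> L2 M" for F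
    using bij that the_inv_into_into[of \<gamma> "L2 M" F "L2 M"] f_the_inv_into_f_bij_betw[OF bij]
      the_inv_into_f_f[of \<gamma> "L2 M" F] unfolding \<delta>_def bij_betw_def by auto
  have iso': "L2_dist M (\<delta> F) (\<delta> K) = L2_dist M F K" if "F \<in> L2 M" "K \<in> L2 M" for F K
    using iso[OF \<delta>in \<delta>in] that \<gamma>\<delta> by simp
  define G where "G f = (SOME g. g \<in> \<gamma> (L2_class M f))" for f
  define H where "H f = (SOME g. g \<in> \<delta> (L2_class M f))" for f
  have Gin: "G f \<in> \<gamma> (L2_class M f)" if "f \<in> L2_fun M" for f
    unfolding G_def using L2_nonempty[OF \<gamma>in[OF L2_class_in_L2[OF that]]] by (rule someI_ex)
  have Hin: "H f \<in> \<delta> (L2_class M f)" if "f \<in> L2_fun M" for f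
    unfolding H_def using L2_nonempty[OF \<delta>in[OF L2_class_in_L2[OF that]]] by (rule someI_ex)
  have GL: "G f \<in> L2_fun M" "\<gamma> (L2_class M f) = L2_class M (G f)" if "f \<in> L2_fun M" for f
    using mem_L2_D[OF \<gamma>in[OF L2_class_in_L2[OF that]] Gin[OF that]] by auto
  have HL: "H f \<in> L2_fun M" "\<delta> (L2_class M f) = L2_class M (H f)" if "f \<in> L2_fun M" for f
    using mem_L2_D[OF \<delta>in[OF L2_class_in_L2[OF that]] Hin[OF that]] by auto
  \<comment> \<open>Stated for an arbitrary class map \<open>c\<close>, so that it serves both
    \<open>\<gamma>\<close> and its inverse \<open>\<delta>\<close>.\<close>
  have embed: "(LINT \<omega>|M. (dist (K f \<omega>) (K g \<omega>))\<^sup>2) = (LINT \<omega>|M. (dist (f \<omega>) (g \<omega>))\<^sup>2)"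
    if L2: "f \<in> L2_fun M" "g \<in> L2_fun M" and c: "\<And>F. F \<in> L2 M \<Longrightarrow> c F \<in> L2 M"
      "\<And>f. f \<in> L2_fun M \<Longrightarrow> K f \<in> c (L2_class M f)"
      "\<And>F F'. F \<in> L2 M \<Longrightarrow> F' \<in> L2 M \<Longrightarrow> L2_dist M (c F) (c F') = L2_dist M F F'"
    for f g and c :: "('a \<Rightarrow> 'x) set \<Rightarrow> ('a \<Rightarrow> 'x) set" and K
  proof -
    note F = L2_class_in_L2[OF L2(1)] L2_class_in_L2[OF L2(2)]
    have "sqrt (LINT \<omega>|M. (dist (K f \<omega>) (K g \<omega>))\<^sup>2) = sqrt (LINT \<omega>|M. (dist (f \<omega>) (g \<omega>))\<^sup>2)"
      using L2_dist_eq[OF c(1)[OF F(1)] c(2)[OF L2(1)] c(1)[OF F(2)] c(2)[OF L2(2)]]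
        L2_dist_eq[OF F(1) L2_class_self[OF L2(1)] F(2) L2_class_self[OF L2(2)]] c(3)[OF F] by simp
    then show ?thesis by simp
  qed
  interpret prob_space M by (rule M)
  have emb: "L2_embedding M G" "L2_embedding M H"
    by unfold_locales (use X GL(1) HL(1) embed[OF _ _ \<gamma>in Gin iso] embed[OF _ _ \<delta>in Hin iso'] in auto)
  have "L2_isometry M G H"
  proof (intro L2_isometry.intro emb L2_isometry_axioms.intro)
    fix f :: "'a \<Rightarrow> 'x" assume f: "f \<in> L2_fun M"
    have "L2_class M (G (H f)) = L2_class M f"
      using GL(2)[OF HL(1)[OF f]] HL(2)[OF f] \<gamma>\<delta>[OF L2_class_in_L2[OF f]] by simp
    then show "AE \<omega> in M. G (H f) \<omega> = f \<omega>"
      using L2_class_self[OF f] by (metis (no_types) mem_L2_class_iff)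
    have "L2_class M (H (G f)) = L2_class M f"
      using HL(2)[OF GL(1)[OF f]] GL(2)[OF f] \<delta>\<gamma>[OF L2_class_in_L2[OF f]] by simp
    then show "AE \<omega> in M. H (G f) \<omega> = f \<omega>"
      using L2_class_self[OF f] by (metis (no_types) mem_L2_class_iff)
  qed
  then show ?thesis using Gin by (rule that)
qed

text \<open>Distances are preserved by a change of variables on representatives, and injectivity
  follows because classes at distance 0 coincide. Surjectivity is where the measurable inverse of
  \<open>\<phi>\<close> is needed.\<close>

lemma isometry_if_representation:
  fixes \<gamma> :: "('a \<Rightarrow> 'x::polish_space) set \<Rightarrow> ('a \<Rightarrow> 'x) set"
  assumes std: "standard_prob_space M" and X: "CAT0 (UNIV :: 'x set) dist" and \<gamma>: "\<gamma> \<in> L2 M \<rightarrow> L2 M"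
    and \<phi>: "\<phi> \<in> measurable M M" "ae_bijective M \<phi>" "mutually_abs_continuous (distr M M \<phi>) M"
    and \<rho>: "AE \<omega> in M. \<rho> \<omega> \<in> Dil (inverse (sqrt (enn2real (RN_deriv M (distr M M \<phi>) \<omega>)))) \<and> surj (\<rho> \<omega>)"
    and rep: "\<forall>F\<in>L2 M. \<forall>f\<in>F. \<forall>g\<in>\<gamma> F. AE \<omega> in M. g \<omega> = \<rho> (\<phi> \<omega>) (f (\<phi> \<omega>))"
  shows "isometry (L2 M) (L2_dist M) (L2 M) (L2_dist M) \<gamma>"
proof -
  obtain e j \<Omega> R where "standard_coordinates M e j \<Omega> R" using standard_coordinates_exist[OF std] .
  then interpret standard_coordinates M e j \<Omega> R .
  interpret nonsingular_map M \<phi> by unfold_locales (rule \<phi>)+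
  interpret ae_bijection M \<phi> e j \<Omega> R by unfold_locales (rule \<phi>)
  have gs: "geodesic_space (UNIV :: 'x set) dist" using X by (simp add: CAT0_def)
  have \<gamma>in: "\<gamma> F \<in> L2 M" if "F \<in> L2 M" for F using \<gamma> that by blast
  define G where "G f = (SOME g. g \<in> \<gamma> (L2_class M f))" for f
  have Gin: "G f \<in> \<gamma> (L2_class M f)" if "f \<in> L2_fun M" for f
    unfolding G_def using L2_nonempty[OF \<gamma>in[OF L2_class_in_L2[OF that]]] by (rule someI_ex)
  have GL: "G f \<in> L2_fun M" "\<gamma> (L2_class M f) = L2_class M (G f)" if "f \<in> L2_fun M" for f
    using mem_L2_D[OF \<gamma>in[OF L2_class_in_L2[OF that]] Gin[OF that]] by auto
  have Grep: "AE \<omega> in M. G f \<omega> = \<rho> (\<phi> \<omega>) (f (\<phi> \<omega>))" if f: "f \<in> L2_fun M" for f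
    using rep L2_class_in_L2[OF f] L2_class_self[OF f] Gin[OF f] by blast
  have iso: "(LINT \<omega>|M. (dist (G f \<omega>) (G g \<omega>))\<^sup>2) = (LINT \<omega>|M. (dist (f \<omega>) (g \<omega>))\<^sup>2)"
    if "f \<in> L2_fun M" "g \<in> L2_fun M" for f g
    by (rule isometric[where G = G and \<rho> = \<rho>, OF gs \<rho>[folded dens_def] _ _ that]) (rule GL(1) Grep, assumption)+
  have sur: "\<exists>f\<in>L2_fun M. AE \<omega> in M. G f \<omega> = g \<omega>" if "g \<in> L2_fun M" for g
    by (rule surjective[where G = G and \<rho> = \<rho>, OF gs \<rho>[folded dens_def] _ _ that]) (rule GL(1) Grep, assumption)+
  have dist: "L2_dist M (\<gamma> F) (\<gamma> K) = L2_dist M F K" if FK: "F \<in> L2 M" "K \<in> L2 M" for F K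
  proof -
    obtain f g where fg: "f \<in> F" "g \<in> K" using L2_nonempty FK by blast
    have L: "f \<in> L2_fun M" "g \<in> L2_fun M" "F = L2_class M f" "K = L2_class M g"
      using mem_L2_D[OF FK(1) fg(1)] mem_L2_D[OF FK(2) fg(2)] by auto
    have "L2_dist M (\<gamma> F) (\<gamma> K) = sqrt (LINT \<omega>|M. (dist (G f \<omega>) (G g \<omega>))\<^sup>2)"
      using L Gin FK by (intro L2_dist_eq \<gamma>in) auto
    also have "\<dots> = L2_dist M F K" using L2_dist_eq[OF FK(1) fg(1) FK(2) fg(2)] iso[OF L(1,2)] by simp
    finally show ?thesis .
  qed
  have zero: "F = K" if FK: "F \<in> L2 M" "K \<in> L2 M" and d: "L2_dist M F K = 0" for F K :: "('a \<Rightarrow> 'x) set"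
  proof -
    obtain f g where fg: "f \<in> F" "g \<in> K" using L2_nonempty FK by blast
    have L: "f \<in> L2_fun M" "g \<in> L2_fun M" "F = L2_class M f" "K = L2_class M g"
      using mem_L2_D[OF FK(1) fg(1)] mem_L2_D[OF FK(2) fg(2)] by auto
    have "(LINT \<omega>|M. (dist (f \<omega>) (g \<omega>))\<^sup>2) = 0" using d L2_dist_eq[OF FK(1) fg(1) FK(2) fg(2)] by simp
    then have "AE \<omega> in M. (dist (f \<omega>) (g \<omega>))\<^sup>2 = 0"
      using L2_fun_integrable_dist[OF finite_measure_axioms L(1,2)] by (subst integral_nonneg_eq_0_iff_AE[symmetric]) auto
    then have "g \<in> L2_class M f" using L by (simp add: mem_L2_class_iff)
    then show ?thesis using L L2_class_eq_iff by blast
  qed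
  have self: "L2_dist M F F = 0" if F: "F \<in> L2 M" for F :: "('a \<Rightarrow> 'x) set"
  proof -
    obtain f where "f \<in> F" using L2_nonempty F by blast
    then show ?thesis using L2_dist_eq[OF F _ F] by simp
  qed
  have "inj_on \<gamma> (L2 M)"
  proof (rule inj_onI)
    fix F K assume FK: "F \<in> L2 M" "K \<in> L2 M" "\<gamma> F = \<gamma> K"
    then have "L2_dist M F K = 0" using dist[OF FK(1,2)] self[OF \<gamma>in[OF FK(2)]] by simp
    then show "F = K" by (rule zero[OF FK(1,2)])
  qed
  moreover have "\<gamma> ` L2 M = L2 M"
  proof
    show "\<gamma> ` L2 M \<subseteq> L2 M" using \<gamma>in by blast
    show "L2 M \<subseteq> \<gamma> ` L2 M"
    proof
      fix K :: "('a \<Rightarrow> 'x) set" assume K: "K \<in> L2 M"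
      obtain g where g: "g \<in> K" using L2_nonempty K by blast
      have gL: "g \<in> L2_fun M" "K = L2_class M g" using mem_L2_D[OF K g] by auto
      obtain f where f: "f \<in> L2_fun M" "AE \<omega> in M. G f \<omega> = g \<omega>" using sur[OF gL(1)] by blast
      have "g \<in> L2_class M (G f)" using f gL GL by (simp add: mem_L2_class_iff)
      then have "K = \<gamma> (L2_class M f)" using gL GL[OF f(1)] L2_class_eq_iff by blast
      then show "K \<in> \<gamma> ` L2 M" using L2_class_in_L2[OF f(1)] by blast
    qed
  qed
  ultimately show ?thesis using dist by (auto simp: isometry_def bij_betw_def)
qed

text \<open>Geodesics of a one-point space have at most one parameter, so every nonnegative factor
  is a dilation factor and the identity serves for both maps.\<close>

lemma trivial_representation:
  fixes \<gamma> :: "('a \<Rightarrow> 'x::polish_space) set \<Rightarrow> ('a \<Rightarrow> 'x) set"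
  assumes M: "prob_space M" and one: "\<And>a b :: 'x. a = b"
  shows "\<exists>\<phi> (\<rho> :: 'a \<Rightarrow> 'x \<Rightarrow> 'x).
       \<phi> \<in> measurable M M \<and> ae_bijective M \<phi> \<and>
       mutually_abs_continuous (distr M M \<phi>) M \<and>
       (AE \<omega> in M. \<rho> \<omega> \<in> Dil (inverse (sqrt (enn2real (RN_deriv M (distr M M \<phi>) \<omega>)))) \<and>
                    surj (\<rho> \<omega>)) \<and>
       (\<exists>x. \<exists>g\<in>L2_fun (distr M M \<phi>). AE \<omega> in M. \<rho> \<omega> x = g \<omega>) \<and>
       (\<forall>F\<in>L2 M. \<forall>f\<in>F. \<forall>g\<in>\<gamma> F. AE \<omega> in M. g \<omega> = \<rho> (\<phi> \<omega>) (f (\<phi> \<omega>)))"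
proof -
  interpret prob_space M by (rule M)
  have d0: "dist a b = 0" for a b :: 'x using one[of a b] by simp
  have D: "(\<lambda>x :: 'x. x) \<in> Dil (inverse (sqrt (enn2real z)))" for z
  proof -
    have "inverse (sqrt (enn2real z)) * \<bar>s - t\<bar> = 0" if "geodesic UNIV dist I c" "s \<in> I" "t \<in> I"
      for I and c :: "real \<Rightarrow> 'x" and s t
    proof -
      have "dist (c s) (c t) = \<bar>s - t\<bar>" using that unfolding geodesic_def by blast
      then have "\<bar>s - t\<bar> = 0" by (simp only: d0)
      then show ?thesis by simp
    qed
    then show ?thesis unfolding Dil_def dilation_by_def by (auto simp: d0)
  qed
  have c: "(\<lambda>_. undefined :: 'x) \<in> L2_fun (distr M M (\<lambda>\<omega>. \<omega>))"
    by (rule L2_fun_const) (simp add: finite_measure_axioms)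
  show ?thesis
  proof (intro exI[of _ "\<lambda>\<omega>. \<omega>"] exI[of _ "\<lambda>_ x. x"] conjI)
    show "ae_bijective M (\<lambda>\<omega>. \<omega>)"
      unfolding ae_bijective_def by (intro bexI[of _ "{}"]) (auto simp: bij_betw_def inj_on_def)
    show "mutually_abs_continuous (distr M M (\<lambda>\<omega>. \<omega>)) M"
      by (simp add: mutually_abs_continuous_def absolutely_continuous_def)
    show "\<exists>x :: 'x. \<exists>g\<in>L2_fun (distr M M (\<lambda>\<omega>. \<omega>)). AE \<omega> in M. x = g \<omega>"
      by (intro exI[of _ undefined] bexI[OF _ c]) simp
    show "\<forall>F\<in>L2 M. \<forall>f\<in>F. \<forall>g\<in>\<gamma> F. AE \<omega> in M. g \<omega> = f \<omega>" using one by simp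
  qed (use D in \<open>auto simp: surj_def\<close>)
qed

theorem theorem4:
  fixes M :: "'a measure"
    and \<gamma> :: "('a \<Rightarrow> 'x::polish_space) set \<Rightarrow> ('a \<Rightarrow> 'x) set"
  assumes "standard_prob_space M"
    and "CAT0 (UNIV :: 'x set) dist"
    and "geodesically_complete (UNIV :: 'x set) dist"
    and "affinely_rigid_CAT0 (UNIV :: 'x set) dist"
    and "\<not> (\<exists>h :: 'x \<Rightarrow> real. isometry UNIV dist UNIV dist h)"
    and "\<gamma> \<in> L2 M \<rightarrow> L2 M"
  shows "isometry (L2 M) (L2_dist M) (L2 M) (L2_dist M) \<gamma> \<longleftrightarrow>
    (\<exists>\<phi> (\<rho> :: 'a \<Rightarrow> 'x \<Rightarrow> 'x).
       \<phi> \<in> measurable M M \<and> ae_bijective M \<phi> \<and>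
       mutually_abs_continuous (distr M M \<phi>) M \<and>
       (AE \<omega> in M. \<rho> \<omega> \<in> Dil (inverse (sqrt (enn2real (RN_deriv M (distr M M \<phi>) \<omega>)))) \<and>
                    surj (\<rho> \<omega>)) \<and>
       (\<exists>x. \<exists>g\<in>L2_fun (distr M M \<phi>). AE \<omega> in M. \<rho> \<omega> x = g \<omega>) \<and>
       (\<forall>F\<in>L2 M. \<forall>f\<in>F. \<forall>g\<in>\<gamma> F. AE \<omega> in M. g \<omega> = \<rho> (\<phi> \<omega>) (f (\<phi> \<omega>))))"
    (is "?iso \<longleftrightarrow> ?rep")
proof
  assume ?rep
  then show ?iso using isometry_if_representation[OF assms(1,2,6)] by blast
next
  assume iso: ?iso
  have M: "prob_space M" using assms(1) by (simp add: standard_prob_space_def)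
  show ?rep
  proof (cases "\<exists>a b :: 'x. a \<noteq> b")
    case False
    then have "a = b" for a b :: 'x by blast
    then show ?thesis by (rule trivial_representation[OF M])
  next
    case True
    obtain G H where GH: "L2_isometry M G H" and Gin: "\<And>f. f \<in> L2_fun M \<Longrightarrow> G f \<in> \<gamma> (L2_class M f)"
      using L2_isometry_of_class_map[OF M assms(2-5) True iso] by blast
    obtain e j \<Omega> R where "standard_coordinates M e j \<Omega> R" using standard_coordinates_exist[OF assms(1)] .
    then interpret L2_isometry_standard M G H e j \<Omega> R using GH by (intro L2_isometry_standard.intro)
    obtain \<phi> and \<rho> :: "'a \<Rightarrow> 'x \<Rightarrow> 'x" where \<phi>\<rho>: "\<phi> \<in> measurable M M" "ae_bijective M \<phi>" "mutually_abs_continuous (distr M M \<phi>) M"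
      "AE \<omega> in M. \<rho> \<omega> \<in> Dil (inverse (sqrt (enn2real (RN_deriv M (distr M M \<phi>) \<omega>)))) \<and> surj (\<rho> \<omega>)"
      "\<exists>x. \<exists>g\<in>L2_fun (distr M M \<phi>). AE \<omega> in M. \<rho> \<omega> x = g \<omega>"
      and G: "\<forall>f\<in>L2_fun M. AE \<omega> in M. G f \<omega> = \<rho> (\<phi> \<omega>) (f (\<phi> \<omega>))"
      using representation by blast
    have "AE \<omega> in M. g \<omega> = \<rho> (\<phi> \<omega>) (f (\<phi> \<omega>))" if F: "F \<in> L2 M" "f \<in> F" "g \<in> \<gamma> F" for F f g
    proof -
      have f: "f \<in> L2_fun M" "F = L2_class M f" using mem_L2_D[OF F(1,2)] by auto
      have "\<gamma> F \<in> L2 M" using assms(6) F(1) by blast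
      then have "\<gamma> F = L2_class M (G f)" using mem_L2_D(2)[OF _ Gin[OF f(1)]] f(2) by blast
      then have "AE \<omega> in M. G f \<omega> = g \<omega>" using F(3) by (simp add: mem_L2_class_iff)
      with bspec[OF G f(1)] show ?thesis by eventually_elim simp
    qed
    then show ?thesis using \<phi>\<rho> by blast
  qed
qed

end
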